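(* Let $(\Phi^{(j)})_{j=1}^\infty$ be a non-autonomous IFS on a compact metric space $X$ with limit set $J$, and let $\mathcal N_{0,k}$ ($k\ge1$) be its associated nerves. Let $G$ be an abelian group. Then for every $q\ge0$ the inverse limit $\varprojlim_k H_q(\mathcal N_{0,k};G)$ is isomorphic to the Čech homology group $\check H_q(J;G)$. Dually, for every $q\ge 0$ the direct limit $\varinjlim_k H^q(\mathcal N_{0,k};G)$ is isomorphic to the Čech cohomology group $\check H^q(J;G)$.
   Context: Let $X$ be a non-empty compact metric space; $\mathrm{Lip}(f)$ denotes the Lipschitz constant of $f\colon X\to X$. A non-autonomous IFS $(\Phi^{(j)})_{j\ge1}$ on $X$ is a sequence of collections $\Phi^{(j)}=\{f^{(j)}_i\colon X\to X\}_{i\in I^{(j)}}$ of maps, with each index set $I^{(j)}$ finite and non-empty, such that there is a constant $c<1$ with $\mathrm{Lip}(f^{(j)}_i)\le c$ for all $j\ge1$, $i\in I^{(j)}$. Its coding map $\Pi\colon\prod_{j\ge1}I^{(j)}\to X$ is defined by $\{\Pi(i_1,i_2,\dots)\}=\bigcap_{j\ge1}f^{(1)}_{i_1}\circ\cdots\circ f^{(j)}_{i_j}(X)$, and its limit set is $J=\Pi(\prod_{j\ge1}I^{(j)})$. For $j\ge0$, $J_j$ denotes the limit set of the shifted system $(\Phi^{(j+k)})_{k\ge1}$, so $J_0=J$. For $0\le j<k$ and $v=(i_{j+1},\dots,i_k)\in I^{(j+1)}\times\cdots\times I^{(k)}$ put $f_v=f^{(j+1)}_{i_{j+1}}\circ\cdots\circ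 f^{(k)}_{i_k}$. The nerve $\mathcal N_{j,k}$ is the abstract simplicial complex with vertex set $I^{(j+1)}\times\cdots\times I^{(k)}$, in which a set $\{v_0,\dots,v_q\}$ of mutually distinct vertices is a simplex iff $\bigcap_{p=0}^q f_{v_p}(J_k)\ne\emptyset$. The simplicial map $\phi\colon\mathcal N_{j,k+1}\to\mathcal N_{j,k}$ sends $(i_{j+1},\dots,i_k,i_{k+1})$ to $(i_{j+1},\dots,i_k)$. The inverse and direct limits are taken along the induced maps $\phi_*\colon H_q(\mathcal N_{0,k+1};G)\to H_q(\mathcal N_{0,k};G)$ and $\phi^*\colon H^q(\mathcal N_{0,k};G)\to H^q(\mathcal N_{0,k+1};G)$ on simplicial (co)homology. Čech homology of a space $Y$ is $\check H_q(Y;G)=\varprojlim_{\mathfrak U}H_q(N(\mathfrak U);G)$, and Čech cohomology is $\check H^q(Y;G)=\varinjlim_{\mathfrak U}H^q(N(\mathfrak U);G)$, where $\mathfrak U$ runs over all finite open coverings of $Y$ ordered by refinement and $N(\mathfrak U)$ is the nerve of $\mathfrak U$. *)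

theory Defs
  imports
    "HOL-Analysis.Analysis"
    "HOL-Algebra.Product_Groups"
    "HOL-Combinatorics.Permutations"
    "HOL-Library.Function_Algebras"
begin

section \<open>Non-autonomous iterated function systems\<close>

locale nonautonomous_ifs =
  fixes X :: "'x::metric_space set"
    and I :: "nat \<Rightarrow> 'i set"
    and f :: "nat \<Rightarrow> 'i \<Rightarrow> 'x \<Rightarrow> 'x"
  assumes compact_space: "compact X"
    and nonempty_space: "X \<noteq> {}"
    and finite_index: "\<And>j. j \<ge> 1 \<Longrightarrow> finite (I j)"
    and nonempty_index: "\<And>j. j \<ge> 1 \<Longrightarrow> I j \<noteq> {}"
    and maps_into: "\<And>j i. j \<ge> 1 \<Longrightarrow> i \<in> I j \<Longrightarrow> f j i ` X \<subseteq> X"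
    and uniformly_contracting: "\<exists>c<1. \<forall>j\<ge>1. \<forall>i\<in>I j. c-lipschitz_on X (f j i)"

text \<open>The word \<open>[i\<^sub>j\<^sub>+\<^sub>1, \<dots>, i\<^sub>k]\<close> acts as the composition of the maps of levels \<open>j + 1, \<dots>, k\<close>, the map
  of level \<open>j + 1\<close> being applied last.\<close>

primrec word_map :: "(nat \<Rightarrow> 'i \<Rightarrow> 'x \<Rightarrow> 'x) \<Rightarrow> nat \<Rightarrow> 'i list \<Rightarrow> 'x \<Rightarrow> 'x" where
  "word_map f j [] = id"
| "word_map f j (i # v) = f (Suc j) i \<circ> word_map f (Suc j) v"

definition words :: "(nat \<Rightarrow> 'i set) \<Rightarrow> nat \<Rightarrow> nat \<Rightarrow> 'i list set" where
  "words I j k = listset (map I [Suc j..<Suc k])"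

definition coding_map :: "'x set \<Rightarrow> (nat \<Rightarrow> 'i \<Rightarrow> 'x \<Rightarrow> 'x) \<Rightarrow> (nat \<Rightarrow> 'i) \<Rightarrow> 'x" where
  "coding_map X f \<omega> = the_elem (\<Inter>j\<in>{1..}. word_map f 0 (map \<omega> [1..<Suc j]) ` X)"

definition limit_set ::
    "'x set \<Rightarrow> (nat \<Rightarrow> 'i set) \<Rightarrow> (nat \<Rightarrow> 'i \<Rightarrow> 'x \<Rightarrow> 'x) \<Rightarrow> 'x set" where
  "limit_set X I f = coding_map X f ` (\<Pi>\<^sub>E j\<in>{1..}. I j)"

definition shifted_limit_set ::
    "'x set \<Rightarrow> (nat \<Rightarrow> 'i set) \<Rightarrow> (nat \<Rightarrow> 'i \<Rightarrow> 'x \<Rightarrow> 'x) \<Rightarrow> nat \<Rightarrow> 'x set" where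
  "shifted_limit_set X I f j = limit_set X (\<lambda>k. I (j + k)) (\<lambda>k. f (j + k))"


section \<open>Simplicial complexes and their (co)homology\<close>

text \<open>An abstract simplicial complex is given by the set of its simplices, which are finite non-empty
  sets of vertices. The following is the nerve of an indexed family of sets.\<close>

definition nerve :: "'v set \<Rightarrow> ('v \<Rightarrow> 'a set) \<Rightarrow> 'v set set" where
  "nerve V F = {s. s \<subseteq> V \<and> s \<noteq> {} \<and> finite s \<and> (\<Inter>v\<in>s. F v) \<noteq> {}}"

definition ordered_simplices :: "nat \<Rightarrow> 'v set set \<Rightarrow> 'v list set" where
  "ordered_simplices q K = {\<sigma>. length \<sigma> = Suc q \<and> distinct \<sigma> \<and> set \<sigma> \<in> K}"

text \<open>Oriented \<open>q\<close>-chains: finitely supported functions on the oriented \<open>q\<close>-simplices which change sign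
  when the orientation is reversed. They are written as functions on the orderings of the simplices.\<close>

definition oriented_chains :: "nat \<Rightarrow> 'v set set \<Rightarrow> ('v list \<Rightarrow> 'g::ab_group_add) set" where
  "oriented_chains q K =
     {c. finite {\<sigma>. c \<sigma> \<noteq> 0} \<and> {\<sigma>. c \<sigma> \<noteq> 0} \<subseteq> ordered_simplices q K \<and>
         (\<forall>\<sigma>\<in>ordered_simplices q K. \<forall>p. p permutes {..<length \<sigma>} \<longrightarrow>
            c (permute_list p \<sigma>) = (if evenperm p then c \<sigma> else - c \<sigma>))}"

text \<open>The coefficient of the boundary at the oriented simplex \<open>w = [w\<^sub>1, \<dots>, w\<^sub>q]\<close>: the faces of a simplex
  that contribute to it are those of the form \<open>[v, w\<^sub>1, \<dots>, w\<^sub>q]\<close>, whose boundary contains \<open>w\<close> with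
  sign \<open>+1\<close>. There are no simplices of dimension \<open>-1\<close> (the homology is not reduced).\<close>

definition boundary_map :: "('v list \<Rightarrow> 'g::ab_group_add) \<Rightarrow> 'v list \<Rightarrow> 'g" where
  "boundary_map c w = (if w = [] then 0 else \<Sum>v\<in>{v. c (v # w) \<noteq> 0}. c (v # w))"

text \<open>The chain map of a simplicial map \<open>h\<close>: it sends the oriented simplex \<open>[v\<^sub>0, \<dots>, v\<^sub>q]\<close> to
  \<open>[h v\<^sub>0, \<dots>, h v\<^sub>q]\<close> if these vertices are distinct and to \<open>0\<close> otherwise.\<close>

definition simplicial_chain_map :: "('v \<Rightarrow> 'w) \<Rightarrow> ('v list \<Rightarrow> 'g::ab_group_add) \<Rightarrow> 'w list \<Rightarrow> 'g" where
  "simplicial_chain_map h c w =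
     (if distinct w then \<Sum>\<sigma>\<in>{\<sigma>. map h \<sigma> = w \<and> c \<sigma> \<noteq> 0}. c \<sigma> else 0)"

definition additive_group_on :: "'a::ab_group_add set \<Rightarrow> 'a monoid" where
  "additive_group_on S = \<lparr>carrier = S, monoid.mult = (+), one = 0\<rparr>"

definition cycles :: "nat \<Rightarrow> 'v set set \<Rightarrow> ('v list \<Rightarrow> 'g::ab_group_add) set" where
  "cycles q K = {c \<in> oriented_chains q K. boundary_map c = 0}"

definition boundaries :: "nat \<Rightarrow> 'v set set \<Rightarrow> ('v list \<Rightarrow> 'g::ab_group_add) set" where
  "boundaries q K = boundary_map ` oriented_chains (Suc q) K"

definition simplicial_homology ::
    "'g::ab_group_add itself \<Rightarrow> nat \<Rightarrow> 'v set set \<Rightarrow> ('v list \<Rightarrow> 'g) set monoid" where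
  "simplicial_homology _ q K = additive_group_on (cycles q K) Mod boundaries q K"

definition homology_class ::
    "nat \<Rightarrow> 'v set set \<Rightarrow> ('v list \<Rightarrow> 'g::ab_group_add) \<Rightarrow> ('v list \<Rightarrow> 'g) set" where
  "homology_class q K z = boundaries q K #>\<^bsub>additive_group_on (cycles q K)\<^esub> z"

text \<open>The map induced on homology by a simplicial map into \<open>L\<close>. All members of the coset \<open>P\<close> have the
  same image class, so the union is that single class.\<close>

definition homology_map ::
    "nat \<Rightarrow> 'w set set \<Rightarrow> ('v \<Rightarrow> 'w) \<Rightarrow> ('v list \<Rightarrow> 'g::ab_group_add) set \<Rightarrow> ('w list \<Rightarrow> 'g) set" where
  "homology_map q L h P = (\<Union>z\<in>P. homology_class q L (simplicial_chain_map h z))"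

text \<open>Cochains are the homomorphisms from the integral chains to the coefficient group, extended by \<open>0\<close>
  to all functions so that equality of cochains is equality on chains.\<close>

definition cochains :: "nat \<Rightarrow> 'v set set \<Rightarrow> (('v list \<Rightarrow> int) \<Rightarrow> 'g::ab_group_add) set" where
  "cochains q K =
     {u \<in> hom (additive_group_on (oriented_chains q K)) (additive_group_on UNIV).
        \<forall>c. c \<notin> oriented_chains q K \<longrightarrow> u c = 0}"

definition coboundary_map ::
    "nat \<Rightarrow> 'v set set \<Rightarrow> (('v list \<Rightarrow> int) \<Rightarrow> 'g::ab_group_add) \<Rightarrow> ('v list \<Rightarrow> int) \<Rightarrow> 'g" where
  "coboundary_map q K u = (\<lambda>c. if c \<in> oriented_chains (Suc q) K then u (boundary_map c) else 0)"

definition simplicial_cochain_map ::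
    "nat \<Rightarrow> 'v set set \<Rightarrow> ('v \<Rightarrow> 'w) \<Rightarrow> (('w list \<Rightarrow> int) \<Rightarrow> 'g::ab_group_add) \<Rightarrow>
     ('v list \<Rightarrow> int) \<Rightarrow> 'g" where
  "simplicial_cochain_map q K h u =
     (\<lambda>c. if c \<in> oriented_chains q K then u (simplicial_chain_map h c) else 0)"

definition cocycles :: "nat \<Rightarrow> 'v set set \<Rightarrow> (('v list \<Rightarrow> int) \<Rightarrow> 'g::ab_group_add) set" where
  "cocycles q K = {u \<in> cochains q K. coboundary_map q K u = 0}"

primrec coboundaries :: "nat \<Rightarrow> 'v set set \<Rightarrow> (('v list \<Rightarrow> int) \<Rightarrow> 'g::ab_group_add) set" where
  "coboundaries 0 K = {0}"
| "coboundaries (Suc q) K = coboundary_map q K ` cochains q K"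

definition simplicial_cohomology ::
    "'g::ab_group_add itself \<Rightarrow> nat \<Rightarrow> 'v set set \<Rightarrow> (('v list \<Rightarrow> int) \<Rightarrow> 'g) set monoid" where
  "simplicial_cohomology _ q K = additive_group_on (cocycles q K) Mod coboundaries q K"

definition cohomology_class ::
    "nat \<Rightarrow> 'v set set \<Rightarrow> (('v list \<Rightarrow> int) \<Rightarrow> 'g::ab_group_add) \<Rightarrow> (('v list \<Rightarrow> int) \<Rightarrow> 'g) set" where
  "cohomology_class q K u = coboundaries q K #>\<^bsub>additive_group_on (cocycles q K)\<^esub> u"

text \<open>The map induced on cohomology by a simplicial map defined on \<open>K\<close>.\<close>

definition cohomology_map ::
    "nat \<Rightarrow> 'v set set \<Rightarrow> ('v \<Rightarrow> 'w) \<Rightarrow> (('w list \<Rightarrow> int) \<Rightarrow> 'g::ab_group_add) set \<Rightarrow>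
     (('v list \<Rightarrow> int) \<Rightarrow> 'g) set" where
  "cohomology_map q K h P = (\<Union>u\<in>P. cohomology_class q K (simplicial_cochain_map q K h u))"


section \<open>Limits of groups\<close>

text \<open>The index set \<open>D\<close> is directed by the preorder \<open>R\<close>. For \<open>R i j\<close>, the bonding map \<open>b i j\<close> goes
  from \<open>A j\<close> to \<open>A i\<close> in an inverse system and from \<open>A i\<close> to \<open>A j\<close> in a direct system.\<close>

definition inverse_limit ::
    "'d set \<Rightarrow> ('d \<Rightarrow> 'd \<Rightarrow> bool) \<Rightarrow> ('d \<Rightarrow> 'a monoid) \<Rightarrow> ('d \<Rightarrow> 'd \<Rightarrow> 'a \<Rightarrow> 'a) \<Rightarrow> ('d \<Rightarrow> 'a) monoid" where
  "inverse_limit D R A b =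
     (product_group D A)
       \<lparr>carrier := {x \<in> carrier (product_group D A). \<forall>i\<in>D. \<forall>j\<in>D. R i j \<longrightarrow> b i j (x j) = x i}\<rparr>"

definition direct_limit_rel ::
    "'d set \<Rightarrow> ('d \<Rightarrow> 'd \<Rightarrow> bool) \<Rightarrow> ('d \<Rightarrow> 'a monoid) \<Rightarrow> ('d \<Rightarrow> 'd \<Rightarrow> 'a \<Rightarrow> 'a) \<Rightarrow>
     (('d \<times> 'a) \<times> ('d \<times> 'a)) set" where
  "direct_limit_rel D R A b =
     {((i, x), (j, y)). i \<in> D \<and> x \<in> carrier (A i) \<and> j \<in> D \<and> y \<in> carrier (A j) \<and>
        (\<exists>k\<in>D. R i k \<and> R j k \<and> b i k x = b j k y)}"

text \<open>The quotient of the disjoint union of the groups. Two classes are multiplied by multiplying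
  representatives of them that lie in a common group \<open>A i\<close>.\<close>

definition direct_limit ::
    "'d set \<Rightarrow> ('d \<Rightarrow> 'd \<Rightarrow> bool) \<Rightarrow> ('d \<Rightarrow> 'a monoid) \<Rightarrow> ('d \<Rightarrow> 'd \<Rightarrow> 'a \<Rightarrow> 'a) \<Rightarrow>
     ('d \<times> 'a) set monoid" where
  "direct_limit D R A b =
     \<lparr>carrier = (SIGMA i:D. carrier (A i)) // direct_limit_rel D R A b,
      monoid.mult = (\<lambda>P Q. direct_limit_rel D R A b ``
        {(i, x \<otimes>\<^bsub>A i\<^esub> y) | i x y. (i, x) \<in> P \<and> (i, y) \<in> Q}),
      one = direct_limit_rel D R A b `` {(i, \<one>\<^bsub>A i\<^esub>) | i. i \<in> D}\<rparr>"


section \<open>\v{C}ech homology and cohomology\<close>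

definition finite_open_coverings :: "'a topology \<Rightarrow> 'a set set set" where
  "finite_open_coverings Y = {\<U>. finite \<U> \<and> (\<forall>U\<in>\<U>. openin Y U) \<and> \<Union>\<U> = topspace Y}"

definition refined_by :: "'a set set \<Rightarrow> 'a set set \<Rightarrow> bool" where
  "refined_by \<U> \<V> \<longleftrightarrow> (\<forall>V\<in>\<V>. \<exists>U\<in>\<U>. V \<subseteq> U)"

text \<open>Any two such choices give contiguous simplicial maps between the nerves, hence the same maps on
  homology and cohomology.\<close>

definition refinement_projection :: "'a set set \<Rightarrow> 'a set \<Rightarrow> 'a set" where
  "refinement_projection \<U> V = (SOME U. U \<in> \<U> \<and> V \<subseteq> U)"

definition covering_nerve :: "'a set set \<Rightarrow> 'a set set set" where
  "covering_nerve \<U> = nerve \<U> (\<lambda>U. U)"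

definition cech_homology ::
    "'g::ab_group_add itself \<Rightarrow> nat \<Rightarrow> 'a topology \<Rightarrow> ('a set set \<Rightarrow> ('a set list \<Rightarrow> 'g) set) monoid" where
  "cech_homology G q Y =
     inverse_limit (finite_open_coverings Y) refined_by
       (\<lambda>\<U>. simplicial_homology G q (covering_nerve \<U>))
       (\<lambda>\<U> \<V>. homology_map q (covering_nerve \<U>) (refinement_projection \<U>))"

definition cech_cohomology ::
    "'g::ab_group_add itself \<Rightarrow> nat \<Rightarrow> 'a topology \<Rightarrow>
     ('a set set \<times> (('a set list \<Rightarrow> int) \<Rightarrow> 'g) set) set monoid" where
  "cech_cohomology G q Y =
     direct_limit (finite_open_coverings Y) refined_by
       (\<lambda>\<U>. simplicial_cohomology G q (covering_nerve \<U>))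
       (\<lambda>\<U> \<V>. cohomology_map q (covering_nerve \<V>) (refinement_projection \<U>))"


section \<open>The nerves of a non-autonomous iterated function system\<close>

definition ifs_nerve ::
    "'x set \<Rightarrow> (nat \<Rightarrow> 'i set) \<Rightarrow> (nat \<Rightarrow> 'i \<Rightarrow> 'x \<Rightarrow> 'x) \<Rightarrow> nat \<Rightarrow> nat \<Rightarrow> 'i list set set" where
  "ifs_nerve X I f j k = nerve (words I j k) (\<lambda>v. word_map f j v ` shifted_limit_set X I f k)"

text \<open>The simplicial map from the nerve of words ending at level \<open>m + 1\<close> to that of words ending at
  level \<open>m\<close> is \<^const>\<open>butlast\<close>. The bonding map between the levels \<open>j \<le> k\<close> is the composite of the
  induced maps for \<open>m = j, \<dots>, k - 1\<close>.\<close>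

definition ifs_nerve_homology_limit ::
    "'g::ab_group_add itself \<Rightarrow> nat \<Rightarrow> 'x set \<Rightarrow> (nat \<Rightarrow> 'i set) \<Rightarrow> (nat \<Rightarrow> 'i \<Rightarrow> 'x \<Rightarrow> 'x) \<Rightarrow>
     (nat \<Rightarrow> ('i list list \<Rightarrow> 'g) set) monoid" where
  "ifs_nerve_homology_limit G q X I f =
     inverse_limit {1..} (\<le>)
       (\<lambda>k. simplicial_homology G q (ifs_nerve X I f 0 k))
       (\<lambda>j k. foldr (\<lambda>m. homology_map q (ifs_nerve X I f 0 m) butlast) [j..<k])"

definition ifs_nerve_cohomology_limit ::
    "'g::ab_group_add itself \<Rightarrow> nat \<Rightarrow> 'x set \<Rightarrow> (nat \<Rightarrow> 'i set) \<Rightarrow> (nat \<Rightarrow> 'i \<Rightarrow> 'x \<Rightarrow> 'x) \<Rightarrow>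
     (nat \<times> (('i list list \<Rightarrow> int) \<Rightarrow> 'g) set) set monoid" where
  "ifs_nerve_cohomology_limit G q X I f =
     direct_limit {1..} (\<le>)
       (\<lambda>k. simplicial_cohomology G q (ifs_nerve X I f 0 k))
       (\<lambda>j k. fold (\<lambda>m. cohomology_map q (ifs_nerve X I f 0 (Suc m)) butlast) [j..<k])"

end

theory Submission
  imports Defs
begin

text \<open>
  Write \<open>F v\<close> for the image of the limit set of the \<open>k\<close>-th shifted system under the map of a word \<open>v\<close> of
  length \<open>k\<close>; these sets are called cylinders below (\<open>cylinder\<close>). For fixed \<open>k\<close> they form a finite
  covering of the limit set \<open>J\<close> by compact sets, their diameters tend to \<open>0\<close> uniformly as \<open>k\<close> grows,
  and the cylinder of a word lies in the cylinders of its prefixes. The complex \<open>N\<^sub>0\<^sub>,\<^sub>k\<close> is the nerve of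
  the cylinders of level \<open>k\<close>.

  Say that a vertex map between the nerves of two families of sets is a nerve map if it sends each
  index to the index of a larger set (\<open>nerve_map\<close>). Deleting the last letter of a word and passing
  to a coarser covering are nerve maps, and so is every choice, for each word \<open>v\<close> of length \<open>k\<close>, of a
  member of a covering that contains \<open>F v\<close>. Any two nerve maps between the same families are
  contiguous, since a point common to the sets of a simplex lies in the sets of all image vertices.
  Contiguous maps induce the same map on homology and on cohomology, so all diagrams of nerve maps
  commute there, and the choices involved are harmless.

  Hence, whenever the cylinders of level \<open>k\<close> refine a finite open covering \<open>u\<close>, there is a canonical
  map from the homology of \<open>N\<^sub>0\<^sub>,\<^sub>k\<close> to that of the nerve of \<open>u\<close>, and these maps are compatible with both
  inverse systems. Such a \<open>k\<close> exists for every \<open>u\<close>, as the cylinders shrink. To see that the limits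
  agree it remains to find a cofinal sequence of coverings for which these maps are bijective. By
  compactness, sufficiently small neighbourhoods of the cylinders of level \<open>k\<close> in \<open>J\<close> have the same
  nerve as the cylinders (\<open>nerve_thickening\<close>). They form an open covering for which the map is
  bijective (\<open>nerve_homology_bij\<close>); with radii tending to \<open>0\<close> these coverings are cofinal
  (\<open>thickened_covering_cofinal\<close>). The purely algebraic conclusion is \<open>inverse_limit_iso\<close>, and dually
  \<open>direct_limit_iso\<close> for cohomology.

  The invariance under contiguity is proved on the level of chains. A chain \<open>c\<close> is an alternating
  function on lists of vertices; its slice \<open>\<lambda>w. c (a # w)\<close> at a vertex \<open>a\<close> represents the link of \<open>a\<close> in
  \<open>c\<close>. If \<open>g\<close> and \<open>h\<close> differ at \<open>a\<close> only, the chain homotopy takes the slice of \<open>c\<close> at \<open>a\<close>, pushes it forward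
  by \<open>h\<close> and forms the cone with apex \<open>g a\<close> and then the cone with apex \<open>h a\<close> (\<open>single_vertex_homotopy\<close>).
  General contiguous maps are connected by changing one vertex at a time
  (\<open>contiguous_chain_homotopy\<close>). Since the coefficient group may have elements of order two,
  alternating functions are also required to vanish at lists with repeated entries.
\<close>

section \<open>Alternating functions on lists\<close>

text \<open>The oriented chains of a complex are alternating functions on lists of vertices, in the following
  sense: they change sign when two neighbouring entries are exchanged, and they vanish when two
  neighbouring entries agree. Coefficients may have order two, so the second condition does not
  follow from the first.\<close>

definition alternating :: "('v list \<Rightarrow> 'g::ab_group_add) \<Rightarrow> bool" where
  "alternating c \<longleftrightarrow>
     (\<forall>u a b w. c (u @ a # b # w) = - c (u @ b # a # w)) \<and> (\<forall>u a w. c (u @ a # a # w) = 0)"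

lemma alternating_swap: "alternating c \<Longrightarrow> c (u @ a # b # w) = - c (u @ b # a # w)"
  unfolding alternating_def by blast

lemma alternating_repeat: "alternating c \<Longrightarrow> c (u @ a # a # w) = 0"
  unfolding alternating_def by blast

lemma alternating_swap_front: "alternating c \<Longrightarrow> c (a # b # w) = - c (b # a # w)"
  using alternating_swap[of c "[]" a b w] by simp

lemma alternating_repeat_front: "alternating c \<Longrightarrow> c (a # a # w) = 0"
  using alternating_repeat[of c "[]"] by simp

lemma alternating_slice:
  assumes "alternating c"
  shows "alternating (\<lambda>w. c (v # w))"
proof -
  have "c (v # u @ a # b # w) = - c (v # u @ b # a # w)" for u a b w
    using alternating_swap[OF assms, of "v # u" a b w] by simp
  moreover have "c (v # u @ a # a # w) = 0" for u a w
    using alternating_repeat[OF assms, of "v # u" a w] by simp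
  ultimately show ?thesis
    unfolding alternating_def by blast
qed

lemma alternating_zero: "alternating (\<lambda>_. 0)"
  by (simp add: alternating_def)

lemma alternating_add:
  assumes "alternating c" "alternating d"
  shows "alternating (\<lambda>w. c w + d w)"
proof -
  have "c (u @ a # b # w) + d (u @ a # b # w) = - (c (u @ b # a # w) + d (u @ b # a # w))" for u a b w
    using alternating_swap[OF assms(1), of u a b w] alternating_swap[OF assms(2), of u a b w] by simp
  moreover have "c (u @ a # a # w) + d (u @ a # a # w) = 0" for u a w
    using alternating_repeat[OF assms(1)] alternating_repeat[OF assms(2)] by simp
  ultimately show ?thesis
    unfolding alternating_def by blast
qed

lemma alternating_uminus:
  assumes "alternating c"
  shows "alternating (\<lambda>w. - c w)"
proof -
  have "- c (u @ a # b # w) = - (- c (u @ b # a # w))" for u a b w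
    using alternating_swap[OF assms, of u a b w] by simp
  moreover have "- c (u @ a # a # w) = 0" for u a w
    using alternating_repeat[OF assms, of u a w] by simp
  ultimately show ?thesis
    unfolding alternating_def by blast
qed

lemma alternating_sum:
  "(\<And>v. v \<in> V \<Longrightarrow> alternating (c v)) \<Longrightarrow> alternating (\<lambda>w. \<Sum>v\<in>V. c v w)"
  by (induction V rule: infinite_finite_induct) (auto intro: alternating_zero alternating_add)

text \<open>Moving an entry past the list \<open>m\<close> costs one sign for each entry of \<open>m\<close>.\<close>

lemma alternating_move:
  "alternating c \<Longrightarrow> c (u @ a # m @ w) = (if even (length m) then c (u @ m @ a # w) else - c (u @ m @ a # w))"
proof (induction m arbitrary: u)
  case (Cons b m)
  have "c (u @ a # b # m @ w) = - c ((u @ [b]) @ a # m @ w)"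
    using alternating_swap[OF Cons.prems, of u a b "m @ w"] by simp
  then show ?case
    using Cons.IH[OF Cons.prems, of "u @ [b]"] by auto
qed simp

lemma alternating_not_distinct:
  assumes "alternating c" "\<not> distinct \<sigma>"
  shows "c \<sigma> = 0"
proof -
  obtain u m w a where \<sigma>: "\<sigma> = u @ a # m @ a # w"
    using not_distinct_decomp[OF assms(2)] by auto
  have "c (u @ m @ a # a # w) = 0"
    using alternating_repeat[OF assms(1), of "u @ m" a w] by simp
  then show ?thesis
    using alternating_move[OF assms(1), of u a m "a # w"] \<sigma> by auto
qed

lemma alternating_exchange:
  assumes "alternating c"
  shows "c (u @ a # m @ b # w) = - c (u @ b # m @ a # w)"
proof -
  have "c (u @ m @ a # b # w) = - c (u @ m @ b # a # w)"
    using alternating_swap[OF assms, of "u @ m" a b w] by simp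
  then show ?thesis
    using alternating_move[OF assms, of u a m "b # w"] alternating_move[OF assms, of u b m "a # w"]
    by auto
qed

lemma alternating_transpose:
  assumes "alternating c" "i < j" "j < length \<sigma>"
  shows "c (permute_list (Transposition.transpose i j) \<sigma>) = - c \<sigma>"
proof -
  define u m w where "u = take i \<sigma>" and "m = take (j - Suc i) (drop (Suc i) \<sigma>)" and "w = drop (Suc j) \<sigma>"
  have j: "j = Suc (i + length m)" and i: "length u = i"
    using assms unfolding u_def m_def by auto
  have "drop (Suc i) \<sigma> = m @ \<sigma> ! j # w"
  proof -
    have "drop (j - Suc i) (drop (Suc i) \<sigma>) = \<sigma> ! j # w"
      using assms unfolding w_def by (simp add: Cons_nth_drop_Suc)
    then show ?thesis
      unfolding m_def by (metis append_take_drop_id)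
  qed
  then have \<sigma>: "\<sigma> = u @ \<sigma> ! i # m @ \<sigma> ! j # w"
    using assms id_take_nth_drop[of i \<sigma>] unfolding u_def by simp
  have "permute_list (Transposition.transpose i j) \<sigma> = u @ \<sigma> ! j # m @ \<sigma> ! i # w"
  proof (rule nth_equalityI)
    show "length (permute_list (Transposition.transpose i j) \<sigma>) = length (u @ \<sigma> ! j # m @ \<sigma> ! i # w)"
      using arg_cong[OF \<sigma>, of length] by simp
    fix k assume "k < length (permute_list (Transposition.transpose i j) \<sigma>)"
    then have k: "k < length \<sigma>" by simp
    have p: "Transposition.transpose i j permutes {..<length \<sigma>}"
      using assms by (intro permutes_swap_id) auto
    have "permute_list (Transposition.transpose i j) \<sigma> ! k = \<sigma> ! Transposition.transpose i j k"
      using permute_list_nth[OF p k] .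
    also have "\<dots> = (u @ \<sigma> ! j # m @ \<sigma> ! i # w) ! k"
    proof -
      consider "k = i" | "k = j" | "k \<noteq> i" "k \<noteq> j" by blast
      then show ?thesis
      proof cases
        case 3
        then have "(u @ \<sigma> ! j # m @ \<sigma> ! i # w) ! k = (u @ \<sigma> ! i # m @ \<sigma> ! j # w) ! k"
          using i j by (auto simp: nth_append nth_Cons split: nat.split)
        then show ?thesis
          using 3 arg_cong[OF \<sigma>, of "\<lambda>\<sigma>. \<sigma> ! k"] by (simp add: Transposition.transpose_def)
      qed (use i j in \<open>auto simp: nth_append\<close>)
    qed
    finally show "permute_list (Transposition.transpose i j) \<sigma> ! k = (u @ \<sigma> ! j # m @ \<sigma> ! i # w) ! k" .
  qed
  then show ?thesis
    using alternating_exchange[OF assms(1), of u "\<sigma> ! i" m "\<sigma> ! j" w] \<sigma> by simp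
qed

text \<open>Permutations are built up from transpositions, so the sign rule for neighbouring entries yields
  the sign rule for all of them.\<close>

lemma alternating_permute:
  assumes "alternating c" "p permutes {..<length \<sigma>}"
  shows "c (permute_list p \<sigma>) = (if evenperm p then c \<sigma> else - c \<sigma>)"
  using finite_lessThan assms(2)
proof (induction p rule: permutes_rev_induct)
  case (swap a b p)
  let ?t = "Transposition.transpose a b"
  have t: "?t permutes {..<length \<sigma>}"
    using swap.hyps by (intro permutes_swap_id) auto
  have "c (permute_list (p \<circ> ?t) \<sigma>) = c (permute_list ?t (permute_list p \<sigma>))"
    using permute_list_compose[OF t] by simp
  also have "\<dots> = - c (permute_list p \<sigma>)"
  proof (cases "a < b")
    case True
    then show ?thesis
      using alternating_transpose[OF assms(1), of a b "permute_list p \<sigma>"] swap.hyps by simp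
  next
    case False
    then show ?thesis
      using alternating_transpose[OF assms(1), of b a "permute_list p \<sigma>"] swap.hyps
      by (simp add: transpose_commute)
  qed
  finally have "c (permute_list (p \<circ> ?t) \<sigma>) = - c (permute_list p \<sigma>)" .
  moreover have "evenperm (p \<circ> ?t) \<longleftrightarrow> \<not> evenperm p"
  proof -
    have "permutation p" "permutation ?t"
      using swap.hyps t permutation_permutes by blast+
    then show ?thesis
      using swap.hyps by (simp add: evenperm_comp evenperm_swap)
  qed
  ultimately show ?case
    using swap.IH by (cases "evenperm p") (simp_all only: if_True if_False simp_thms minus_minus)
qed simp

text \<open>The terms \<open>s a b\<close> and \<open>s b a\<close> cancel. Antisymmetry alone would not do: in the presence of
  elements of order two it does not imply that the diagonal terms vanish.\<close>

lemma sum_antisymmetric: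
  fixes s :: "'v \<Rightarrow> 'v \<Rightarrow> 'g::ab_group_add"
  assumes "\<And>a b. s a b = - s b a" "\<And>a. s a a = 0"
  shows "(\<Sum>a\<in>V. \<Sum>b\<in>V. s a b) = 0"
proof (induction V rule: infinite_finite_induct)
  case (insert x V)
  have "(\<Sum>a\<in>V. s a x) = - (\<Sum>a\<in>V. s x a)"
    unfolding sum_negf[symmetric] by (rule sum.cong[OF refl]) (rule assms(1))
  then show ?case
    using insert assms(2)[of x] by (simp add: sum.distrib)
qed auto

text \<open>For a complex with finitely many vertices, the oriented chains are the alternating functions
  supported on its simplices; the finiteness of the support is then automatic.\<close>

lemma oriented_chains_iff:
  assumes fin: "finite (\<Union>K)"
  shows "c \<in> oriented_chains q K \<longleftrightarrow>
           alternating c \<and> (\<forall>\<sigma>. c \<sigma> \<noteq> 0 \<longrightarrow> length \<sigma> = Suc q \<and> set \<sigma> \<in> K)"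
proof
  assume c: "c \<in> oriented_chains q K"
  then have supp: "\<And>\<sigma>. c \<sigma> \<noteq> 0 \<Longrightarrow> length \<sigma> = Suc q \<and> distinct \<sigma> \<and> set \<sigma> \<in> K"
    unfolding oriented_chains_def ordered_simplices_def by blast
  have "c (u @ a # b # w) = - c (u @ b # a # w)" for u a b w
  proof (cases "u @ a # b # w \<in> ordered_simplices q K")
    case True
    let ?\<sigma> = "u @ a # b # w" and ?t = "Transposition.transpose (length u) (Suc (length u))"
    have t: "?t permutes {..<length ?\<sigma>}"
      by (intro permutes_swap_id) auto
    have "permute_list ?t ?\<sigma> = u @ b # a # w"
    proof (rule nth_equalityI)
      fix k assume "k < length (permute_list ?t ?\<sigma>)"
      then show "permute_list ?t ?\<sigma> ! k = (u @ b # a # w) ! k"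
        using permute_list_nth[OF t, of k]
        by (auto simp: nth_append nth_Cons Transposition.transpose_def split: nat.split)
    qed simp
    moreover have "c (permute_list ?t ?\<sigma>) = - c ?\<sigma>"
      using c t True unfolding oriented_chains_def by (simp add: evenperm_swap)
    ultimately show ?thesis by simp
  next
    case False
    moreover from this have "u @ b # a # w \<notin> ordered_simplices q K"
      unfolding ordered_simplices_def by (auto simp: insert_commute)
    ultimately have "c (u @ a # b # w) = 0" "c (u @ b # a # w) = 0"
      using c unfolding oriented_chains_def by blast+
    then show ?thesis by simp
  qed
  moreover have "c (u @ a # a # w) = 0" for u a w
    using supp[of "u @ a # a # w"] by auto
  ultimately show "alternating c \<and> (\<forall>\<sigma>. c \<sigma> \<noteq> 0 \<longrightarrow> length \<sigma> = Suc q \<and> set \<sigma> \<in> K)"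
    using supp unfolding alternating_def by blast
next
  assume c: "alternating c \<and> (\<forall>\<sigma>. c \<sigma> \<noteq> 0 \<longrightarrow> length \<sigma> = Suc q \<and> set \<sigma> \<in> K)"
  have "{\<sigma>. c \<sigma> \<noteq> 0} \<subseteq> {\<sigma>. set \<sigma> \<subseteq> \<Union>K \<and> length \<sigma> = Suc q}"
    using c by blast
  then have "finite {\<sigma>. c \<sigma> \<noteq> 0}"
    using finite_lists_length_eq[OF fin] finite_subset by blast
  moreover have "{\<sigma>. c \<sigma> \<noteq> 0} \<subseteq> ordered_simplices q K"
    using c alternating_not_distinct unfolding ordered_simplices_def by blast
  ultimately show "c \<in> oriented_chains q K"
    using c alternating_permute unfolding oriented_chains_def by blast
qed

section \<open>Boundary, push-forward and cone\<close>

text \<open>The boundary operator of the augmented chain complex of the simplex with vertex set \<open>V\<close>. Unlike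
  \<^const>\<open>boundary_map\<close> it may take a non-zero value at the empty list.\<close>

definition face_sum :: "'v set \<Rightarrow> ('v list \<Rightarrow> 'g::ab_group_add) \<Rightarrow> 'v list \<Rightarrow> 'g" where
  "face_sum V c w = (\<Sum>v\<in>V. c (v # w))"

text \<open>The push-forward along \<open>h\<close> of a function on the lists with entries in \<open>V\<close>. For an alternating
  function the degenerate lists need not be singled out: their contributions cancel.\<close>

definition pushforward :: "'v set \<Rightarrow> ('v \<Rightarrow> 'w) \<Rightarrow> ('v list \<Rightarrow> 'g::ab_group_add) \<Rightarrow> 'w list \<Rightarrow> 'g" where
  "pushforward V h c w = (\<Sum>\<sigma>\<in>{\<sigma>. set \<sigma> \<subseteq> V \<and> map h \<sigma> = w}. c \<sigma>)"

text \<open>The cone with apex \<open>x\<close>. The oriented simplex \<open>[w\<^sub>1, \<dots>, w\<^sub>q]\<close> is sent to \<open>[x, w\<^sub>1, \<dots>, w\<^sub>q]\<close>, which is \<open>0\<close> if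
  \<open>x\<close> is among its vertices. The value of \<open>vertex_cone x d\<close> at a list is the alternating sum, over the
  positions of \<open>x\<close> in the list, of the values of \<open>d\<close> after deleting that entry; the recursion computes
  this sum.\<close>

primrec vertex_cone :: "'v \<Rightarrow> ('v list \<Rightarrow> 'g::ab_group_add) \<Rightarrow> 'v list \<Rightarrow> 'g" where
  "vertex_cone x d [] = 0"
| "vertex_cone x d (v # w) = (if v = x then d w else 0) - vertex_cone x (\<lambda>u. d (v # u)) w"

lemma face_sum_add: "face_sum V (\<lambda>w. c w + d w) w = face_sum V c w + face_sum V d w"
  by (simp add: face_sum_def sum.distrib)

lemma pushforward_add: "pushforward V h (\<lambda>w. c w + d w) w = pushforward V h c w + pushforward V h d w"
  by (simp add: pushforward_def sum.distrib)

lemma pushforward_uminus: "pushforward V h (\<lambda>w. - c w) w = - pushforward V h c w"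
  by (simp add: pushforward_def sum_negf)

lemma pushforward_zero: "pushforward V h (\<lambda>w. 0) w = 0"
  by (simp add: pushforward_def)

lemma pushforward_sum: "pushforward V h (\<lambda>w. \<Sum>i\<in>A. c i w) w = (\<Sum>i\<in>A. pushforward V h (c i) w)"
  unfolding pushforward_def by (rule sum.swap)

lemma vertex_cone_add: "vertex_cone x (\<lambda>w. c w + d w) w = vertex_cone x c w + vertex_cone x d w"
  by (induction w arbitrary: c d) auto

lemma vertex_cone_zero: "vertex_cone x (\<lambda>w. 0) w = 0"
  by (induction w) auto

lemma vertex_cone_uminus: "vertex_cone x (\<lambda>w. - c w) w = - vertex_cone x c w"
  by (induction w arbitrary: c) auto

lemma vertex_cone_sum: "vertex_cone x (\<lambda>w. \<Sum>i\<in>A. c i w) w = (\<Sum>i\<in>A. vertex_cone x (c i) w)"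
  by (induction A rule: infinite_finite_induct) (auto simp: vertex_cone_zero vertex_cone_add)

lemma alternating_cone:
  assumes "alternating d"
  shows "alternating (vertex_cone x d)"
proof -
  have "vertex_cone x d (u @ a # b # w) = - vertex_cone x d (u @ b # a # w)" for u a b w
    using assms
  proof (induction u arbitrary: d)
    case Nil
    have "(\<lambda>u. d (a # b # u)) = (\<lambda>u. - d (b # a # u))"
      using alternating_swap_front[OF Nil] by blast
    then show ?case
      by (simp add: vertex_cone_uminus)
  next
    case (Cons v u)
    then show ?case
      using Cons.IH[OF alternating_slice[OF Cons.prems, of v]] alternating_swap[OF Cons.prems, of u a b w]
      by simp
  qed
  moreover have "vertex_cone x d (u @ a # a # w) = 0" for u a w
    using assms
  proof (induction u arbitrary: d)
    case Nil
    have "(\<lambda>u. d (a # a # u)) = (\<lambda>u. 0)"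
      using alternating_repeat_front[OF Nil] by blast
    then show ?case
      by (simp add: vertex_cone_zero)
  next
    case (Cons v u)
    then show ?case
      using Cons.IH[OF alternating_slice[OF Cons.prems, of v]] alternating_repeat[OF Cons.prems, of u a w]
      by simp
  qed
  ultimately show ?thesis
    unfolding alternating_def by blast
qed

lemma vertex_cone_support:
  assumes "vertex_cone x d \<sigma> \<noteq> 0"
  obtains \<tau> where "d \<tau> \<noteq> 0" "set \<sigma> = insert x (set \<tau>)" "length \<sigma> = Suc (length \<tau>)"
proof -
  have "\<exists>\<tau>. d \<tau> \<noteq> 0 \<and> set \<sigma> = insert x (set \<tau>) \<and> length \<sigma> = Suc (length \<tau>)"
    using assms
  proof (induction \<sigma> arbitrary: d)
    case (Cons v w)
    show ?case
    proof (cases "v = x \<and> d w \<noteq> 0")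
      case False
      then have "(if v = x then d w else 0) = 0"
        by simp
      then have "vertex_cone x (\<lambda>u. d (v # u)) w \<noteq> 0"
        using Cons.prems by auto
      then obtain \<tau> where "d (v # \<tau>) \<noteq> 0" "set w = insert x (set \<tau>)" "length w = Suc (length \<tau>)"
        using Cons.IH by blast
      then show ?thesis
        by (intro exI[of _ "v # \<tau>"]) auto
    qed auto
  qed simp
  then show thesis using that by blast
qed

text \<open>The cone is a contraction of the augmented chain complex.\<close>

lemma face_sum_cone:
  assumes "finite V" "x \<in> V"
  shows "face_sum V (vertex_cone x d) w = d w - vertex_cone x (face_sum V d) w"
proof -
  have "face_sum V d = (\<lambda>w. \<Sum>v\<in>V. d (v # w))"
    by (simp add: face_sum_def fun_eq_iff)
  then show ?thesis
    using assms by (simp add: face_sum_def sum_subtractf vertex_cone_sum)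
qed

text \<open>An alternating function splits into the cone over its slice at \<open>a\<close> and a part avoiding \<open>a\<close>.\<close>

lemma alternating_cone_slice:
  assumes "alternating c" "a \<in> set \<sigma>"
  shows "vertex_cone a (\<lambda>u. c (a # u)) \<sigma> = c \<sigma>"
proof -
  obtain u w where \<sigma>: "\<sigma> = u @ a # w"
    using assms(2) by (meson split_list)
  let ?d = "\<lambda>\<sigma>. c \<sigma> - vertex_cone a (\<lambda>u. c (a # u)) \<sigma>"
  have "alternating ?d"
    using alternating_add[OF assms(1) alternating_uminus[OF alternating_cone[OF alternating_slice[OF assms(1)]]]]
    by simp
  moreover have "?d (a # u @ w) = 0"
    using alternating_repeat_front[OF assms(1)] by (simp add: vertex_cone_zero)
  ultimately have "?d (u @ a # w) = 0"
    using alternating_move[of ?d "[]" a u w] by (auto split: if_splits)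
  then show ?thesis
    using \<sigma> by simp
qed

lemma pushforward_Nil [simp]: "pushforward V h c [] = c []"
proof -
  have "{\<sigma>. set \<sigma> \<subseteq> V \<and> map h \<sigma> = []} = {[]}" by auto
  then show ?thesis by (simp add: pushforward_def)
qed

lemma pushforward_Cons:
  assumes "finite V"
  shows "pushforward V h c (y # w) = pushforward V h (\<lambda>u. \<Sum>v\<in>{v\<in>V. h v = y}. c (v # u)) w"
proof -
  let ?T = "{v\<in>V. h v = y}" and ?S = "\<lambda>w. {\<sigma>. set \<sigma> \<subseteq> V \<and> map h \<sigma> = w}"
  have "?S (y # w) = (\<lambda>(v, u). v # u) ` (?T \<times> ?S w)"
  proof (rule equalityI, rule subsetI)
    fix \<sigma> assume "\<sigma> \<in> ?S (y # w)"
    then show "\<sigma> \<in> (\<lambda>(v, u). v # u) ` (?T \<times> ?S w)"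
      by (cases \<sigma>) auto
  qed auto
  then have "pushforward V h c (y # w) = (\<Sum>(v, u)\<in>?T \<times> ?S w. c (v # u))"
    unfolding pushforward_def by (simp add: sum.reindex inj_on_def split_def)
  also have "\<dots> = (\<Sum>v\<in>?T. \<Sum>u\<in>?S w. c (v # u))"
    by (rule sum.cartesian_product[symmetric])
  also have "\<dots> = pushforward V h (\<lambda>u. \<Sum>v\<in>?T. c (v # u)) w"
    unfolding pushforward_def by (rule sum.swap)
  finally show ?thesis .
qed

lemma alternating_pushforward:
  assumes "finite V" "alternating c"
  shows "alternating (pushforward V h c)"
proof -
  let ?T = "\<lambda>y. {v\<in>V. h v = y}"
  have two: "pushforward V h c (a # b # w) = pushforward V h (\<lambda>u. \<Sum>v\<in>?T b. \<Sum>v'\<in>?T a. c (v' # v # u)) w"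
    for c :: "'a list \<Rightarrow> 'b" and a b w
    by (simp add: pushforward_Cons[OF assms(1)])
  have step: "alternating (\<lambda>u. \<Sum>v\<in>?T y. c (v # u))" if "alternating c" for c :: "'a list \<Rightarrow> 'b" and y
    by (intro alternating_sum alternating_slice that)
  have "pushforward V h c (u @ a # b # w) = - pushforward V h c (u @ b # a # w)" for u a b w
    using assms(2)
  proof (induction u arbitrary: c)
    case Nil
    have "(\<Sum>v\<in>?T b. \<Sum>v'\<in>?T a. c (v' # v # u)) = - (\<Sum>v'\<in>?T a. \<Sum>v\<in>?T b. c (v # v' # u))" for u
      by (subst sum.swap) (simp add: sum_negf[symmetric] alternating_swap_front[OF Nil, symmetric])
    then show ?case
      by (simp add: two pushforward_uminus)
  next
    case (Cons v u)
    then show ?case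
      by (simp add: pushforward_Cons[OF assms(1)] step)
  qed
  moreover have "pushforward V h c (u @ a # a # w) = 0" for u a w
    using assms(2)
  proof (induction u arbitrary: c)
    case Nil
    have "(\<Sum>v\<in>?T a. \<Sum>v'\<in>?T a. c (v' # v # u)) = 0" for u
      by (rule sum_antisymmetric)
        (rule alternating_swap_front[OF Nil], rule alternating_repeat_front[OF Nil])
    then show ?case
      by (simp add: two pushforward_zero)
  next
    case (Cons v u)
    then show ?case
      by (simp add: pushforward_Cons[OF assms(1)] step)
  qed
  ultimately show ?thesis
    unfolding alternating_def by blast
qed

lemma pushforward_support:
  assumes "pushforward V h c w \<noteq> 0"
  obtains \<sigma> where "c \<sigma> \<noteq> 0" "set \<sigma> \<subseteq> V" "map h \<sigma> = w"
proof -
  have "\<exists>\<sigma>\<in>{\<sigma>. set \<sigma> \<subseteq> V \<and> map h \<sigma> = w}. c \<sigma> \<noteq> 0"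
    using assms unfolding pushforward_def by (meson sum.neutral)
  then show thesis using that by blast
qed

lemma pushforward_cong:
  assumes "\<And>\<sigma> v. c \<sigma> \<noteq> 0 \<Longrightarrow> v \<in> set \<sigma> \<Longrightarrow> h v = g v" "finite V"
  shows "pushforward V h c w = pushforward V g c w"
proof -
  have fin: "finite {\<sigma>. set \<sigma> \<subseteq> V \<and> length \<sigma> = length w}"
    using assms(2) by (rule finite_lists_length_eq)
  have "pushforward V f c w = (\<Sum>\<sigma>\<in>{\<sigma>. set \<sigma> \<subseteq> V \<and> length \<sigma> = length w}. if map f \<sigma> = w then c \<sigma> else 0)" for f
  proof -
    have "{\<sigma>. set \<sigma> \<subseteq> V \<and> map f \<sigma> = w} = {\<sigma>\<in>{\<sigma>. set \<sigma> \<subseteq> V \<and> length \<sigma> = length w}. map f \<sigma> = w}"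
      by auto
    then show ?thesis
      unfolding pushforward_def using sum.inter_filter[OF fin, of c "\<lambda>\<sigma>. map f \<sigma> = w"] by simp
  qed
  moreover have "(if map h \<sigma> = w then c \<sigma> else 0) = (if map g \<sigma> = w then c \<sigma> else 0)" for \<sigma>
    using assms(1)[of \<sigma>] by (cases "c \<sigma> = 0") (auto cong: map_cong)
  ultimately show ?thesis by simp
qed

lemma pushforward_compose:
  assumes "finite V" "finite V'" "h ` V \<subseteq> V'"
  shows "pushforward V' g (pushforward V h c) w = pushforward V (g \<circ> h) c w"
proof (induction w arbitrary: c)
  case (Cons y w)
  let ?T = "\<lambda>h V y. {v\<in>V. h v = y}"
  have *: "(\<Sum>v'\<in>?T g V' y. \<Sum>v\<in>?T h V v'. c (v # u)) = (\<Sum>v\<in>?T (g \<circ> h) V y. c (v # u))" for u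
  proof -
    have "(\<Sum>v'\<in>?T g V' y. \<Sum>v\<in>?T h V v'. c (v # u)) =
        (\<Sum>v'\<in>?T g V' y. \<Sum>v\<in>{v\<in>?T (g \<circ> h) V y. h v = v'}. c (v # u))"
      by (intro sum.cong) auto
    also have "\<dots> = (\<Sum>v\<in>?T (g \<circ> h) V y. c (v # u))"
      using assms by (intro sum.group) auto
    finally show ?thesis .
  qed
  have "pushforward V' g (pushforward V h c) (y # w) =
      pushforward V' g (\<lambda>u. \<Sum>v'\<in>?T g V' y. pushforward V h (\<lambda>u. \<Sum>v\<in>?T h V v'. c (v # u)) u) w"
    by (simp add: pushforward_Cons assms)
  also have "\<dots> = pushforward V' g (pushforward V h (\<lambda>u. \<Sum>v'\<in>?T g V' y. \<Sum>v\<in>?T h V v'. c (v # u))) w"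
    by (simp add: pushforward_sum[symmetric])
  also have "\<dots> = pushforward V (g \<circ> h) c (y # w)"
    by (simp add: Cons.IH[unfolded comp_def] *[unfolded comp_def] pushforward_Cons assms comp_def)
  finally show ?case .
qed simp

lemma face_sum_pushforward:
  assumes "finite V" "finite V'" "h ` V \<subseteq> V'"
  shows "face_sum V' (pushforward V h c) w = pushforward V h (face_sum V c) w"
proof -
  have "(\<Sum>y\<in>V'. \<Sum>v\<in>{v\<in>V. h v = y}. c (v # u)) = (\<Sum>v\<in>V. c (v # u))" for u
    using assms by (intro sum.group) auto
  moreover have "face_sum V c = (\<lambda>w. \<Sum>v\<in>V. c (v # w))"
    by (simp add: face_sum_def fun_eq_iff)
  ultimately show ?thesis
    using assms by (simp add: face_sum_def pushforward_Cons pushforward_sum[symmetric])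
qed

lemma pushforward_cone:
  assumes "finite V" "a \<in> V"
  shows "pushforward V h (vertex_cone a d) w = vertex_cone (h a) (pushforward V h d) w"
proof (induction w arbitrary: d)
  case (Cons y w)
  let ?T = "{v\<in>V. h v = y}"
  have "(\<Sum>v\<in>?T. vertex_cone a d (v # u)) = (if h a = y then d u else 0) - vertex_cone a (\<lambda>u. \<Sum>v\<in>?T. d (v # u)) u" for u
    using assms by (simp add: sum_subtractf vertex_cone_sum)
  then have "pushforward V h (vertex_cone a d) (y # w) =
      pushforward V h (\<lambda>u. (if h a = y then d u else 0) + - vertex_cone a (\<lambda>u. \<Sum>v\<in>?T. d (v # u)) u) w"
    by (simp add: pushforward_Cons assms)
  also have "\<dots> = (if h a = y then pushforward V h d w else 0)
      - pushforward V h (vertex_cone a (\<lambda>u. \<Sum>v\<in>?T. d (v # u))) w"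
    by (subst pushforward_add) (simp add: pushforward_uminus pushforward_zero)
  finally show ?case
    by (simp add: Cons.IH pushforward_Cons assms eq_commute)
qed simp

text \<open>Two maps that differ in the vertex \<open>a\<close> only are chain homotopic: the homotopy sends each simplex
  \<open>[a, w]\<close> to \<open>[h a, g a, h w]\<close>, and the simplices without the vertex \<open>a\<close> to \<open>0\<close>.\<close>

lemma single_vertex_homotopy:
  fixes h g :: "'v \<Rightarrow> 'w" and c :: "'v list \<Rightarrow> 'g::ab_group_add"
  assumes V: "finite V" "finite V'" "a \<in> V" "h ` V \<subseteq> V'" "g ` V \<subseteq> V'"
    and c: "alternating c"
    and eq: "\<And>v. v \<noteq> a \<Longrightarrow> g v = h v"
  shows "pushforward V g c w - pushforward V h c w =
    face_sum V' (vertex_cone (h a) (vertex_cone (g a) (pushforward V h (\<lambda>u. c (a # u))))) w +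
    vertex_cone (h a) (vertex_cone (g a) (pushforward V h (\<lambda>u. face_sum V c (a # u)))) w"
proof -
  let ?s = "\<lambda>u. c (a # u)"
  let ?r = "\<lambda>\<sigma>. c \<sigma> + - vertex_cone a ?s \<sigma>"
  let ?e = "pushforward V h ?s"
  \<comment> \<open>Neither \<open>?r\<close> nor \<open>?s\<close> involves \<open>a\<close>, so \<open>g\<close> and \<open>h\<close> have the same effect on them.\<close>
  have "?r \<sigma> = 0" if "a \<in> set \<sigma>" for \<sigma>
    using alternating_cone_slice[OF c that] by simp
  then have r: "pushforward V g ?r w = pushforward V h ?r w"
    using eq V(1) by (intro pushforward_cong) metis+
  have "?s \<sigma> = 0" if "a \<in> set \<sigma>" for \<sigma>
    using alternating_not_distinct[OF c, of "a # \<sigma>"] that by simp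
  then have s: "pushforward V g ?s = ?e"
    using eq V(1) by (intro ext pushforward_cong) metis+
  have "pushforward V f c w = pushforward V f ?r w + vertex_cone (f a) (pushforward V f ?s) w" for f :: "'v \<Rightarrow> 'w"
    by (simp only: pushforward_add pushforward_uminus pushforward_cone[OF V(1,3)]) simp
  then have "pushforward V g c w - pushforward V h c w = vertex_cone (g a) ?e w - vertex_cone (h a) ?e w"
    using r s by simp
  also have "\<dots> = face_sum V' (vertex_cone (h a) (vertex_cone (g a) ?e)) w - vertex_cone (h a) (vertex_cone (g a) (face_sum V' ?e)) w"
  proof -
    have "face_sum V' (vertex_cone (g a) ?e) = (\<lambda>w. ?e w + - vertex_cone (g a) (face_sum V' ?e) w)"
      using V by (intro ext) (subst face_sum_cone, auto)
    moreover have "face_sum V' (vertex_cone (h a) (vertex_cone (g a) ?e)) w =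
        vertex_cone (g a) ?e w - vertex_cone (h a) (face_sum V' (vertex_cone (g a) ?e)) w"
      using V by (intro face_sum_cone) auto
    ultimately show ?thesis
      by (simp only: vertex_cone_add vertex_cone_uminus) simp
  qed
  also have "face_sum V' ?e = (\<lambda>w. - pushforward V h (\<lambda>u. face_sum V c (a # u)) w)"
  proof
    fix w
    have "face_sum V ?s = (\<lambda>u. - face_sum V c (a # u))"
      unfolding face_sum_def by (simp add: sum_negf[symmetric] alternating_swap_front[OF c, symmetric])
    then show "face_sum V' ?e w = - pushforward V h (\<lambda>u. face_sum V c (a # u)) w"
      using V by (simp add: face_sum_pushforward pushforward_uminus)
  qed
  finally show ?thesis
    by (simp add: vertex_cone_uminus)
qed

section \<open>Chain maps and chain homotopies\<close>

text \<open>A simplicial complex with finitely many vertices. The vertices are the elements of \<open>\<Union>K\<close>.\<close>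

definition finite_complex :: "'v set set \<Rightarrow> bool" where
  "finite_complex K \<longleftrightarrow>
     finite (\<Union>K) \<and> {} \<notin> K \<and> (\<forall>s\<in>K. \<forall>t. t \<subseteq> s \<longrightarrow> t \<noteq> {} \<longrightarrow> t \<in> K)"

text \<open>Simplicial maps, as functions on the ambient type of vertices of which only the values at the
  vertices of \<open>K\<close> matter.\<close>

definition simplicial :: "'v set set \<Rightarrow> 'w set set \<Rightarrow> ('v \<Rightarrow> 'w) \<Rightarrow> bool" where
  "simplicial K L h \<longleftrightarrow> (\<forall>s\<in>K. h ` s \<in> L)"

text \<open>Contiguity: the images of each simplex under the two maps span a common simplex.\<close>

definition contiguous :: "'v set set \<Rightarrow> 'w set set \<Rightarrow> ('v \<Rightarrow> 'w) \<Rightarrow> ('v \<Rightarrow> 'w) \<Rightarrow> bool" where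
  "contiguous K L h g \<longleftrightarrow> (\<forall>s\<in>K. h ` s \<union> g ` s \<in> L)"

lemma finite_complex_finite: "finite_complex K \<Longrightarrow> finite (\<Union>K)"
  by (simp add: finite_complex_def)

lemma finite_complex_face: "finite_complex K \<Longrightarrow> s \<in> K \<Longrightarrow> t \<subseteq> s \<Longrightarrow> t \<noteq> {} \<Longrightarrow> t \<in> K"
  unfolding finite_complex_def by blast

lemma contiguous_simplicial:
  assumes "finite_complex K" "finite_complex L" "contiguous K L h g"
  shows "simplicial K L h" "simplicial K L g"
proof -
  have "s \<noteq> {}" if "s \<in> K" for s
    using assms(1) that unfolding finite_complex_def by blast
  then show "simplicial K L h" "simplicial K L g"
    using assms(3) finite_complex_face[OF assms(2)] unfolding simplicial_def contiguous_def
    by (metis Un_upper1 image_is_empty, metis Un_upper2 image_is_empty)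
qed

lemma simplicial_image: "simplicial K L h \<Longrightarrow> h ` \<Union>K \<subseteq> \<Union>L"
  unfolding simplicial_def by blast

lemma oriented_chainsD:
  assumes "finite (\<Union>K)" "c \<in> oriented_chains q K"
  shows "alternating c" "c \<sigma> \<noteq> 0 \<Longrightarrow> length \<sigma> = Suc q" "c \<sigma> \<noteq> 0 \<Longrightarrow> set \<sigma> \<in> K"
  using assms oriented_chains_iff by blast+

lemma zero_in_oriented_chains: "0 \<in> oriented_chains q K"
  by (simp add: oriented_chains_def)

lemma add_in_oriented_chains:
  assumes "finite (\<Union>K)" "c \<in> oriented_chains q K" "d \<in> oriented_chains q K"
  shows "c + d \<in> oriented_chains q K"
proof -
  have "c + d = (\<lambda>w. c w + d w)" by (simp add: fun_eq_iff)
  then have "alternating (c + d)"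
    using alternating_add[OF oriented_chainsD(1)[OF assms(1,2)] oriented_chainsD(1)[OF assms(1,3)]] by simp
  moreover have "length \<sigma> = Suc q \<and> set \<sigma> \<in> K" if "(c + d) \<sigma> \<noteq> 0" for \<sigma>
  proof -
    have "c \<sigma> \<noteq> 0 \<or> d \<sigma> \<noteq> 0" using that by auto
    then show ?thesis
      using oriented_chainsD(2,3)[OF assms(1,2)] oriented_chainsD(2,3)[OF assms(1,3)] by blast
  qed
  ultimately show ?thesis
    using oriented_chains_iff[OF assms(1)] by blast
qed

lemma uminus_in_oriented_chains:
  assumes "finite (\<Union>K)" "c \<in> oriented_chains q K"
  shows "- c \<in> oriented_chains q K"
proof -
  have "- c = (\<lambda>w. - c w)" by (simp add: fun_eq_iff)
  then have "alternating (- c)"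
    using alternating_uminus[OF oriented_chainsD(1)[OF assms]] by simp
  moreover have "length \<sigma> = Suc q \<and> set \<sigma> \<in> K" if "(- c) \<sigma> \<noteq> 0" for \<sigma>
    using that oriented_chainsD(2,3)[OF assms] by simp
  ultimately show ?thesis
    using oriented_chains_iff[OF assms(1)] by blast
qed

lemma boundary_map_eq_face_sum:
  assumes "finite V" "\<Union>K \<subseteq> V" "c \<in> oriented_chains q K"
  shows "boundary_map c w = (if w = [] then 0 else face_sum V c w)"
proof -
  have K: "finite (\<Union>K)" using finite_subset[OF assms(2,1)] .
  have "v \<in> V" if "c (v # w) \<noteq> 0" for v
    using oriented_chainsD(3)[OF K assms(3) that] assms(2) by auto
  then have "(\<Sum>v\<in>{v. c (v # w) \<noteq> 0}. c (v # w)) = (\<Sum>v\<in>V. c (v # w))"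
    using assms(1) by (intro sum.mono_neutral_left) auto
  then show ?thesis
    by (simp add: boundary_map_def face_sum_def)
qed

text \<open>The push-forward of a chain vanishes at lists with repetitions, because it is alternating.\<close>

lemma simplicial_chain_map_eq_pushforward:
  assumes "finite V" "\<Union>K \<subseteq> V" "c \<in> oriented_chains q K"
  shows "simplicial_chain_map h c = pushforward V h c"
proof
  fix w
  have K: "finite (\<Union>K)" using finite_subset[OF assms(2,1)] .
  have alt: "alternating (pushforward V h c)"
    using alternating_pushforward[OF assms(1)] oriented_chainsD(1)[OF K assms(3)] by blast
  have "{\<sigma>. set \<sigma> \<subseteq> V \<and> map h \<sigma> = w} \<subseteq> {\<sigma>. set \<sigma> \<subseteq> V \<and> length \<sigma> = length w}"
    by auto
  then have fin: "finite {\<sigma>. set \<sigma> \<subseteq> V \<and> map h \<sigma> = w}"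
    using finite_lists_length_eq[OF assms(1)] finite_subset by blast
  have "set \<sigma> \<subseteq> V" if "c \<sigma> \<noteq> 0" for \<sigma>
    using oriented_chainsD(3)[OF K assms(3) that] assms(2) by auto
  then have "(\<Sum>\<sigma>\<in>{\<sigma>. map h \<sigma> = w \<and> c \<sigma> \<noteq> 0}. c \<sigma>) = pushforward V h c w"
    unfolding pushforward_def using fin by (intro sum.mono_neutral_left) auto
  then show "simplicial_chain_map h c w = pushforward V h c w"
    using alternating_not_distinct[OF alt] by (simp add: simplicial_chain_map_def)
qed

lemma boundary_map_add:
  assumes "finite (\<Union>K)" "c \<in> oriented_chains q K" "d \<in> oriented_chains q K"
  shows "boundary_map (c + d) = boundary_map c + boundary_map d"
proof -
  have cd: "c + d = (\<lambda>w. c w + d w)" by (simp add: fun_eq_iff)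
  show ?thesis
    using boundary_map_eq_face_sum[OF assms(1) subset_refl assms(2)]
      boundary_map_eq_face_sum[OF assms(1) subset_refl assms(3)]
      boundary_map_eq_face_sum[OF assms(1) subset_refl add_in_oriented_chains[OF assms]]
    by (simp add: fun_eq_iff cd face_sum_add)
qed

lemma boundary_map_zero: "boundary_map 0 = 0"
  by (simp add: boundary_map_def fun_eq_iff)

lemma boundary_map_in_oriented_chains:
  assumes K: "finite_complex K" and c: "c \<in> oriented_chains (Suc q) K"
  shows "boundary_map c \<in> oriented_chains q K"
proof -
  have fin: "finite (\<Union>K)" using finite_complex_finite[OF K] .
  note b = boundary_map_eq_face_sum[OF fin subset_refl c]
  have alt: "alternating (face_sum (\<Union>K) c)"
    unfolding face_sum_def[abs_def]
    by (intro alternating_sum alternating_slice oriented_chainsD(1)[OF fin c])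
  have "boundary_map c (u @ x # y # w) = - boundary_map c (u @ y # x # w)" for u x y w
    using alternating_swap[OF alt, of u x y w] by (simp add: b)
  moreover have "boundary_map c (u @ x # x # w) = 0" for u x w
    using alternating_repeat[OF alt, of u x w] by (simp add: b)
  ultimately have "alternating (boundary_map c)"
    unfolding alternating_def by blast
  moreover have "length w = Suc q \<and> set w \<in> K" if "boundary_map c w \<noteq> 0" for w
  proof -
    have w: "w \<noteq> []" "face_sum (\<Union>K) c w \<noteq> 0"
      using that b by (auto split: if_splits)
    then obtain v where v: "c (v # w) \<noteq> 0"
      unfolding face_sum_def by (meson sum.neutral)
    have "set (v # w) \<in> K"
      using oriented_chainsD(3)[OF fin c v] .
    then have "set w \<in> K"
      by (rule finite_complex_face[OF K]) (use w in auto)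
    then show ?thesis
      using oriented_chainsD(2)[OF fin c v] by simp
  qed
  ultimately show ?thesis
    using oriented_chains_iff[OF fin] by blast
qed

lemma boundary_map_boundary_map:
  assumes K: "finite_complex K" and c: "c \<in> oriented_chains (Suc q) K"
  shows "boundary_map (boundary_map c) = 0"
proof
  fix w
  have fin: "finite (\<Union>K)" using finite_complex_finite[OF K] .
  note alt = oriented_chainsD(1)[OF fin c]
  have "(\<Sum>v\<in>\<Union>K. \<Sum>v'\<in>\<Union>K. c (v' # v # w)) = 0"
    by (rule sum_antisymmetric) (rule alternating_swap_front[OF alt], rule alternating_repeat_front[OF alt])
  then show "boundary_map (boundary_map c) w = 0 w"
    using boundary_map_eq_face_sum[OF fin subset_refl boundary_map_in_oriented_chains[OF assms]]
      boundary_map_eq_face_sum[OF fin subset_refl c]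
    by (simp add: face_sum_def)
qed

lemma boundary_map_dim_0:
  assumes "finite (\<Union>K)" "c \<in> oriented_chains 0 K"
  shows "boundary_map c = 0"
proof
  fix w
  have "c (v # w) = 0" if "w \<noteq> []" for v
    using oriented_chainsD(2)[OF assms, of "v # w"] that by auto
  then show "boundary_map c w = 0 w"
    by (simp add: boundary_map_def)
qed

lemma simplicial_chain_map_in_oriented_chains:
  assumes fin: "finite (\<Union>K)" "finite (\<Union>L)" and h: "simplicial K L h" and c: "c \<in> oriented_chains q K"
  shows "simplicial_chain_map h c \<in> oriented_chains q L"
proof -
  have eq: "simplicial_chain_map h c = pushforward (\<Union>K) h c"
    using simplicial_chain_map_eq_pushforward[OF fin(1) subset_refl c] .
  have "length w = Suc q \<and> set w \<in> L" if nz: "pushforward (\<Union>K) h c w \<noteq> 0" for w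
  proof -
    obtain \<sigma> where \<sigma>: "c \<sigma> \<noteq> 0" "map h \<sigma> = w"
      using pushforward_support[OF nz] by blast
    have "h ` set \<sigma> \<in> L"
      using h oriented_chainsD(3)[OF fin(1) c \<sigma>(1)] unfolding simplicial_def by blast
    then show ?thesis
      using \<sigma> oriented_chainsD(2)[OF fin(1) c \<sigma>(1)] by auto
  qed
  then show ?thesis
    unfolding eq oriented_chains_iff[OF fin(2)]
    using alternating_pushforward[OF fin(1) oriented_chainsD(1)[OF fin(1) c]] by blast
qed

lemma simplicial_chain_map_add:
  assumes fin: "finite (\<Union>K)" and c: "c \<in> oriented_chains q K" "d \<in> oriented_chains q K"
  shows "simplicial_chain_map h (c + d) = simplicial_chain_map h c + simplicial_chain_map h d"
proof -
  have cd: "c + d = (\<lambda>w. c w + d w)" by (simp add: fun_eq_iff)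
  show ?thesis
    unfolding simplicial_chain_map_eq_pushforward[OF fin subset_refl c(1)]
      simplicial_chain_map_eq_pushforward[OF fin subset_refl c(2)]
      simplicial_chain_map_eq_pushforward[OF fin subset_refl add_in_oriented_chains[OF fin c]]
    by (simp add: fun_eq_iff cd pushforward_add)
qed

lemma boundary_map_simplicial_chain_map:
  assumes K: "finite_complex K" and L: "finite_complex L" and h: "simplicial K L h" and c: "c \<in> oriented_chains q K"
  shows "boundary_map (simplicial_chain_map h c) = simplicial_chain_map h (boundary_map c)"
proof
  fix w
  note fin = finite_complex_finite[OF K] finite_complex_finite[OF L]
  have push: "simplicial_chain_map h c = pushforward (\<Union>K) h c"
    using simplicial_chain_map_eq_pushforward[OF fin(1) subset_refl c] .
  have b: "boundary_map c = (\<lambda>w. if w = [] then 0 else face_sum (\<Union>K) c w)"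
    using boundary_map_eq_face_sum[OF fin(1) subset_refl c] by blast
  have "boundary_map (simplicial_chain_map h c) w =
      (if w = [] then 0 else pushforward (\<Union>K) h (face_sum (\<Union>K) c) w)"
    using boundary_map_eq_face_sum[OF fin(2) subset_refl simplicial_chain_map_in_oriented_chains[OF fin h c]]
      face_sum_pushforward[OF fin simplicial_image[OF h], of c w] push by simp
  also have "\<dots> = pushforward (\<Union>K) h (boundary_map c) w"
  proof (cases "w = []")
    case False
    then show ?thesis
      unfolding pushforward_def b by (simp, intro sum.cong) auto
  qed (simp add: b)
  also have "\<dots> = simplicial_chain_map h (boundary_map c) w"
  proof (cases q)
    case 0
    then show ?thesis
      using boundary_map_dim_0[of K c] fin c
      by (simp add: simplicial_chain_map_def pushforward_def)
  next
    case (Suc q')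
    then have "boundary_map c \<in> oriented_chains q' K"
      using boundary_map_in_oriented_chains[OF K] c by blast
    then show ?thesis
      using simplicial_chain_map_eq_pushforward[OF fin(1) subset_refl] by metis
  qed
  finally show "boundary_map (simplicial_chain_map h c) w = simplicial_chain_map h (boundary_map c) w" .
qed

lemma simplicial_chain_map_compose:
  assumes fin: "finite (\<Union>K)" "finite (\<Union>L)" and h: "simplicial K L h" and c: "c \<in> oriented_chains q K"
  shows "simplicial_chain_map g (simplicial_chain_map h c) = simplicial_chain_map (g \<circ> h) c"
proof -
  have "simplicial_chain_map g (pushforward (\<Union>K) h c) = pushforward (\<Union>L) g (pushforward (\<Union>K) h c)"
    using simplicial_chain_map_eq_pushforward[OF fin(2) subset_refl simplicial_chain_map_in_oriented_chains[OF assms]]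
      simplicial_chain_map_eq_pushforward[OF fin(1) subset_refl c] by metis
  then show ?thesis
    using simplicial_chain_map_eq_pushforward[OF fin(1) subset_refl c]
      pushforward_compose[OF fin simplicial_image[OF h]] by (metis ext)
qed

lemma simplicial_chain_map_cong:
  assumes fin: "finite (\<Union>K)" and c: "c \<in> oriented_chains q K" and eq: "\<And>v. v \<in> \<Union>K \<Longrightarrow> h v = g v"
  shows "simplicial_chain_map h c = simplicial_chain_map g c"
proof -
  have "pushforward (\<Union>K) h c w = pushforward (\<Union>K) g c w" for w
  proof (rule pushforward_cong[OF _ fin])
    fix \<sigma> v assume "c \<sigma> \<noteq> 0" "v \<in> set \<sigma>"
    then show "h v = g v"
      using oriented_chainsD(3)[OF fin c] eq by blast
  qed
  then show ?thesis
    using simplicial_chain_map_eq_pushforward[OF fin subset_refl c] by (metis ext)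
qed

lemma simplicial_chain_map_id:
  assumes fin: "finite (\<Union>K)" and c: "c \<in> oriented_chains q K" and eq: "\<And>v. v \<in> \<Union>K \<Longrightarrow> h v = v"
  shows "simplicial_chain_map h c = c"
proof
  fix w
  have "{\<sigma>. map (\<lambda>v. v) \<sigma> = w \<and> c \<sigma> \<noteq> 0} = (if c w = 0 then {} else {w})"
    by auto
  then have "simplicial_chain_map (\<lambda>v. v) c w =
      (if distinct w then sum c (if c w = 0 then {} else {w}) else 0)"
    unfolding simplicial_chain_map_def by (rule arg_cong)
  also have "\<dots> = c w"
    using alternating_not_distinct[OF oriented_chainsD(1)[OF fin c], of w] by simp
  finally have "simplicial_chain_map (\<lambda>v. v) c w = c w" .
  moreover have "simplicial_chain_map h c = simplicial_chain_map (\<lambda>v. v) c"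
    by (rule simplicial_chain_map_cong[OF fin c eq])
  ultimately show "simplicial_chain_map h c w = c w"
    by simp
qed

text \<open>A chain homotopy from \<open>h\<close> to \<open>g\<close>. For convenience a single operator \<open>D\<close> serves all dimensions; it
  is additive on all functions, not only on chains.\<close>

definition chain_homotopy ::
    "'v set set \<Rightarrow> 'w set set \<Rightarrow> ('v \<Rightarrow> 'w) \<Rightarrow> ('v \<Rightarrow> 'w) \<Rightarrow> (('v list \<Rightarrow> 'g) \<Rightarrow> 'w list \<Rightarrow> 'g::ab_group_add) \<Rightarrow> bool" where
  "chain_homotopy K L h g D \<longleftrightarrow>
     (\<forall>c d. D (c + d) = D c + D d) \<and>
     (\<forall>q. \<forall>c\<in>oriented_chains q K. D c \<in> oriented_chains (Suc q) L \<and>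
        simplicial_chain_map g c - simplicial_chain_map h c = boundary_map (D c) + D (boundary_map c))"

lemma chain_homotopyD:
  assumes "chain_homotopy K L h g D"
  shows "D (c + d) = D c + D d"
    and "c \<in> oriented_chains q K \<Longrightarrow> D c \<in> oriented_chains (Suc q) L"
    and "c \<in> oriented_chains q K \<Longrightarrow>
      simplicial_chain_map g c - simplicial_chain_map h c = boundary_map (D c) + D (boundary_map c)"
    and "D 0 = 0"
proof -
  have "D (0 + 0) = D 0 + D 0"
    using assms unfolding chain_homotopy_def by blast
  then show "D 0 = 0" by simp
qed (use assms in \<open>unfold chain_homotopy_def, blast+\<close>)

lemma single_vertex_chain_homotopy:
  fixes h g :: "'v \<Rightarrow> 'w"
  assumes K: "finite_complex K" and L: "finite_complex L"
    and cont: "contiguous K L h g" and eq: "\<And>v. v \<noteq> a \<Longrightarrow> g v = h v" and a: "a \<in> \<Union>K"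
  shows "\<exists>D. chain_homotopy K L h g (D :: ('v list \<Rightarrow> 'g::ab_group_add) \<Rightarrow> _)"
proof -
  let ?V = "\<Union>K" and ?V' = "\<Union>L"
  define D :: "('v list \<Rightarrow> 'g) \<Rightarrow> 'w list \<Rightarrow> 'g" where
    "D c = vertex_cone (h a) (vertex_cone (g a) (pushforward ?V h (\<lambda>u. c (a # u))))" for c
  have V: "finite ?V" "finite ?V'"
    using K L by (simp_all add: finite_complex_def)
  have hg: "h ` ?V \<subseteq> ?V'" "g ` ?V \<subseteq> ?V'"
    by (intro simplicial_image contiguous_simplicial[OF K L cont])+
  have "D (c + d) = D c + D d" for c d
    by (simp add: D_def fun_eq_iff pushforward_add[abs_def] vertex_cone_add[abs_def])
  moreover have Dc: "D c \<in> oriented_chains (Suc q) L" if c: "c \<in> oriented_chains q K" for c q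
  proof -
    have "alternating (D c)"
      unfolding D_def
      by (intro alternating_cone alternating_pushforward alternating_slice oriented_chainsD(1)[OF V(1) c] V)
    moreover have "length \<sigma> = Suc (Suc q) \<and> set \<sigma> \<in> L" if nz: "D c \<sigma> \<noteq> 0" for \<sigma>
    proof -
      obtain \<tau>' where \<tau>': "vertex_cone (g a) (pushforward ?V h (\<lambda>u. c (a # u))) \<tau>' \<noteq> 0"
          "set \<sigma> = insert (h a) (set \<tau>')" "length \<sigma> = Suc (length \<tau>')"
        using vertex_cone_support[OF nz[unfolded D_def]] .
      obtain \<tau> where \<tau>: "pushforward ?V h (\<lambda>u. c (a # u)) \<tau> \<noteq> 0"
          "set \<sigma> = insert (h a) (insert (g a) (set \<tau>))" "length \<sigma> = Suc (Suc (length \<tau>))"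
        using vertex_cone_support[OF \<tau>'(1)] \<tau>'(2,3) by metis
      obtain \<rho> where \<rho>: "c (a # \<rho>) \<noteq> 0" "map h \<rho> = \<tau>"
        using pushforward_support[OF \<tau>(1)] by blast
      have "set \<sigma> = h ` set (a # \<rho>) \<union> g ` set (a # \<rho>)"
        using \<tau>(2) \<rho>(2) eq by (auto simp: image_iff) metis
      moreover have "h ` set (a # \<rho>) \<union> g ` set (a # \<rho>) \<in> L"
        using cont oriented_chainsD(3)[OF V(1) c \<rho>(1)] unfolding contiguous_def by blast
      ultimately have "set \<sigma> \<in> L"
        by (simp only:)
      then show ?thesis
        using \<tau>(3) \<rho>(2) oriented_chainsD(2)[OF V(1) c \<rho>(1)] by auto
    qed
    ultimately show ?thesis
      using oriented_chains_iff[OF V(2)] by blast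
  qed
  moreover have "simplicial_chain_map g c - simplicial_chain_map h c = boundary_map (D c) + D (boundary_map c)"
    if c: "c \<in> oriented_chains q K" for c q
  proof
    fix w
    show "(simplicial_chain_map g c - simplicial_chain_map h c) w = (boundary_map (D c) + D (boundary_map c)) w"
    proof (cases "w = []")
      case True
      then show ?thesis
        by (simp add: boundary_map_def D_def simplicial_chain_map_eq_pushforward[OF V(1) subset_refl c])
    next
      case False
      then have "boundary_map (D c) w = face_sum ?V' (D c) w"
        using boundary_map_eq_face_sum[OF V(2) subset_refl Dc[OF c]] by simp
      moreover have "(\<lambda>u. boundary_map c (a # u)) = (\<lambda>u. face_sum ?V c (a # u))"
        using boundary_map_eq_face_sum[OF V(1) subset_refl c] by simp
      then have "D (boundary_map c) w =
          vertex_cone (h a) (vertex_cone (g a) (pushforward ?V h (\<lambda>u. face_sum ?V c (a # u)))) w"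
        unfolding D_def by simp
      ultimately show ?thesis
        using single_vertex_homotopy[OF V a hg oriented_chainsD(1)[OF V(1) c] eq]
        by (simp add: D_def simplicial_chain_map_eq_pushforward[OF V(1) subset_refl c])
    qed
  qed
  ultimately show ?thesis
    unfolding chain_homotopy_def by blast
qed

text \<open>Contiguous maps are chain homotopic: one passes from one to the other by changing the image of
  one vertex at a time.\<close>

lemma contiguous_chain_homotopy:
  fixes h g :: "'v \<Rightarrow> 'w"
  assumes K: "finite_complex K" and L: "finite_complex L" and cont: "contiguous K L h g"
  shows "\<exists>D. chain_homotopy K L h g (D :: ('v list \<Rightarrow> 'g::ab_group_add) \<Rightarrow> _)"
proof -
  have fin: "finite (\<Union>K)" "finite (\<Union>L)"
    using K L by (simp_all add: finite_complex_def)
  have "\<exists>D. chain_homotopy K L h g (D :: ('v list \<Rightarrow> 'g) \<Rightarrow> _)"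
    if "finite A" "A \<subseteq> \<Union>K" "contiguous K L h g" "\<And>v. v \<in> \<Union>K - A \<Longrightarrow> h v = g v" for A and h :: "'v \<Rightarrow> 'w"
    using that
  proof (induction A arbitrary: h rule: finite_induct)
    case empty
    have "simplicial_chain_map g c - simplicial_chain_map h c = 0" if "c \<in> oriented_chains q K"
      for c :: "'v list \<Rightarrow> 'g" and q
      using simplicial_chain_map_cong[OF fin(1) that, of h g] empty.prems(3) by simp
    then have "chain_homotopy K L h g (\<lambda>_ :: 'v list \<Rightarrow> 'g. 0)"
      unfolding chain_homotopy_def by (simp add: zero_in_oriented_chains boundary_map_zero)
    then show ?case by blast
  next
    case (insert a A)
    \<comment> \<open>The intermediate map takes its values among those of \<open>h\<close> and \<open>g\<close>, so it is contiguous to both.\<close>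
    define m where "m = h(a := g a)"
    have m: "m ` s \<subseteq> h ` s \<union> g ` s" for s
      by (auto simp: m_def)
    have L': "t \<in> L" if "s \<in> K" "t \<subseteq> h ` s \<union> g ` s" "t \<noteq> {}" for s t
      using finite_complex_face[OF L] insert.prems(2) that unfolding contiguous_def by blast
    have ne: "s \<noteq> {}" if "s \<in> K" for s
      using K that unfolding finite_complex_def by blast
    have "contiguous K L h m" "contiguous K L m g"
      unfolding contiguous_def using m ne by (auto intro!: L')
    moreover have "\<exists>D. chain_homotopy K L m g (D :: ('v list \<Rightarrow> 'g) \<Rightarrow> _)"
    proof (rule insert.IH[OF _ \<open>contiguous K L m g\<close>])
      show "A \<subseteq> \<Union>K" using insert.prems(1) by simp
      show "m v = g v" if "v \<in> \<Union>K - A" for v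
        using insert.prems(3)[of v] that by (auto simp: m_def)
    qed
    moreover have "\<exists>D. chain_homotopy K L h m (D :: ('v list \<Rightarrow> 'g) \<Rightarrow> _)"
      using single_vertex_chain_homotopy[OF K L \<open>contiguous K L h m\<close>, of a] insert.prems(1)
      by (auto simp: m_def)
    ultimately obtain D D' :: "('v list \<Rightarrow> 'g) \<Rightarrow> 'w list \<Rightarrow> 'g"
      where D: "chain_homotopy K L h m D" "chain_homotopy K L m g D'"
      by blast
    have "chain_homotopy K L h g (\<lambda>c. D c + D' c)"
      unfolding chain_homotopy_def
    proof (intro conjI allI ballI)
      fix c d show "D (c + d) + D' (c + d) = D c + D' c + (D d + D' d)"
        using chain_homotopyD(1)[OF D(1)] chain_homotopyD(1)[OF D(2)] by simp
    next
      fix q and c :: "'v list \<Rightarrow> 'g" assume c: "c \<in> oriented_chains q K"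
      note in1 = chain_homotopyD(2)[OF D(1) c] and in2 = chain_homotopyD(2)[OF D(2) c]
      show "D c + D' c \<in> oriented_chains (Suc q) L"
        using add_in_oriented_chains[OF fin(2) in1 in2] .
      show "simplicial_chain_map g c - simplicial_chain_map h c =
          boundary_map (D c + D' c) + (D (boundary_map c) + D' (boundary_map c))"
        using chain_homotopyD(3)[OF D(1) c] chain_homotopyD(3)[OF D(2) c]
          boundary_map_add[OF fin(2) in1 in2]
        by (simp add: algebra_simps)
    qed
    then show ?case by blast
  qed
  from this[OF fin(1) subset_refl cont] show ?thesis by simp
qed

section \<open>Quotients of additive groups\<close>

text \<open>Subgroups of the additive group of a type. The groups of (co)cycles and (co)boundaries are of
  this form.\<close>

definition additive_subgroup :: "'a::ab_group_add set \<Rightarrow> bool" where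
  "additive_subgroup S \<longleftrightarrow> 0 \<in> S \<and> (\<forall>x\<in>S. \<forall>y\<in>S. x + y \<in> S) \<and> (\<forall>x\<in>S. - x \<in> S)"

text \<open>The coset of \<open>z\<close> modulo \<open>B\<close>. The group \<open>Z\<close> only provides the addition; the coset does not depend
  on it.\<close>

abbreviation coset_of :: "'a::ab_group_add set \<Rightarrow> 'a set \<Rightarrow> 'a \<Rightarrow> 'a set" where
  "coset_of Z B z \<equiv> B #>\<^bsub>additive_group_on Z\<^esub> z"

lemma coset_of_eq: "coset_of Z B z = (\<lambda>b. b + z) ` B"
  by (auto simp: r_coset_def additive_group_on_def)

lemma additive_subgroup_diff: "additive_subgroup S \<Longrightarrow> x \<in> S \<Longrightarrow> y \<in> S \<Longrightarrow> x - y \<in> S"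
  unfolding additive_subgroup_def by (metis add_uminus_conv_diff)

lemma coset_of_eq_iff:
  assumes "additive_subgroup B"
  shows "coset_of Z B z = coset_of Z B z' \<longleftrightarrow> z - z' \<in> B"
proof
  assume "coset_of Z B z = coset_of Z B z'"
  moreover have "0 + z \<in> coset_of Z B z"
    using assms unfolding coset_of_eq additive_subgroup_def by blast
  ultimately obtain b where "b \<in> B" "z = b + z'"
    unfolding coset_of_eq by auto
  then show "z - z' \<in> B" by simp
next
  have sub: "coset_of Z B z \<subseteq> coset_of Z B z'" if "z - z' \<in> B" for z z'
  proof
    fix x assume "x \<in> coset_of Z B z"
    then obtain b where b: "b \<in> B" "x = b + z"
      unfolding coset_of_eq by blast
    have "b + (z - z') \<in> B"
      using assms b that unfolding additive_subgroup_def by blast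
    moreover have "x = (b + (z - z')) + z'"
      using b by simp
    ultimately show "x \<in> coset_of Z B z'"
      unfolding coset_of_eq by blast
  qed
  assume z: "z - z' \<in> B"
  then have "z' - z \<in> B"
    using assms unfolding additive_subgroup_def by (metis minus_diff_eq)
  then show "coset_of Z B z = coset_of Z B z'"
    using sub z by blast
qed

lemma carrier_quotient: "carrier (additive_group_on Z Mod B) = coset_of Z B ` Z"
  by (simp add: carrier_FactGroup additive_group_on_def)

lemma mult_quotient:
  assumes "additive_subgroup B"
  shows "coset_of Z B x \<otimes>\<^bsub>additive_group_on Z Mod B\<^esub> coset_of Z B y = coset_of Z B (x + y)"
proof -
  have "coset_of Z B x \<otimes>\<^bsub>additive_group_on Z Mod B\<^esub> coset_of Z B y = (\<Union>b\<in>B. \<Union>b'\<in>B. {(b + x) + (b' + y)})"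
    unfolding mult_FactGroup set_mult_def coset_of_eq by (simp add: additive_group_on_def)
  also have "\<dots> = coset_of Z B (x + y)"
  proof (rule equalityI; rule subsetI)
    fix z assume "z \<in> (\<Union>b\<in>B. \<Union>b'\<in>B. {(b + x) + (b' + y)})"
    then obtain b b' where "b \<in> B" "b' \<in> B" "z = (b + b') + (x + y)"
      by (auto simp: algebra_simps)
    then show "z \<in> coset_of Z B (x + y)"
      using assms unfolding additive_subgroup_def coset_of_eq by blast
  next
    fix z assume "z \<in> coset_of Z B (x + y)"
    then obtain b where "b \<in> B" "z = (b + x) + (0 + y)"
      unfolding coset_of_eq by (auto simp: algebra_simps)
    then show "z \<in> (\<Union>b\<in>B. \<Union>b'\<in>B. {(b + x) + (b' + y)})"
      using assms unfolding additive_subgroup_def by blast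
  qed
  finally show ?thesis .
qed

text \<open>A homomorphism \<open>t\<close> of pairs of groups induces a map of the quotients, written here as the union
  of the cosets of the images of all representatives.\<close>

locale induced_quotient_map =
  fixes Z B :: "'a::ab_group_add set" and Z' B' :: "'b::ab_group_add set" and t :: "'a \<Rightarrow> 'b"
  assumes subgroups: "additive_subgroup Z" "additive_subgroup B" "additive_subgroup Z'" "additive_subgroup B'"
    and B_le: "B \<subseteq> Z"
    and t_in: "z \<in> Z \<Longrightarrow> t z \<in> Z'" "z \<in> B \<Longrightarrow> t z \<in> B'"
    and t_add: "z \<in> Z \<Longrightarrow> z' \<in> Z \<Longrightarrow> t (z + z') = t z + t z'"
begin

definition induced :: "'a set \<Rightarrow> 'b set" where
  "induced P = (\<Union>z\<in>P. coset_of Z' B' (t z))"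

lemma induced_coset:
  assumes z: "z \<in> Z"
  shows "induced (coset_of Z B z) = coset_of Z' B' (t z)"
proof -
  have "coset_of Z' B' (t (b + z)) = coset_of Z' B' (t z)" if b: "b \<in> B" for b
    using t_add[of b z] t_in(2)[OF b] b z B_le by (auto simp: coset_of_eq_iff[OF subgroups(4)])
  moreover have "B \<noteq> {}"
    using subgroups(2) unfolding additive_subgroup_def by blast
  ultimately show ?thesis
    unfolding induced_def coset_of_eq[of Z B] by auto
qed

lemma induced_hom: "induced \<in> hom (additive_group_on Z Mod B) (additive_group_on Z' Mod B')"
proof (rule homI)
  fix P Q assume "P \<in> carrier (additive_group_on Z Mod B)" "Q \<in> carrier (additive_group_on Z Mod B)"
  then obtain x y where xy: "x \<in> Z" "y \<in> Z" "P = coset_of Z B x" "Q = coset_of Z B y"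
    unfolding carrier_quotient by blast
  then have "x + y \<in> Z"
    using subgroups(1) unfolding additive_subgroup_def by blast
  then show "induced (P \<otimes>\<^bsub>additive_group_on Z Mod B\<^esub> Q) = induced P \<otimes>\<^bsub>additive_group_on Z' Mod B'\<^esub> induced Q"
    using xy by (simp only: mult_quotient[OF subgroups(2)] mult_quotient[OF subgroups(4)] induced_coset t_add)
next
  fix P assume "P \<in> carrier (additive_group_on Z Mod B)"
  then show "induced P \<in> carrier (additive_group_on Z' Mod B')"
    unfolding carrier_quotient using induced_coset t_in(1) by auto
qed

end

section \<open>Induced maps on homology and cohomology\<close>

lemma additive_subgroup_chains: "finite (\<Union>K) \<Longrightarrow> additive_subgroup (oriented_chains q K)"
  unfolding additive_subgroup_def
  by (blast intro: zero_in_oriented_chains add_in_oriented_chains uminus_in_oriented_chains)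

lemma additive_subgroup_kernel:
  fixes t :: "'a::ab_group_add \<Rightarrow> 'b::ab_group_add"
  assumes "additive_subgroup S" "\<And>x y. x \<in> S \<Longrightarrow> y \<in> S \<Longrightarrow> t (x + y) = t x + t y"
  shows "additive_subgroup {x \<in> S. t x = 0}"
proof -
  have S: "0 \<in> S" "\<And>x. x \<in> S \<Longrightarrow> - x \<in> S" "\<And>x y. x \<in> S \<Longrightarrow> y \<in> S \<Longrightarrow> x + y \<in> S"
    using assms(1) unfolding additive_subgroup_def by auto
  have 0: "t 0 = 0"
    using assms(2)[OF S(1) S(1)] by simp
  have "t (- x) = 0" if "x \<in> S" "t x = 0" for x
    using assms(2)[OF that(1) S(2)[OF that(1)]] 0 that by simp
  then show ?thesis
    using S 0 assms(2) unfolding additive_subgroup_def by simp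
qed

lemma additive_subgroup_image:
  fixes t :: "'a::ab_group_add \<Rightarrow> 'b::ab_group_add"
  assumes "additive_subgroup S" "\<And>x y. x \<in> S \<Longrightarrow> y \<in> S \<Longrightarrow> t (x + y) = t x + t y"
  shows "additive_subgroup (t ` S)"
proof -
  have S: "0 \<in> S" "\<And>x. x \<in> S \<Longrightarrow> - x \<in> S" "\<And>x y. x \<in> S \<Longrightarrow> y \<in> S \<Longrightarrow> x + y \<in> S"
    using assms(1) unfolding additive_subgroup_def by auto
  have 0: "t 0 = 0"
    using assms(2)[OF S(1) S(1)] by simp
  have "t (- x) = - t x" if "x \<in> S" for x
    using assms(2)[OF that S(2)[OF that]] 0 by (simp add: eq_neg_iff_add_eq_0 add.commute)
  then have "- t x \<in> t ` S" if "x \<in> S" for x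
    using S(2)[OF that] that by (metis imageI)
  moreover have "t x + t y \<in> t ` S" if "x \<in> S" "y \<in> S" for x y
    using S(3)[OF that] assms(2)[OF that] by (metis imageI)
  moreover have "0 \<in> t ` S"
    using 0 S(1) by (metis imageI)
  ultimately show ?thesis
    unfolding additive_subgroup_def by auto
qed

lemma additive_subgroup_cycles: "finite (\<Union>K) \<Longrightarrow> additive_subgroup (cycles q K)"
  unfolding cycles_def by (intro additive_subgroup_kernel additive_subgroup_chains boundary_map_add)

lemma additive_subgroup_boundaries: "finite (\<Union>K) \<Longrightarrow> additive_subgroup (boundaries q K)"
  unfolding boundaries_def by (intro additive_subgroup_image additive_subgroup_chains boundary_map_add)

lemma boundaries_subset_cycles: "finite_complex K \<Longrightarrow> boundaries q K \<subseteq> cycles q K"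
  unfolding boundaries_def cycles_def
  using boundary_map_in_oriented_chains boundary_map_boundary_map by blast

lemma homology_quotient_map:
  fixes K :: "'v set set" and L :: "'w set set"
  assumes K: "finite_complex K" and L: "finite_complex L" and h: "simplicial K L h"
  shows "induced_quotient_map (cycles q K) (boundaries q K) (cycles q L) (boundaries q L)
    (simplicial_chain_map h :: ('v list \<Rightarrow> 'g::ab_group_add) \<Rightarrow> _)"
proof
  note fin = finite_complex_finite[OF K] finite_complex_finite[OF L]
  show "additive_subgroup (cycles q K :: ('v list \<Rightarrow> 'g) set)" "additive_subgroup (boundaries q K :: ('v list \<Rightarrow> 'g) set)"
    "additive_subgroup (cycles q L :: ('w list \<Rightarrow> 'g) set)" "additive_subgroup (boundaries q L :: ('w list \<Rightarrow> 'g) set)"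
    using fin additive_subgroup_cycles additive_subgroup_boundaries by blast+
  show "boundaries q K \<subseteq> (cycles q K :: ('v list \<Rightarrow> 'g) set)"
    using boundaries_subset_cycles[OF K] .
  fix z :: "'v list \<Rightarrow> 'g"
  show "simplicial_chain_map h z \<in> cycles q L" if "z \<in> cycles q K"
  proof -
    have "z \<in> oriented_chains q K" "boundary_map z = 0"
      using that by (auto simp: cycles_def)
    moreover have "simplicial_chain_map h 0 = (0 :: 'w list \<Rightarrow> 'g)"
      by (simp add: simplicial_chain_map_def fun_eq_iff)
    ultimately show ?thesis
      using simplicial_chain_map_in_oriented_chains[OF fin h, of z q]
        boundary_map_simplicial_chain_map[OF K L h, of z q]
      unfolding cycles_def by auto
  qed
  show "simplicial_chain_map h z \<in> boundaries q L" if z: "z \<in> boundaries q K"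
  proof -
    obtain c where c: "c \<in> oriented_chains (Suc q) K" "z = boundary_map c"
      using z unfolding boundaries_def by blast
    then have "simplicial_chain_map h z = boundary_map (simplicial_chain_map h c)"
      using boundary_map_simplicial_chain_map[OF K L h c(1)] by simp
    then show ?thesis
      using simplicial_chain_map_in_oriented_chains[OF fin h c(1)] unfolding boundaries_def by blast
  qed
  fix z' :: "'v list \<Rightarrow> 'g"
  show "simplicial_chain_map h (z + z') = simplicial_chain_map h z + simplicial_chain_map h z'"
    if "z \<in> cycles q K" "z' \<in> cycles q K"
    using that simplicial_chain_map_add[OF fin(1)] unfolding cycles_def by blast
qed

lemma carrier_simplicial_homology:
  "carrier (simplicial_homology TYPE('g::ab_group_add) q K) = homology_class q K ` cycles q K"
  by (simp add: simplicial_homology_def carrier_quotient homology_class_def image_def)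

lemma homology_map_class:
  assumes "finite_complex K" "finite_complex L" "simplicial K L h" "z \<in> cycles q K"
  shows "homology_map q L h (homology_class q K z) = homology_class q L (simplicial_chain_map h z)"
proof -
  interpret induced_quotient_map "cycles q K" "boundaries q K" "cycles q L" "boundaries q L" "simplicial_chain_map h"
    using homology_quotient_map[OF assms(1-3)] .
  show ?thesis
    using induced_coset[OF assms(4)] unfolding homology_map_def homology_class_def induced_def .
qed

lemma homology_map_hom:
  assumes "finite_complex K" "finite_complex L" "simplicial K L h"
  shows "homology_map q L h \<in>
    hom (simplicial_homology TYPE('g::ab_group_add) q K) (simplicial_homology TYPE('g) q L)"
proof -
  interpret induced_quotient_map "cycles q K" "boundaries q K" "cycles q L" "boundaries q L"
    "simplicial_chain_map h :: (_ \<Rightarrow> 'g) \<Rightarrow> _"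
    using homology_quotient_map[OF assms(1-3)] .
  have "homology_map q L h = induced"
    by (simp add: homology_map_def homology_class_def induced_def fun_eq_iff)
  then show ?thesis
    using induced_hom unfolding simplicial_homology_def by simp
qed

lemma homology_map_compose:
  assumes K: "finite_complex K" and L: "finite_complex L" and M: "finite_complex M"
    and h: "simplicial K L h" and g: "simplicial L M g"
    and P: "P \<in> carrier (simplicial_homology TYPE('g::ab_group_add) q K)"
  shows "homology_map q M g (homology_map q L h P) = homology_map q M (g \<circ> h) P"
proof -
  obtain z where z: "z \<in> cycles q K" "P = homology_class q K z"
    using P unfolding carrier_simplicial_homology by blast
  have gh: "simplicial K M (g \<circ> h)"
    using h g unfolding simplicial_def by (metis image_comp)
  have "simplicial_chain_map h z \<in> cycles q L"
    using induced_quotient_map.t_in(1)[OF homology_quotient_map[OF K L h] z(1)] .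
  then show ?thesis
    using simplicial_chain_map_compose[OF finite_complex_finite[OF K] finite_complex_finite[OF L] h, of z q g] z(1)
    by (simp add: z(2) homology_map_class[OF K L h z(1)] homology_map_class[OF L M g]
        homology_map_class[OF K M gh z(1)] cycles_def)
qed

lemma homology_map_contiguous:
  fixes K :: "'v set set" and L :: "'w set set"
  assumes K: "finite_complex K" and L: "finite_complex L" and cont: "contiguous K L h g"
    and P: "P \<in> carrier (simplicial_homology TYPE('g::ab_group_add) q K)"
  shows "homology_map q L h P = homology_map q L g P"
proof -
  obtain z where z: "z \<in> cycles q K" "P = homology_class q K z"
    using P unfolding carrier_simplicial_homology by blast
  obtain D :: "('v list \<Rightarrow> 'g) \<Rightarrow> 'w list \<Rightarrow> 'g" where D: "chain_homotopy K L h g D"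
    using contiguous_chain_homotopy[OF K L cont] by blast
  have c: "z \<in> oriented_chains q K" and b: "boundary_map z = 0"
    using z(1) by (auto simp: cycles_def)
  have "simplicial_chain_map g z - simplicial_chain_map h z = boundary_map (D z)"
    using chain_homotopyD(3)[OF D c] chain_homotopyD(4)[OF D] b by simp
  then have "simplicial_chain_map g z - simplicial_chain_map h z \<in> boundaries q L"
    using chain_homotopyD(2)[OF D c] unfolding boundaries_def by blast
  then have "homology_class q L (simplicial_chain_map g z) = homology_class q L (simplicial_chain_map h z)"
    unfolding homology_class_def
    using coset_of_eq_iff[OF additive_subgroup_boundaries[OF finite_complex_finite[OF L]]] by blast
  then show ?thesis
    using homology_map_class[OF K L contiguous_simplicial(1)[OF K L cont] z(1)]
      homology_map_class[OF K L contiguous_simplicial(2)[OF K L cont] z(1)] z(2) by simp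
qed

lemma homology_map_id:
  assumes K: "finite_complex K" and id: "\<And>v. v \<in> \<Union>K \<Longrightarrow> h v = v"
    and P: "P \<in> carrier (simplicial_homology TYPE('g::ab_group_add) q K)"
  shows "homology_map q K h P = P"
proof -
  obtain z where z: "z \<in> cycles q K" "P = homology_class q K z"
    using P unfolding carrier_simplicial_homology by blast
  have "h ` s = s" if "s \<in> K" for s
    using that id by (force simp: image_iff)
  then have "simplicial K K h"
    by (simp add: simplicial_def)
  moreover have "simplicial_chain_map h z = z"
    using z(1) simplicial_chain_map_id[OF finite_complex_finite[OF K] _ id] unfolding cycles_def by blast
  ultimately show ?thesis
    using homology_map_class[OF K K _ z(1)] z(2) by simp
qed

lemma cochainsD:
  assumes "u \<in> cochains q K"
  shows "c \<in> oriented_chains q K \<Longrightarrow> d \<in> oriented_chains q K \<Longrightarrow> u (c + d) = u c + u d"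
    and "c \<notin> oriented_chains q K \<Longrightarrow> u c = 0"
    and "finite (\<Union>K) \<Longrightarrow> u 0 = 0"
    and "finite (\<Union>K) \<Longrightarrow> c \<in> oriented_chains q K \<Longrightarrow> d \<in> oriented_chains q K \<Longrightarrow> u (c - d) = u c - u d"
proof -
  show add: "u (c + d) = u c + u d" if "c \<in> oriented_chains q K" "d \<in> oriented_chains q K" for c d
    using assms that by (auto simp: cochains_def hom_def additive_group_on_def)
  show "c \<notin> oriented_chains q K \<Longrightarrow> u c = 0"
    using assms by (simp add: cochains_def)
  show "u 0 = 0" if "finite (\<Union>K)"
    using add[OF zero_in_oriented_chains zero_in_oriented_chains] by simp
  show "u (c - d) = u c - u d"
    if "finite (\<Union>K)" "c \<in> oriented_chains q K" "d \<in> oriented_chains q K"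
    using add[OF additive_subgroup_diff[OF additive_subgroup_chains[OF that(1)] that(2,3)] that(3)] by simp
qed

lemma cochainsI:
  assumes "\<And>c d. c \<in> oriented_chains q K \<Longrightarrow> d \<in> oriented_chains q K \<Longrightarrow> u (c + d) = u c + u d"
    and "\<And>c. c \<notin> oriented_chains q K \<Longrightarrow> u c = 0"
  shows "u \<in> cochains q K"
  using assms by (simp add: cochains_def hom_def additive_group_on_def)

lemma additive_subgroup_cochains:
  assumes "finite (\<Union>K)"
  shows "additive_subgroup (cochains q K)"
  unfolding additive_subgroup_def
proof (intro conjI ballI)
  show "0 \<in> cochains q K"
    by (rule cochainsI) auto
  show "u + u' \<in> cochains q K" if "u \<in> cochains q K" "u' \<in> cochains q K" for u u'
    using cochainsD(1,2)[OF that(1)] cochainsD(1,2)[OF that(2)] by (intro cochainsI) (simp_all add: algebra_simps)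
  show "- u \<in> cochains q K" if "u \<in> cochains q K" for u
    using cochainsD(1,2)[OF that(1)] by (intro cochainsI) (auto simp: algebra_simps)
qed

lemma coboundary_map_add: "coboundary_map q K (u + u') = coboundary_map q K u + coboundary_map q K u'"
  by (simp add: coboundary_map_def fun_eq_iff)

lemma coboundary_map_in_cochains:
  assumes K: "finite_complex K" and u: "u \<in> cochains q K"
  shows "coboundary_map q K u \<in> cochains (Suc q) K"
proof (rule cochainsI)
  fix c d :: "'a list \<Rightarrow> int" assume cd: "c \<in> oriented_chains (Suc q) K" "d \<in> oriented_chains (Suc q) K"
  note fin = finite_complex_finite[OF K]
  show "coboundary_map q K u (c + d) = coboundary_map q K u c + coboundary_map q K u d"
    using cd add_in_oriented_chains[OF fin cd] boundary_map_add[OF fin cd]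
      cochainsD(1)[OF u boundary_map_in_oriented_chains[OF K cd(1)] boundary_map_in_oriented_chains[OF K cd(2)]]
    by (simp add: coboundary_map_def)
qed (simp add: coboundary_map_def)

lemma coboundary_map_coboundary_map:
  assumes K: "finite_complex K" and u: "u \<in> cochains q K"
  shows "coboundary_map (Suc q) K (coboundary_map q K u) = 0"
proof
  fix c
  show "coboundary_map (Suc q) K (coboundary_map q K u) c = 0 c"
    using boundary_map_boundary_map[OF K, of c "Suc q"] cochainsD(3)[OF u finite_complex_finite[OF K]]
    by (simp add: coboundary_map_def)
qed

lemma additive_subgroup_cocycles: "finite (\<Union>K) \<Longrightarrow> additive_subgroup (cocycles q K)"
  unfolding cocycles_def by (intro additive_subgroup_kernel additive_subgroup_cochains coboundary_map_add)

lemma additive_subgroup_coboundaries: "finite (\<Union>K) \<Longrightarrow> additive_subgroup (coboundaries q K)"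
  by (cases q) (auto intro: additive_subgroup_image additive_subgroup_cochains coboundary_map_add
      simp: additive_subgroup_def[of "{0}"])

lemma coboundaries_subset_cocycles:
  assumes K: "finite_complex K"
  shows "coboundaries q K \<subseteq> (cocycles q K :: (_ \<Rightarrow> 'g::ab_group_add) set)"
proof (cases q)
  case 0
  have "additive_subgroup (cocycles q K :: (_ \<Rightarrow> 'g) set)"
    using additive_subgroup_cocycles[OF finite_complex_finite[OF K]] .
  then show ?thesis
    using 0 by (simp add: additive_subgroup_def)
next
  case (Suc q')
  then show ?thesis
    using coboundary_map_in_cochains[OF K] coboundary_map_coboundary_map[OF K] by (auto simp: cocycles_def)
qed

lemma simplicial_cochain_map_in_cochains:
  assumes K: "finite_complex K" and L: "finite_complex L" and h: "simplicial K L h"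
    and u: "u \<in> cochains q L"
  shows "simplicial_cochain_map q K h u \<in> cochains q K"
proof (rule cochainsI)
  note fin = finite_complex_finite[OF K] finite_complex_finite[OF L]
  fix c d :: "'a list \<Rightarrow> int" assume cd: "c \<in> oriented_chains q K" "d \<in> oriented_chains q K"
  show "simplicial_cochain_map q K h u (c + d) =
      simplicial_cochain_map q K h u c + simplicial_cochain_map q K h u d"
    using cd add_in_oriented_chains[OF fin(1) cd] simplicial_chain_map_add[OF fin(1) cd, of h]
      cochainsD(1)[OF u simplicial_chain_map_in_oriented_chains[OF fin h cd(1)]
        simplicial_chain_map_in_oriented_chains[OF fin h cd(2)]]
    by (simp add: simplicial_cochain_map_def)
qed (simp add: simplicial_cochain_map_def)

lemma coboundary_map_simplicial_cochain_map:
  assumes K: "finite_complex K" and L: "finite_complex L" and h: "simplicial K L h"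
  shows "coboundary_map q K (simplicial_cochain_map q K h u) =
    simplicial_cochain_map (Suc q) K h (coboundary_map q L u)"
proof
  fix c
  note fin = finite_complex_finite[OF K] finite_complex_finite[OF L]
  show "coboundary_map q K (simplicial_cochain_map q K h u) c =
      simplicial_cochain_map (Suc q) K h (coboundary_map q L u) c"
  proof (cases "c \<in> oriented_chains (Suc q) K")
    case True
    then show ?thesis
      using boundary_map_in_oriented_chains[OF K True] simplicial_chain_map_in_oriented_chains[OF fin h True]
        boundary_map_simplicial_chain_map[OF K L h True]
      by (simp add: coboundary_map_def simplicial_cochain_map_def)
  qed (simp add: coboundary_map_def simplicial_cochain_map_def)
qed

lemma simplicial_cochain_map_zero: "simplicial_cochain_map q K h 0 = 0"
  by (simp add: simplicial_cochain_map_def fun_eq_iff)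

lemma simplicial_cochain_map_add:
  "simplicial_cochain_map q K h (u + u') = simplicial_cochain_map q K h u + simplicial_cochain_map q K h u'"
  by (simp add: simplicial_cochain_map_def fun_eq_iff)

lemma cohomology_quotient_map:
  assumes K: "finite_complex K" and L: "finite_complex L" and h: "simplicial K L h"
  shows "induced_quotient_map (cocycles q L) (coboundaries q L) (cocycles q K) (coboundaries q K)
    (simplicial_cochain_map q K h)"
proof
  note fin = finite_complex_finite[OF K] finite_complex_finite[OF L]
  show "additive_subgroup (cocycles q K)" "additive_subgroup (coboundaries q K)"
    "additive_subgroup (cocycles q L)" "additive_subgroup (coboundaries q L)"
    by (intro additive_subgroup_cocycles additive_subgroup_coboundaries fin)+
  show "coboundaries q L \<subseteq> cocycles q L"
    using coboundaries_subset_cocycles[OF L] .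
  fix u
  show "simplicial_cochain_map q K h u \<in> cocycles q K" if "u \<in> cocycles q L"
    using that simplicial_cochain_map_in_cochains[OF K L h, of u q] coboundary_map_simplicial_cochain_map[OF K L h, of q u]
    by (simp add: cocycles_def simplicial_cochain_map_zero)
  show "simplicial_cochain_map q K h u \<in> coboundaries q K" if u: "u \<in> coboundaries q L"
  proof (cases q)
    case 0
    then show ?thesis
      using u by (simp add: simplicial_cochain_map_zero)
  next
    case (Suc q')
    then obtain w where w: "w \<in> cochains q' L" "u = coboundary_map q' L w"
      using u by auto
    have "simplicial_cochain_map q K h u = coboundary_map q' K (simplicial_cochain_map q' K h w)"
      using coboundary_map_simplicial_cochain_map[OF K L h, of q' w] w Suc by simp
    then show ?thesis
      using simplicial_cochain_map_in_cochains[OF K L h w(1)] Suc by simp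
  qed
qed (simp add: simplicial_cochain_map_add)

lemma carrier_simplicial_cohomology:
  "carrier (simplicial_cohomology TYPE('g::ab_group_add) q K) = cohomology_class q K ` cocycles q K"
  by (simp add: simplicial_cohomology_def carrier_quotient cohomology_class_def image_def)

lemma simplicial_cohomology_closed:
  assumes K: "finite_complex K"
    and P: "P \<in> carrier (simplicial_cohomology TYPE('g::ab_group_add) q K)"
    and Q: "Q \<in> carrier (simplicial_cohomology TYPE('g) q K)"
  shows "P \<otimes>\<^bsub>simplicial_cohomology TYPE('g) q K\<^esub> Q \<in> carrier (simplicial_cohomology TYPE('g) q K)"
proof -
  note fin = finite_complex_finite[OF K]
  obtain u w where uw: "u \<in> cocycles q K" "w \<in> cocycles q K" "P = cohomology_class q K u" "Q = cohomology_class q K w"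
    using P Q unfolding carrier_simplicial_cohomology by blast
  then have "u + w \<in> cocycles q K"
    using additive_subgroup_cocycles[OF fin] unfolding additive_subgroup_def by blast
  moreover have "P \<otimes>\<^bsub>simplicial_cohomology TYPE('g) q K\<^esub> Q = cohomology_class q K (u + w)"
    unfolding simplicial_cohomology_def uw(3,4) cohomology_class_def
    by (rule mult_quotient[OF additive_subgroup_coboundaries[OF fin]])
  ultimately show ?thesis
    unfolding carrier_simplicial_cohomology by blast
qed

lemma cohomology_map_class:
  assumes "finite_complex K" "finite_complex L" "simplicial K L h" "u \<in> cocycles q L"
  shows "cohomology_map q K h (cohomology_class q L u) = cohomology_class q K (simplicial_cochain_map q K h u)"
proof -
  interpret induced_quotient_map "cocycles q L" "coboundaries q L" "cocycles q K" "coboundaries q K"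
    "simplicial_cochain_map q K h"
    using cohomology_quotient_map[OF assms(1-3)] .
  show ?thesis
    using induced_coset[OF assms(4)] unfolding cohomology_map_def cohomology_class_def induced_def .
qed

lemma cohomology_map_hom:
  assumes "finite_complex K" "finite_complex L" "simplicial K L h"
  shows "cohomology_map q K h \<in>
    hom (simplicial_cohomology TYPE('g::ab_group_add) q L) (simplicial_cohomology TYPE('g) q K)"
proof -
  interpret induced_quotient_map "cocycles q L" "coboundaries q L" "cocycles q K" "coboundaries q K"
    "simplicial_cochain_map q K h :: (_ \<Rightarrow> 'g) \<Rightarrow> _"
    using cohomology_quotient_map[OF assms(1-3)] .
  have "cohomology_map q K h = induced"
    by (simp add: cohomology_map_def cohomology_class_def induced_def fun_eq_iff)
  then show ?thesis
    using induced_hom unfolding simplicial_cohomology_def by simp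
qed

lemma cohomology_map_compose:
  assumes K: "finite_complex K" and L: "finite_complex L" and M: "finite_complex M"
    and h: "simplicial K L h" and g: "simplicial L M g"
    and P: "P \<in> carrier (simplicial_cohomology TYPE('g::ab_group_add) q M)"
  shows "cohomology_map q K h (cohomology_map q L g P) = cohomology_map q K (g \<circ> h) P"
proof -
  note fin = finite_complex_finite[OF K] finite_complex_finite[OF L]
  obtain u where u: "u \<in> cocycles q M" "P = cohomology_class q M u"
    using P unfolding carrier_simplicial_cohomology by blast
  have gh: "simplicial K M (g \<circ> h)"
    using h g unfolding simplicial_def by (metis image_comp)
  have gu: "simplicial_cochain_map q L g u \<in> cocycles q L"
    using induced_quotient_map.t_in(1)[OF cohomology_quotient_map[OF L M g] u(1)] .
  have "simplicial_cochain_map q K h (simplicial_cochain_map q L g u) = simplicial_cochain_map q K (g \<circ> h) u"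
    by (simp add: simplicial_cochain_map_def fun_eq_iff simplicial_chain_map_in_oriented_chains[OF fin h]
        simplicial_chain_map_compose[OF fin h])
  then show ?thesis
    using cohomology_map_class[OF L M g u(1)] cohomology_map_class[OF K L h gu]
      cohomology_map_class[OF K M gh u(1)] u(2) by simp
qed

lemma cohomology_map_contiguous:
  fixes K :: "'v set set" and L :: "'w set set"
  assumes K: "finite_complex K" and L: "finite_complex L" and cont: "contiguous K L h g"
    and P: "P \<in> carrier (simplicial_cohomology TYPE('g::ab_group_add) q L)"
  shows "cohomology_map q K h P = cohomology_map q K g P"
proof -
  note fin = finite_complex_finite[OF K] finite_complex_finite[OF L]
  note h = contiguous_simplicial(1)[OF K L cont] and g = contiguous_simplicial(2)[OF K L cont]
  obtain u where u: "u \<in> cocycles q L" "P = cohomology_class q L u"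
    using P unfolding carrier_simplicial_cohomology by blast
  then have uc: "u \<in> cochains q L" and du: "coboundary_map q L u = 0"
    by (auto simp: cocycles_def)
  obtain D :: "('v list \<Rightarrow> int) \<Rightarrow> 'w list \<Rightarrow> int" where D: "chain_homotopy K L h g D"
    using contiguous_chain_homotopy[OF K L cont] by blast
  let ?d = "simplicial_cochain_map q K g u - simplicial_cochain_map q K h u"
  have ub: "u (boundary_map c) = 0" if "c \<in> oriented_chains (Suc q) L" for c
    using fun_cong[OF du, of c] that by (simp add: coboundary_map_def)
  \<comment> \<open>The cocycle \<open>u\<close> vanishes on boundaries, so only the second half of the homotopy formula survives.\<close>
  have d: "?d c = u (D (boundary_map c))" if c: "c \<in> oriented_chains q K" for c
  proof -
    have b: "boundary_map (D c) \<in> oriented_chains q L"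
      using boundary_map_in_oriented_chains[OF L chain_homotopyD(2)[OF D c]] .
    have "?d c = u (simplicial_chain_map g c - simplicial_chain_map h c)"
      using c cochainsD(4)[OF uc fin(2)] simplicial_chain_map_in_oriented_chains[OF fin _ c] h g
      by (simp add: simplicial_cochain_map_def)
    also have "\<dots> = u (boundary_map (D c) + D (boundary_map c))"
      using chain_homotopyD(3)[OF D c] by simp
    also have "\<dots> = u (boundary_map (D c)) + u (D (boundary_map c))"
    proof (rule cochainsD(1)[OF uc b])
      have "D (boundary_map c) = (simplicial_chain_map g c - simplicial_chain_map h c) - boundary_map (D c)"
        using chain_homotopyD(3)[OF D c] by simp
      then show "D (boundary_map c) \<in> oriented_chains q L"
        using simplicial_chain_map_in_oriented_chains[OF fin _ c] h g b
          additive_subgroup_diff[OF additive_subgroup_chains[OF fin(2)]] by metis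
    qed
    also have "u (boundary_map (D c)) = 0"
      using ub chain_homotopyD(2)[OF D c] by blast
    finally show ?thesis by simp
  qed
  have d0: "?d c = 0" if "c \<notin> oriented_chains q K" for c
    using that by (simp add: simplicial_cochain_map_def)
  have "?d \<in> coboundaries q K"
  proof (cases q)
    case 0
    have "?d c = 0" for c
      using d[of c] d0[of c] boundary_map_dim_0[OF fin(1), of c] chain_homotopyD(4)[OF D] 0
        cochainsD(3)[OF uc fin(2)] by (cases "c \<in> oriented_chains q K") auto
    then show ?thesis
      using 0 by (simp add: fun_eq_iff)
  next
    case (Suc q')
    \<comment> \<open>The difference is the coboundary of \<open>u \<circ> D\<close>.\<close>
    define w where "w c = (if c \<in> oriented_chains q' K then u (D c) else 0)" for c
    have "w \<in> cochains q' K"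
    proof (rule cochainsI)
      fix c d :: "'v list \<Rightarrow> int" assume cd: "c \<in> oriented_chains q' K" "d \<in> oriented_chains q' K"
      show "w (c + d) = w c + w d"
        using cd add_in_oriented_chains[OF fin(1) cd] chain_homotopyD(1)[OF D]
          cochainsD(1)[OF uc] chain_homotopyD(2)[OF D] Suc by (simp add: w_def)
    qed (simp add: w_def)
    moreover have "?d = coboundary_map q' K w"
    proof
      fix c
      show "?d c = coboundary_map q' K w c"
        using d[of c] d0[of c] boundary_map_in_oriented_chains[OF K, of c q'] Suc
        by (simp add: coboundary_map_def w_def)
    qed
    ultimately show ?thesis
      using Suc by simp
  qed
  then have "cohomology_class q K (simplicial_cochain_map q K g u) =
      cohomology_class q K (simplicial_cochain_map q K h u)"
    unfolding cohomology_class_def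
    using coset_of_eq_iff[OF additive_subgroup_coboundaries[OF fin(1)]] by blast
  then show ?thesis
    using cohomology_map_class[OF K L h u(1)] cohomology_map_class[OF K L g u(1)] u(2) by simp
qed

lemma cohomology_map_id:
  assumes K: "finite_complex K" and id: "\<And>v. v \<in> \<Union>K \<Longrightarrow> h v = v"
    and P: "P \<in> carrier (simplicial_cohomology TYPE('g::ab_group_add) q K)"
  shows "cohomology_map q K h P = P"
proof -
  obtain u where u: "u \<in> cocycles q K" "P = cohomology_class q K u"
    using P unfolding carrier_simplicial_cohomology by blast
  have "h ` s = s" if "s \<in> K" for s
    using that id by (force simp: image_iff)
  then have "simplicial K K h"
    by (simp add: simplicial_def)
  moreover have "u c = simplicial_cochain_map q K h u c" for c
    using u(1) cochainsD(2)[of u q K c] simplicial_chain_map_id[OF finite_complex_finite[OF K] _ id, of c q]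
    unfolding cocycles_def simplicial_cochain_map_def by auto
  then have "simplicial_cochain_map q K h u = u"
    by (simp add: fun_eq_iff)
  ultimately show ?thesis
    using cohomology_map_class[OF K K _ u(1)] u(2) by simp
qed

section \<open>Maps of nerves\<close>

text \<open>A map between two indexed families of sets: each \<open>F v\<close> is contained in the set that belongs to
  the image of \<open>v\<close>. Prefixes of words and refinements of coverings give maps of this kind.\<close>

definition nerve_map :: "'v set \<Rightarrow> ('v \<Rightarrow> 'a set) \<Rightarrow> 'w set \<Rightarrow> ('w \<Rightarrow> 'a set) \<Rightarrow> ('v \<Rightarrow> 'w) \<Rightarrow> bool" where
  "nerve_map W F W' G h \<longleftrightarrow> (\<forall>v\<in>W. h v \<in> W' \<and> F v \<subseteq> G (h v))"

lemma finite_complex_nerve: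
  assumes "finite W"
  shows "finite_complex (nerve W F)"
proof -
  have "\<Union>(nerve W F) \<subseteq> W"
    by (auto simp: nerve_def)
  then have "finite (\<Union>(nerve W F))"
    by (rule finite_subset[OF _ assms])
  moreover have "t \<in> nerve W F" if "s \<in> nerve W F" "t \<subseteq> s" "t \<noteq> {}" for s t
  proof -
    have s: "s \<subseteq> W" "finite s" "(\<Inter>v\<in>s. F v) \<noteq> {}"
      using that(1) by (simp_all add: nerve_def)
    have "(\<Inter>v\<in>s. F v) \<subseteq> (\<Inter>v\<in>t. F v)"
      using that(2) by (rule INF_superset_mono) simp
    then have "(\<Inter>v\<in>t. F v) \<noteq> {}"
      using s(3) by blast
    then show ?thesis
      using s that(2,3) finite_subset[OF that(2) s(2)] by (simp add: nerve_def)
  qed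
  moreover have "{} \<notin> nerve W F"
    by (simp add: nerve_def)
  ultimately show ?thesis
    unfolding finite_complex_def by blast
qed

text \<open>Any two maps of families induce contiguous maps of the nerves: a common point of the sets of a
  simplex lies in the sets of both images.\<close>

lemma nerve_map_contiguous:
  assumes "nerve_map W F W' G h" "nerve_map W F W' G g"
  shows "contiguous (nerve W F) (nerve W' G) h g"
  unfolding contiguous_def
proof
  fix s assume s: "s \<in> nerve W F"
  then obtain x where x: "\<And>v. v \<in> s \<Longrightarrow> x \<in> F v"
    unfolding nerve_def by blast
  have s': "s \<subseteq> W" "s \<noteq> {}" "finite s"
    using s by (auto simp: nerve_def)
  have "x \<in> G w" "w \<in> W'" if "w \<in> h ` s \<union> g ` s" for w
    using assms s' x that unfolding nerve_map_def by blast+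
  then have "h ` s \<union> g ` s \<subseteq> W'" "x \<in> (\<Inter>w\<in>h ` s \<union> g ` s. G w)"
    by auto
  moreover have "finite (h ` s \<union> g ` s)" "h ` s \<union> g ` s \<noteq> {}"
    using s' by auto
  ultimately show "h ` s \<union> g ` s \<in> nerve W' G"
    unfolding nerve_def by blast
qed

lemma nerve_map_simplicial: "nerve_map W F W' G h \<Longrightarrow> simplicial (nerve W F) (nerve W' G) h"
  using nerve_map_contiguous[of W F W' G h h] by (simp add: contiguous_def simplicial_def)

lemma nerve_map_compose:
  "nerve_map W F W' G h \<Longrightarrow> nerve_map W' G W'' E g \<Longrightarrow> nerve_map W F W'' E (g \<circ> h)"
  unfolding nerve_map_def by fastforce

lemma nerve_homology_hom:
  assumes "finite W" "finite W'" "nerve_map W F W' G h"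
  shows "homology_map q (nerve W' G) h \<in>
    hom (simplicial_homology TYPE('g::ab_group_add) q (nerve W F)) (simplicial_homology TYPE('g) q (nerve W' G))"
  using assms by (intro homology_map_hom finite_complex_nerve nerve_map_simplicial)

lemma nerve_cohomology_hom:
  assumes "finite W" "finite W'" "nerve_map W F W' G h"
  shows "cohomology_map q (nerve W F) h \<in>
    hom (simplicial_cohomology TYPE('g::ab_group_add) q (nerve W' G)) (simplicial_cohomology TYPE('g) q (nerve W F))"
  using assms by (intro cohomology_map_hom finite_complex_nerve nerve_map_simplicial)

lemma nerve_homology_unique:
  assumes "finite W" "finite W'" "nerve_map W F W' G h" "nerve_map W F W' G g"
    and "P \<in> carrier (simplicial_homology TYPE('g::ab_group_add) q (nerve W F))"
  shows "homology_map q (nerve W' G) h P = homology_map q (nerve W' G) g P"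
  using assms by (intro homology_map_contiguous[OF _ _ nerve_map_contiguous] finite_complex_nerve)

lemma nerve_cohomology_unique:
  assumes "finite W" "finite W'" "nerve_map W F W' G h" "nerve_map W F W' G g"
    and "P \<in> carrier (simplicial_cohomology TYPE('g::ab_group_add) q (nerve W' G))"
  shows "cohomology_map q (nerve W F) h P = cohomology_map q (nerve W F) g P"
  using assms by (intro cohomology_map_contiguous[OF _ _ nerve_map_contiguous] finite_complex_nerve)

lemma nerve_homology_triangle:
  assumes fin: "finite W" "finite W'" "finite W''"
    and h: "nerve_map W F W' G h" and g: "nerve_map W' G W'' E g" and k: "nerve_map W F W'' E k"
    and P: "P \<in> carrier (simplicial_homology TYPE('g::ab_group_add) q (nerve W F))"
  shows "homology_map q (nerve W'' E) g (homology_map q (nerve W' G) h P) = homology_map q (nerve W'' E) k P"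
proof -
  have "homology_map q (nerve W'' E) g (homology_map q (nerve W' G) h P) = homology_map q (nerve W'' E) (g \<circ> h) P"
    using fin h g P by (intro homology_map_compose[where K = "nerve W F"] finite_complex_nerve nerve_map_simplicial)
  then show ?thesis
    using nerve_homology_unique[OF fin(1,3) nerve_map_compose[OF h g] k P] by simp
qed

lemma nerve_cohomology_triangle:
  assumes fin: "finite W" "finite W'" "finite W''"
    and h: "nerve_map W F W' G h" and g: "nerve_map W' G W'' E g" and k: "nerve_map W F W'' E k"
    and P: "P \<in> carrier (simplicial_cohomology TYPE('g::ab_group_add) q (nerve W'' E))"
  shows "cohomology_map q (nerve W F) h (cohomology_map q (nerve W' G) g P) = cohomology_map q (nerve W F) k P"
proof -
  have "cohomology_map q (nerve W F) h (cohomology_map q (nerve W' G) g P) = cohomology_map q (nerve W F) (g \<circ> h) P"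
    using fin h g P by (intro cohomology_map_compose[where M = "nerve W'' E"] finite_complex_nerve nerve_map_simplicial)
  then show ?thesis
    using nerve_cohomology_unique[OF fin(1,3) nerve_map_compose[OF h g] k P] by simp
qed

text \<open>Let enlarging the sets \<open>F v\<close> to \<open>U v\<close> not change the nerve, and let the families \<open>U\<close> and \<open>G\<close> map to
  each other. These two maps induce mutually inverse isomorphisms, by uniqueness, and every map
  from \<open>F\<close> to \<open>G\<close> induces one of them.\<close>

lemma nerve_homology_bij:
  assumes fin: "finite W" "finite W'" and eq: "nerve W F = nerve W U"
    and FU: "\<And>v. v \<in> W \<Longrightarrow> F v \<subseteq> U v"
    and h: "nerve_map W U W' G h" and g: "nerve_map W' G W U g" and k: "nerve_map W F W' G k"
  shows "bij_betw (homology_map q (nerve W' G) k)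
    (carrier (simplicial_homology TYPE('g::ab_group_add) q (nerve W F)))
    (carrier (simplicial_homology TYPE('g) q (nerve W' G)))"
proof (rule bij_betw_byWitness)
  let ?A = "carrier (simplicial_homology TYPE('g) q (nerve W F))"
  let ?B = "carrier (simplicial_homology TYPE('g) q (nerve W' G))"
  have hF: "nerve_map W F W' G h"
    using h FU unfolding nerve_map_def by blast
  have id: "nerve_map W U W U (\<lambda>v. v)" "nerve_map W' G W' G (\<lambda>v. v)"
    by (auto simp: nerve_map_def)
  have kh: "homology_map q (nerve W' G) k P = homology_map q (nerve W' G) h P" if "P \<in> ?A" for P
    using nerve_homology_unique[OF fin k hF that] .
  show "\<forall>P\<in>?A. homology_map q (nerve W F) g (homology_map q (nerve W' G) k P) = P"
  proof
    fix P assume P: "P \<in> ?A"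
    have "homology_map q (nerve W U) g (homology_map q (nerve W' G) h P) = homology_map q (nerve W U) (\<lambda>v. v) P"
      using nerve_homology_triangle[OF fin fin(1) h g id(1)] P unfolding eq .
    also have "\<dots> = P"
      using homology_map_id[OF finite_complex_nerve[OF fin(1)], of U "\<lambda>v. v"] P unfolding eq by blast
    finally show "homology_map q (nerve W F) g (homology_map q (nerve W' G) k P) = P"
      using kh[OF P] eq by simp
  qed
  have gB: "homology_map q (nerve W F) g P \<in> ?A" if "P \<in> ?B" for P
    using nerve_homology_hom[OF fin(2,1) g, where 'g = 'g and q = q] that unfolding eq hom_def by blast
  then show "homology_map q (nerve W F) g ` ?B \<subseteq> ?A"
    by blast
  show "homology_map q (nerve W' G) k ` ?A \<subseteq> ?B"
    using nerve_homology_hom[OF fin k, where 'g = 'g and q = q] unfolding hom_def by blast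
  show "\<forall>P\<in>?B. homology_map q (nerve W' G) k (homology_map q (nerve W F) g P) = P"
  proof
    fix P assume P: "P \<in> ?B"
    have "homology_map q (nerve W' G) h (homology_map q (nerve W U) g P) = homology_map q (nerve W' G) (\<lambda>v. v) P"
      using nerve_homology_triangle[OF fin(2,1,2) g h id(2) P] .
    also have "\<dots> = P"
      using homology_map_id[OF finite_complex_nerve[OF fin(2)], of G "\<lambda>v. v"] P by blast
    finally show "homology_map q (nerve W' G) k (homology_map q (nerve W F) g P) = P"
      using kh[OF gB[OF P]] eq by simp
  qed
qed

lemma nerve_cohomology_bij:
  assumes fin: "finite W" "finite W'" and eq: "nerve W F = nerve W U"
    and FU: "\<And>v. v \<in> W \<Longrightarrow> F v \<subseteq> U v"
    and h: "nerve_map W U W' G h" and g: "nerve_map W' G W U g" and k: "nerve_map W F W' G k"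
  shows "bij_betw (cohomology_map q (nerve W F) k)
    (carrier (simplicial_cohomology TYPE('g::ab_group_add) q (nerve W' G)))
    (carrier (simplicial_cohomology TYPE('g) q (nerve W F)))"
proof (rule bij_betw_byWitness)
  let ?A = "carrier (simplicial_cohomology TYPE('g) q (nerve W F))"
  let ?B = "carrier (simplicial_cohomology TYPE('g) q (nerve W' G))"
  have hF: "nerve_map W F W' G h"
    using h FU unfolding nerve_map_def by blast
  have id: "nerve_map W U W U (\<lambda>v. v)" "nerve_map W' G W' G (\<lambda>v. v)"
    by (auto simp: nerve_map_def)
  have kh: "cohomology_map q (nerve W F) k P = cohomology_map q (nerve W F) h P" if "P \<in> ?B" for P
    using nerve_cohomology_unique[OF fin k hF that] .
  have gA: "cohomology_map q (nerve W' G) g P \<in> ?B" if "P \<in> ?A" for P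
    using nerve_cohomology_hom[OF fin(2,1) g, where 'g = 'g and q = q] that unfolding eq hom_def by blast
  then show "cohomology_map q (nerve W' G) g ` ?A \<subseteq> ?B"
    by blast
  show "cohomology_map q (nerve W F) k ` ?B \<subseteq> ?A"
    using nerve_cohomology_hom[OF fin k, where 'g = 'g and q = q] unfolding hom_def by blast
  show "\<forall>P\<in>?B. cohomology_map q (nerve W' G) g (cohomology_map q (nerve W F) k P) = P"
  proof
    fix P assume P: "P \<in> ?B"
    have "cohomology_map q (nerve W' G) g (cohomology_map q (nerve W U) h P) = cohomology_map q (nerve W' G) (\<lambda>v. v) P"
      using nerve_cohomology_triangle[OF fin(2,1,2) g h id(2) P] .
    also have "\<dots> = P"
      using cohomology_map_id[OF finite_complex_nerve[OF fin(2)], of G "\<lambda>v. v"] P by blast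
    finally show "cohomology_map q (nerve W' G) g (cohomology_map q (nerve W F) k P) = P"
      using kh[OF P] eq by simp
  qed
  show "\<forall>P\<in>?A. cohomology_map q (nerve W F) k (cohomology_map q (nerve W' G) g P) = P"
  proof
    fix P assume P: "P \<in> ?A"
    have "cohomology_map q (nerve W U) h (cohomology_map q (nerve W' G) g P) = cohomology_map q (nerve W U) (\<lambda>v. v) P"
      using nerve_cohomology_triangle[OF fin fin(1) h g id(1)] P unfolding eq .
    also have "\<dots> = P"
      using cohomology_map_id[OF finite_complex_nerve[OF fin(1)], of U "\<lambda>v. v"] P unfolding eq by blast
    finally show "cohomology_map q (nerve W F) k (cohomology_map q (nerve W' G) g P) = P"
      using kh[OF gA[OF P]] eq by simp
  qed
qed

section \<open>Limits of inverse and direct systems\<close>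

lemma carrier_inverse_limit:
  "x \<in> carrier (inverse_limit D R A b) \<longleftrightarrow>
     x \<in> (\<Pi>\<^sub>E i\<in>D. carrier (A i)) \<and> (\<forall>i\<in>D. \<forall>j\<in>D. R i j \<longrightarrow> b i j (x j) = x i)"
  by (simp add: inverse_limit_def)

lemma mult_inverse_limit:
  "x \<otimes>\<^bsub>inverse_limit D R A b\<^esub> y = (\<lambda>i\<in>D. x i \<otimes>\<^bsub>A i\<^esub> y i)"
  by (simp add: inverse_limit_def)

text \<open>A tower \<open>A\<close> and an inverse system \<open>B\<close> have isomorphic limits if there are compatible maps
  \<open>\<alpha> k u: A k \<rightarrow> B u\<close>, defined for the related pairs \<open>P k u\<close>, and a cofinal sequence \<open>V\<close> of indices
  of \<open>B\<close> for which the maps \<open>\<alpha> k (V k)\<close> are bijective.\<close>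

lemma inverse_limit_iso:
  fixes A :: "nat \<Rightarrow> 'a monoid" and B :: "'d \<Rightarrow> 'b monoid" and P :: "nat \<Rightarrow> 'd \<Rightarrow> bool"
  assumes hom: "\<And>k u. k \<ge> 1 \<Longrightarrow> u \<in> E \<Longrightarrow> P k u \<Longrightarrow> \<alpha> k u \<in> hom (A k) (B u)"
    and mono: "\<And>k m u. 1 \<le> k \<Longrightarrow> k \<le> m \<Longrightarrow> u \<in> E \<Longrightarrow> P k u \<Longrightarrow> P m u"
    and \<alpha>_a: "\<And>k m u y. 1 \<le> k \<Longrightarrow> k \<le> m \<Longrightarrow> u \<in> E \<Longrightarrow> P k u \<Longrightarrow> y \<in> carrier (A m) \<Longrightarrow>
        \<alpha> k u (a k m y) = \<alpha> m u y"
    and a_in: "\<And>k m y. 1 \<le> k \<Longrightarrow> k \<le> m \<Longrightarrow> y \<in> carrier (A m) \<Longrightarrow> a k m y \<in> carrier (A k)"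
    and refine: "\<And>k u u'. 1 \<le> k \<Longrightarrow> u \<in> E \<Longrightarrow> u' \<in> E \<Longrightarrow> S u u' \<Longrightarrow> P k u' \<Longrightarrow> P k u"
    and b_\<alpha>: "\<And>k u u' y. 1 \<le> k \<Longrightarrow> u \<in> E \<Longrightarrow> u' \<in> E \<Longrightarrow> S u u' \<Longrightarrow> P k u' \<Longrightarrow> y \<in> carrier (A k) \<Longrightarrow>
        b u u' (\<alpha> k u' y) = \<alpha> k u y"
    and V: "\<And>k. k \<ge> 1 \<Longrightarrow> V k \<in> E" "\<And>k. k \<ge> 1 \<Longrightarrow> P k (V k)"
        "\<And>k. k \<ge> 1 \<Longrightarrow> bij_betw (\<alpha> k (V k)) (carrier (A k)) (carrier (B (V k)))"
    and cofinal: "\<And>u. u \<in> E \<Longrightarrow> \<exists>N. \<forall>n\<ge>N. S u (V n)"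
  shows "inverse_limit {1..} (\<le>) A a \<cong> inverse_limit E S B b"
proof -
  let ?LA = "inverse_limit {1..} (\<le>) A a" and ?LB = "inverse_limit E S B b"
  \<comment> \<open>The component at \<open>u\<close> of the image of a thread does not depend on the chosen level \<open>\<kappa> u\<close>.\<close>
  define \<kappa> where "\<kappa> u = (SOME k. k \<ge> 1 \<and> P k u)" for u
  have \<kappa>: "\<kappa> u \<ge> 1" "P (\<kappa> u) u" if u: "u \<in> E" for u
  proof -
    obtain N where "\<forall>n\<ge>N. S u (V n)" using cofinal[OF u] by blast
    then have "max N 1 \<ge> 1 \<and> P (max N 1) u"
      using refine[of "max N 1" u "V (max N 1)"] u V(1,2)[of "max N 1"] by simp
    then have "\<kappa> u \<ge> 1 \<and> P (\<kappa> u) u"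
      unfolding \<kappa>_def by (rule someI)
    then show "\<kappa> u \<ge> 1" "P (\<kappa> u) u" by auto
  qed
  define \<Psi> where "\<Psi> y = (\<lambda>u\<in>E. \<alpha> (\<kappa> u) u (y (\<kappa> u)))" for y
  have LA: "y k \<in> carrier (A k)" "k \<le> m \<Longrightarrow> a k m (y m) = y k" if "y \<in> carrier ?LA" "1 \<le> k" for y k m
    using that unfolding carrier_inverse_limit by auto
  have LB: "x u \<in> carrier (B u)" "u' \<in> E \<Longrightarrow> S u u' \<Longrightarrow> b u u' (x u') = x u"
    if "x \<in> carrier ?LB" "u \<in> E" for x u u'
    using that unfolding carrier_inverse_limit by auto
  have \<Psi>: "\<alpha> k u (y k) = \<Psi> y u" if y: "y \<in> carrier ?LA" and k: "1 \<le> k" and u: "u \<in> E" "P k u" for y k u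
  proof -
    let ?m = "max k (\<kappa> u)"
    have "\<alpha> l u (y l) = \<alpha> ?m u (y ?m)" if "1 \<le> l" "l \<le> ?m" "P l u" for l
      using \<alpha>_a[OF that(1,2) u(1) that(3) LA(1)[OF y]] LA(2)[OF y that(1,2)] that by simp
    then show ?thesis
      using k u \<kappa>[OF u(1)] by (simp add: \<Psi>_def)
  qed
  have \<Psi>_in: "\<Psi> y \<in> carrier ?LB" if y: "y \<in> carrier ?LA" for y
    unfolding carrier_inverse_limit
  proof (intro conjI ballI impI)
    have "\<alpha> (\<kappa> u) u (y (\<kappa> u)) \<in> carrier (B u)" if "u \<in> E" for u
      using hom[OF \<kappa>(1)[OF that] that \<kappa>(2)[OF that]] LA(1)[OF y \<kappa>(1)[OF that]] unfolding hom_def by blast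
    then show "\<Psi> y \<in> (\<Pi>\<^sub>E u\<in>E. carrier (B u))"
      by (auto simp: \<Psi>_def)
    fix u u' assume u: "u \<in> E" "u' \<in> E" "S u u'"
    note k = \<kappa>[OF u(2)]
    have "b u u' (\<Psi> y u') = \<alpha> (\<kappa> u') u (y (\<kappa> u'))"
      using b_\<alpha>[OF k(1) u k(2) LA(1)[OF y k(1)]] u by (simp add: \<Psi>_def)
    then show "b u u' (\<Psi> y u') = \<Psi> y u"
      using \<Psi>[OF y k(1) u(1) refine[OF k(1) u k(2)]] by simp
  qed
  have "\<Psi> \<in> hom ?LA ?LB"
  proof (rule homI)
    fix y z assume yz: "y \<in> carrier ?LA" "z \<in> carrier ?LA"
    show "\<Psi> (y \<otimes>\<^bsub>?LA\<^esub> z) = \<Psi> y \<otimes>\<^bsub>?LB\<^esub> \<Psi> z"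
      unfolding mult_inverse_limit
    proof
      fix u
      show "\<Psi> (\<lambda>k\<in>{1..}. y k \<otimes>\<^bsub>A k\<^esub> z k) u = (\<lambda>u\<in>E. \<Psi> y u \<otimes>\<^bsub>B u\<^esub> \<Psi> z u) u"
      proof (cases "u \<in> E")
        case True
        then show ?thesis
          using hom_mult[OF hom[OF \<kappa>(1)[OF True] True \<kappa>(2)[OF True]]] LA(1)[OF yz(1) \<kappa>(1)[OF True]]
            LA(1)[OF yz(2) \<kappa>(1)[OF True]] \<kappa>(1)[OF True] by (simp add: \<Psi>_def)
      qed (simp add: \<Psi>_def)
    qed
  qed (rule \<Psi>_in)
  moreover have "inj_on \<Psi> (carrier ?LA)"
  proof (rule inj_onI)
    fix y z assume yz: "y \<in> carrier ?LA" "z \<in> carrier ?LA" "\<Psi> y = \<Psi> z"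
    have "y k = z k" if k: "k \<ge> 1" for k
    proof -
      have "\<alpha> k (V k) (y k) = \<alpha> k (V k) (z k)"
        using \<Psi>[OF yz(1) k V(1,2)[OF k]] \<Psi>[OF yz(2) k V(1,2)[OF k]] yz(3) by simp
      then show ?thesis
        using V(3)[OF k] LA(1)[OF yz(1) k] LA(1)[OF yz(2) k] unfolding bij_betw_def inj_on_def by blast
    qed
    then show "y = z"
      using yz(1,2) unfolding carrier_inverse_limit by (intro PiE_ext[of y "{1..}" _ z]) auto
  qed
  moreover have "x \<in> \<Psi> ` carrier ?LA" if x: "x \<in> carrier ?LB" for x
  proof -
    define y where "y = (\<lambda>k\<in>{1..}. inv_into (carrier (A k)) (\<alpha> k (V k)) (x (V k)))"
    have y: "y k \<in> carrier (A k)" "\<alpha> k (V k) (y k) = x (V k)" if k: "k \<ge> 1" for k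
    proof -
      have "x (V k) \<in> \<alpha> k (V k) ` carrier (A k)"
        using LB(1)[OF x V(1)[OF k]] V(3)[OF k] by (simp add: bij_betw_def)
      then show "y k \<in> carrier (A k)" "\<alpha> k (V k) (y k) = x (V k)"
        using k by (simp_all add: y_def inv_into_into f_inv_into_f)
    qed
    \<comment> \<open>The index \<open>m\<close> is compared with an index \<open>n\<close> for which \<open>V n\<close> is beyond both \<open>u\<close> and \<open>V m\<close>.\<close>
    have claim: "\<alpha> m u (y m) = x u" if m: "m \<ge> 1" and u: "u \<in> E" "P m u" for m u
    proof -
      obtain N N' where N: "\<forall>n\<ge>N. S u (V n)" "\<forall>n\<ge>N'. S (V m) (V n)"
        using cofinal u(1) V(1)[OF m] by meson
      define n where "n = max m (max N N')"
      have n: "1 \<le> n" "m \<le> n" "S u (V n)" "S (V m) (V n)"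
        using N m by (auto simp: n_def)
      have *: "\<alpha> n w (y n) = x w" if "w \<in> E" "S w (V n)" for w
        using b_\<alpha>[OF n(1) that(1) V(1)[OF n(1)] that(2) V(2)[OF n(1)] y(1)[OF n(1)]] y(2)[OF n(1)]
          LB(2)[OF x that(1) V(1)[OF n(1)] that(2)] by simp
      have "\<alpha> m (V m) (a m n (y n)) = \<alpha> m (V m) (y m)"
        using \<alpha>_a[OF m n(2) V(1,2)[OF m] y(1)[OF n(1)]] *[OF V(1)[OF m] n(4)] y(2)[OF m] by simp
      then have "a m n (y n) = y m"
        using V(3)[OF m] a_in[OF m n(2) y(1)[OF n(1)]] y(1)[OF m] unfolding bij_betw_def inj_on_def by blast
      then show ?thesis
        using \<alpha>_a[OF m n(2) u y(1)[OF n(1)]] *[OF u(1) n(3)] by simp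
    qed
    have "y \<in> carrier ?LA"
      unfolding carrier_inverse_limit
    proof (intro conjI ballI impI)
      show "y \<in> (\<Pi>\<^sub>E k\<in>{1..}. carrier (A k))"
        using y(1) by (auto simp: PiE_iff y_def)
      fix k m :: nat assume "k \<in> {1..}" "m \<in> {1..}" and km: "k \<le> m"
      then have k: "1 \<le> k" and m: "1 \<le> m" by auto
      have "\<alpha> k (V k) (a k m (y m)) = \<alpha> k (V k) (y k)"
        using \<alpha>_a[OF k km V(1,2)[OF k] y(1)[OF m]] y(2)[OF k]
          claim[OF m V(1)[OF k] mono[OF k km V(1,2)[OF k]]] by simp
      then show "a k m (y m) = y k"
        using V(3)[OF k] a_in[OF k km y(1)[OF m]] y(1)[OF k] unfolding bij_betw_def inj_on_def by blast
    qed
    moreover have "\<Psi> y = x"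
    proof
      fix u
      show "\<Psi> y u = x u"
      proof (cases "u \<in> E")
        case True
        then show ?thesis
          using claim[OF \<kappa>(1)[OF True] True \<kappa>(2)[OF True]] by (simp add: \<Psi>_def)
      next
        case False
        then show ?thesis
          using x PiE_arb[of x E _ u] unfolding carrier_inverse_limit by (auto simp: \<Psi>_def)
      qed
    qed
    ultimately show ?thesis by blast
  qed
  then have "\<Psi> ` carrier ?LA = carrier ?LB"
    using \<Psi>_in by blast
  ultimately have "\<Psi> \<in> iso ?LA ?LB"
    unfolding iso_def bij_betw_def by blast
  then show ?thesis
    unfolding is_iso_def by blast
qed

text \<open>If the defining relation is a congruence, the product of two classes can be computed with any
  representatives in a common group.\<close>

lemma mult_direct_limit:
  fixes A :: "'d \<Rightarrow> 'a monoid"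
  assumes eq: "equiv (SIGMA i:D. carrier (A i)) (direct_limit_rel D R A b)"
    and cong: "\<And>i j x y x' y'. ((i, x), (j, x')) \<in> direct_limit_rel D R A b \<Longrightarrow>
        ((i, y), (j, y')) \<in> direct_limit_rel D R A b \<Longrightarrow>
        ((i, x \<otimes>\<^bsub>A i\<^esub> y), (j, x' \<otimes>\<^bsub>A j\<^esub> y')) \<in> direct_limit_rel D R A b"
    and i: "i \<in> D" "x \<in> carrier (A i)" "y \<in> carrier (A i)"
  shows "direct_limit_rel D R A b `` {(i, x)} \<otimes>\<^bsub>direct_limit D R A b\<^esub> direct_limit_rel D R A b `` {(i, y)} =
    direct_limit_rel D R A b `` {(i, x \<otimes>\<^bsub>A i\<^esub> y)}"
proof -
  let ?r = "direct_limit_rel D R A b"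
  let ?M = "{(j, x' \<otimes>\<^bsub>A j\<^esub> y') | j x' y'. (j, x') \<in> ?r `` {(i, x)} \<and> (j, y') \<in> ?r `` {(i, y)}}"
  have refl: "((i, x), (i, x)) \<in> ?r" if "x \<in> carrier (A i)" for x
    using eq i(1) that unfolding equiv_def refl_on_def by blast
  have "(i, x \<otimes>\<^bsub>A i\<^esub> y) \<in> ?M"
    using refl[OF i(2)] refl[OF i(3)] by blast
  moreover have "?r `` {z} = ?r `` {(i, x \<otimes>\<^bsub>A i\<^esub> y)}" if "z \<in> ?M" for z
  proof -
    have "((i, x \<otimes>\<^bsub>A i\<^esub> y), z) \<in> ?r"
      using that cong by blast
    then show ?thesis
      using equiv_class_eq[OF eq] by blast
  qed
  ultimately have "?r `` ?M = ?r `` {(i, x \<otimes>\<^bsub>A i\<^esub> y)}"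
    by blast
  then show ?thesis
    by (simp add: direct_limit_def)
qed

text \<open>A group that receives compatible homomorphisms from a direct system is the direct limit if the
  homomorphisms identify exactly what the limit identifies and any two elements come from a common
  group of the system.\<close>

lemma direct_limit_universal:
  fixes A :: "'d \<Rightarrow> 'a monoid"
  assumes hom: "\<And>i. i \<in> D \<Longrightarrow> \<iota> i \<in> hom (A i) T"
    and closed: "\<And>i x y. i \<in> D \<Longrightarrow> x \<in> carrier (A i) \<Longrightarrow> y \<in> carrier (A i) \<Longrightarrow> x \<otimes>\<^bsub>A i\<^esub> y \<in> carrier (A i)"
    and rel: "\<And>i j x y. i \<in> D \<Longrightarrow> j \<in> D \<Longrightarrow> x \<in> carrier (A i) \<Longrightarrow> y \<in> carrier (A j) \<Longrightarrow>
        ((i, x), (j, y)) \<in> direct_limit_rel D R A b \<longleftrightarrow> \<iota> i x = \<iota> j y"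
    and surj: "\<And>s t. s \<in> carrier T \<Longrightarrow> t \<in> carrier T \<Longrightarrow>
        \<exists>i\<in>D. \<exists>x\<in>carrier (A i). \<exists>y\<in>carrier (A i). \<iota> i x = s \<and> \<iota> i y = t"
  shows "T \<cong> direct_limit D R A b"
proof -
  let ?r = "direct_limit_rel D R A b" and ?S = "SIGMA i:D. carrier (A i)"
  \<comment> \<open>The fibres of the maps \<open>\<iota> i\<close> are the classes of the limit.\<close>
  define \<Theta> where "\<Theta> t = {(i, x). i \<in> D \<and> x \<in> carrier (A i) \<and> \<iota> i x = t}" for t
  have r: "((i, x), (j, y)) \<in> ?r \<longleftrightarrow>
      i \<in> D \<and> x \<in> carrier (A i) \<and> j \<in> D \<and> y \<in> carrier (A j) \<and> \<iota> i x = \<iota> j y" for i j x y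
  proof (cases "i \<in> D \<and> x \<in> carrier (A i) \<and> j \<in> D \<and> y \<in> carrier (A j)")
    case False
    then show ?thesis by (auto simp: direct_limit_rel_def)
  qed (use rel in blast)
  have eq: "equiv ?S ?r"
    by (rule equivI) (auto simp: refl_on_def sym_def trans_def r)
  have cong: "((i, x \<otimes>\<^bsub>A i\<^esub> y), (j, x' \<otimes>\<^bsub>A j\<^esub> y')) \<in> ?r"
    if "((i, x), (j, x')) \<in> ?r" "((i, y), (j, y')) \<in> ?r" for i j x y x' y'
    using that closed hom_mult[OF hom] unfolding r by metis
  have \<Theta>: "\<Theta> (\<iota> i x) = ?r `` {(i, x)}" if "i \<in> D" "x \<in> carrier (A i)" for i x
    using that by (auto simp: \<Theta>_def r)
  have carrier: "carrier (direct_limit D R A b) = ?S // ?r"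
    by (simp add: direct_limit_def)
  have "\<Theta> \<in> hom T (direct_limit D R A b)"
  proof (rule homI)
    fix t assume "t \<in> carrier T"
    then obtain i x where "i \<in> D" "x \<in> carrier (A i)" "\<iota> i x = t"
      using surj by blast
    then show "\<Theta> t \<in> carrier (direct_limit D R A b)"
      using \<Theta>[of i x] unfolding carrier by (auto intro: quotientI)
  next
    fix s t assume "s \<in> carrier T" "t \<in> carrier T"
    then obtain i x y where i: "i \<in> D" "x \<in> carrier (A i)" "y \<in> carrier (A i)" "\<iota> i x = s" "\<iota> i y = t"
      using surj by blast
    then have "s \<otimes>\<^bsub>T\<^esub> t = \<iota> i (x \<otimes>\<^bsub>A i\<^esub> y)"
      using hom_mult[OF hom] by metis
    then have "\<Theta> (s \<otimes>\<^bsub>T\<^esub> t) = ?r `` {(i, x \<otimes>\<^bsub>A i\<^esub> y)}"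
      by (simp only: \<Theta>[OF i(1) closed[OF i(1-3)]])
    also have "\<dots> = ?r `` {(i, x)} \<otimes>\<^bsub>direct_limit D R A b\<^esub> ?r `` {(i, y)}"
      by (rule mult_direct_limit[OF eq cong i(1-3), symmetric])
    also have "\<dots> = \<Theta> s \<otimes>\<^bsub>direct_limit D R A b\<^esub> \<Theta> t"
      by (simp only: \<Theta>[OF i(1,2), symmetric] \<Theta>[OF i(1,3), symmetric] i(4,5))
    finally show "\<Theta> (s \<otimes>\<^bsub>T\<^esub> t) = \<Theta> s \<otimes>\<^bsub>direct_limit D R A b\<^esub> \<Theta> t" .
  qed
  moreover have "inj_on \<Theta> (carrier T)"
  proof (rule inj_onI)
    fix s t assume st: "s \<in> carrier T" "t \<in> carrier T" "\<Theta> s = \<Theta> t"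
    then obtain i x where "i \<in> D" "x \<in> carrier (A i)" "\<iota> i x = s"
      using surj by blast
    then have "(i, x) \<in> \<Theta> t"
      unfolding st(3)[symmetric] by (simp add: \<Theta>_def)
    then show "s = t"
      using \<open>\<iota> i x = s\<close> by (simp add: \<Theta>_def)
  qed
  moreover have "\<Theta> ` carrier T = carrier (direct_limit D R A b)"
  proof
    show "\<Theta> ` carrier T \<subseteq> carrier (direct_limit D R A b)"
      using \<open>\<Theta> \<in> hom T (direct_limit D R A b)\<close> unfolding hom_def by blast
    show "carrier (direct_limit D R A b) \<subseteq> \<Theta> ` carrier T"
    proof
      fix Q assume "Q \<in> carrier (direct_limit D R A b)"
      then obtain i x where "i \<in> D" "x \<in> carrier (A i)" "Q = ?r `` {(i, x)}"
        unfolding carrier by (auto elim!: quotientE)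
      then show "Q \<in> \<Theta> ` carrier T"
        using \<Theta>[of i x] hom[of i] unfolding hom_def by blast
    qed
  qed
  ultimately have "\<Theta> \<in> iso T (direct_limit D R A b)"
    unfolding iso_def bij_betw_def by blast
  then show ?thesis
    unfolding is_iso_def by blast
qed

text \<open>The direct limits of a sequence \<open>A\<close> and of a direct system \<open>B\<close> agree under the conditions dual to
  those for inverse limits.\<close>

lemma direct_limit_iso:
  fixes A :: "nat \<Rightarrow> 'a monoid" and B :: "'d \<Rightarrow> 'b monoid" and P :: "nat \<Rightarrow> 'd \<Rightarrow> bool"
  assumes hom: "\<And>k u. k \<ge> 1 \<Longrightarrow> u \<in> E \<Longrightarrow> P k u \<Longrightarrow> \<alpha> k u \<in> hom (B u) (A k)"
    and closed: "\<And>k x y. k \<ge> 1 \<Longrightarrow> x \<in> carrier (A k) \<Longrightarrow> y \<in> carrier (A k) \<Longrightarrow> x \<otimes>\<^bsub>A k\<^esub> y \<in> carrier (A k)"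
      "\<And>u x y. u \<in> E \<Longrightarrow> x \<in> carrier (B u) \<Longrightarrow> y \<in> carrier (B u) \<Longrightarrow> x \<otimes>\<^bsub>B u\<^esub> y \<in> carrier (B u)"
    and a_hom: "\<And>k m. 1 \<le> k \<Longrightarrow> k \<le> m \<Longrightarrow> a k m \<in> hom (A k) (A m)"
    and a_comp: "\<And>k m n x. 1 \<le> k \<Longrightarrow> k \<le> m \<Longrightarrow> m \<le> n \<Longrightarrow> x \<in> carrier (A k) \<Longrightarrow> a m n (a k m x) = a k n x"
    and mono: "\<And>k m u. 1 \<le> k \<Longrightarrow> k \<le> m \<Longrightarrow> u \<in> E \<Longrightarrow> P k u \<Longrightarrow> P m u"
    and a_\<alpha>: "\<And>k m u x. 1 \<le> k \<Longrightarrow> k \<le> m \<Longrightarrow> u \<in> E \<Longrightarrow> P k u \<Longrightarrow> x \<in> carrier (B u) \<Longrightarrow>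
        a k m (\<alpha> k u x) = \<alpha> m u x"
    and refine: "\<And>k u u'. 1 \<le> k \<Longrightarrow> u \<in> E \<Longrightarrow> u' \<in> E \<Longrightarrow> S u u' \<Longrightarrow> P k u' \<Longrightarrow> P k u"
    and b_in: "\<And>u u' x. u \<in> E \<Longrightarrow> u' \<in> E \<Longrightarrow> S u u' \<Longrightarrow> x \<in> carrier (B u) \<Longrightarrow> b u u' x \<in> carrier (B u')"
    and \<alpha>_b: "\<And>k u u' x. 1 \<le> k \<Longrightarrow> u \<in> E \<Longrightarrow> u' \<in> E \<Longrightarrow> S u u' \<Longrightarrow> P k u' \<Longrightarrow> x \<in> carrier (B u) \<Longrightarrow>
        \<alpha> k u' (b u u' x) = \<alpha> k u x"
    and V: "\<And>k. k \<ge> 1 \<Longrightarrow> V k \<in> E" "\<And>k. k \<ge> 1 \<Longrightarrow> P k (V k)"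
        "\<And>k. k \<ge> 1 \<Longrightarrow> bij_betw (\<alpha> k (V k)) (carrier (B (V k))) (carrier (A k))"
    and cofinal: "\<And>u. u \<in> E \<Longrightarrow> \<exists>N. \<forall>n\<ge>N. S u (V n)"
  shows "direct_limit {1..} (\<le>) A a \<cong> direct_limit E S B b"
proof -
  let ?r = "direct_limit_rel {1..} (\<le>) A a" and ?T = "direct_limit {1..} (\<le>) A a"
  have \<kappa>: "\<exists>k\<ge>1. P k u" if u: "u \<in> E" for u
  proof -
    obtain N where "\<forall>n\<ge>N. S u (V n)" using cofinal[OF u] by blast
    then have "P (max N 1) u"
      using refine[of "max N 1" u "V (max N 1)"] u V(1,2)[of "max N 1"] by simp
    then show ?thesis by (meson max.cobounded2)
  qed
  have a_in: "a k m x \<in> carrier (A m)" if "1 \<le> k" "k \<le> m" "x \<in> carrier (A k)" for k m x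
    using a_hom[OF that(1,2)] that(3) unfolding hom_def by blast
  have \<alpha>_in: "\<alpha> k u x \<in> carrier (A k)" if "1 \<le> k" "u \<in> E" "P k u" "x \<in> carrier (B u)" for k u x
    using hom[OF that(1-3)] that(4) unfolding hom_def by blast
  have r: "((k, x), (l, y)) \<in> ?r \<longleftrightarrow> 1 \<le> k \<and> x \<in> carrier (A k) \<and> 1 \<le> l \<and> y \<in> carrier (A l) \<and>
      (\<exists>m. k \<le> m \<and> l \<le> m \<and> a k m x = a l m y)" for k l x y
    by (auto simp: direct_limit_rel_def)
  have later: "a k n x = a l n y"
    if "1 \<le> k" "x \<in> carrier (A k)" "1 \<le> l" "y \<in> carrier (A l)" "k \<le> m" "l \<le> m" "a k m x = a l m y" "m \<le> n"
    for k l m n x y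
    using that a_comp by metis
  have eq: "equiv (SIGMA k:{1..}. carrier (A k)) ?r"
  proof (rule equivI)
    show "refl_on (SIGMA k:{1..}. carrier (A k)) ?r"
      by (auto simp: refl_on_def r simp del: One_nat_def)
    show "sym ?r"
      unfolding sym_def by (auto simp: r simp del: One_nat_def)
    show "trans ?r"
    proof (rule transI, clarify)
      fix k x l y m z
      assume 1: "((k, x), (l, y)) \<in> ?r" and 2: "((l, y), (m, z)) \<in> ?r"
      obtain n where n: "k \<le> n" "l \<le> n" "a k n x = a l n y" using 1 unfolding r by blast
      obtain n' where n': "l \<le> n'" "m \<le> n'" "a l n' y = a m n' z" using 2 unfolding r by blast
      have "a k (max n n') x = a l (max n n') y" "a l (max n n') y = a m (max n n') z"
        using 1 2 n n' unfolding r by (auto intro: later)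
      then show "((k, x), (m, z)) \<in> ?r"
        using 1 2 n n' unfolding r by (metis max.coboundedI1 max.coboundedI2)
    qed
  qed (auto simp: direct_limit_rel_def)
  have cong: "((k, x \<otimes>\<^bsub>A k\<^esub> y), (l, x' \<otimes>\<^bsub>A l\<^esub> y')) \<in> ?r"
    if xx: "((k, x), (l, x')) \<in> ?r" and yy: "((k, y), (l, y')) \<in> ?r" for k l x y x' y'
  proof -
    obtain n where n: "k \<le> n" "l \<le> n" "a k n x = a l n x'" using xx unfolding r by blast
    obtain n' where n': "k \<le> n'" "l \<le> n'" "a k n' y = a l n' y'" using yy unfolding r by blast
    have "a k (max n n') x = a l (max n n') x'" "a k (max n n') y = a l (max n n') y'"
      using xx yy n n' unfolding r by (auto intro: later)
    moreover have "a j (max n n') (z \<otimes>\<^bsub>A j\<^esub> z') = a j (max n n') z \<otimes>\<^bsub>A (max n n')\<^esub> a j (max n n') z'"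
      if "1 \<le> j" "j \<le> max n n'" "z \<in> carrier (A j)" "z' \<in> carrier (A j)" for j z z'
      using hom_mult[OF a_hom[OF that(1,2)] that(3,4)] .
    ultimately have "a k (max n n') (x \<otimes>\<^bsub>A k\<^esub> y) = a l (max n n') (x' \<otimes>\<^bsub>A l\<^esub> y')"
      using xx yy n n' unfolding r by (metis max.coboundedI1)
    then show ?thesis
      using xx yy n closed(1) unfolding r by (metis max.coboundedI1)
  qed
  let ?cl = "\<lambda>k x. ?r `` {(k, x)}"
  have cl_iff: "?cl k x = ?cl l y \<longleftrightarrow> ((k, x), (l, y)) \<in> ?r"
    if "1 \<le> k" "x \<in> carrier (A k)" "1 \<le> l" "y \<in> carrier (A l)" for k l x y
    using eq_equiv_class_iff[OF eq] that by simp
  have cl_a: "?cl m (a k m x) = ?cl k x" if "1 \<le> k" "k \<le> m" "x \<in> carrier (A k)" for k m x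
  proof -
    have "a m m (a k m x) = a k m x"
      using a_comp[OF that(1,2) order_refl that(3)] .
    then have "((m, a k m x), (k, x)) \<in> ?r"
      using that a_in[OF that] unfolding r by auto
    then show ?thesis
      using cl_iff that a_in[OF that] by simp
  qed
  define \<kappa> where "\<kappa> u = (SOME k. 1 \<le> k \<and> P k u)" for u
  have \<kappa>: "1 \<le> \<kappa> u" "P (\<kappa> u) u" if "u \<in> E" for u
    using someI_ex[of "\<lambda>k. 1 \<le> k \<and> P k u"] \<kappa>[OF that] unfolding \<kappa>_def by blast+
  \<comment> \<open>The groups \<open>B u\<close> map to the limit of \<open>A\<close>, which is then recognized as the limit of \<open>B\<close>.\<close>
  define \<iota> where "\<iota> u x = ?cl (\<kappa> u) (\<alpha> (\<kappa> u) u x)" for u x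
  have \<iota>: "?cl k (\<alpha> k u x) = \<iota> u x" if k: "1 \<le> k" "u \<in> E" "P k u" "x \<in> carrier (B u)" for k u x
  proof -
    let ?m = "max k (\<kappa> u)"
    have "?cl l (\<alpha> l u x) = ?cl ?m (\<alpha> ?m u x)" if "1 \<le> l" "P l u" "l \<le> ?m" for l
      using a_\<alpha>[OF that(1,3) k(2) that(2) k(4)] cl_a[OF that(1,3) \<alpha>_in[OF that(1) k(2) that(2) k(4)]] by simp
    then show ?thesis
      using k \<kappa>[OF k(2)] by (simp add: \<iota>_def)
  qed
  have carrier: "carrier ?T = (SIGMA k:{1..}. carrier (A k)) // ?r"
    by (simp add: direct_limit_def)
  show ?thesis
  proof (rule direct_limit_universal[where \<iota> = \<iota>])
    fix u assume u: "u \<in> E"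
    show "\<iota> u \<in> hom (B u) ?T"
    proof (rule homI)
      fix x y assume xy: "x \<in> carrier (B u)" "y \<in> carrier (B u)"
      show "\<iota> u (x \<otimes>\<^bsub>B u\<^esub> y) = \<iota> u x \<otimes>\<^bsub>?T\<^esub> \<iota> u y"
        unfolding \<iota>_def hom_mult[OF hom[OF \<kappa>(1)[OF u] u \<kappa>(2)[OF u]] xy]
        by (rule mult_direct_limit[OF eq cong, symmetric])
          (use \<kappa>[OF u] \<alpha>_in[OF \<kappa>(1)[OF u] u \<kappa>(2)[OF u]] xy in auto)
    next
      fix x assume "x \<in> carrier (B u)"
      then show "\<iota> u x \<in> carrier ?T"
        unfolding carrier \<iota>_def using \<kappa>[OF u] \<alpha>_in[OF \<kappa>(1)[OF u] u \<kappa>(2)[OF u]] by (intro quotientI) auto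
    qed
  next
    fix u v x y assume uv: "u \<in> E" "v \<in> E" and x: "x \<in> carrier (B u)" and y: "y \<in> carrier (B v)"
    show "((u, x), (v, y)) \<in> direct_limit_rel E S B b \<longleftrightarrow> \<iota> u x = \<iota> v y"
    proof
      assume "((u, x), (v, y)) \<in> direct_limit_rel E S B b"
      then obtain w where w: "w \<in> E" "S u w" "S v w" "b u w x = b v w y"
        by (auto simp: direct_limit_rel_def)
      note k = \<kappa>[OF w(1)]
      have "\<alpha> (\<kappa> w) u x = \<alpha> (\<kappa> w) v y"
        using \<alpha>_b[OF k(1) uv(1) w(1,2) k(2) x] \<alpha>_b[OF k(1) uv(2) w(1,3) k(2) y] w(4) by simp
      then show "\<iota> u x = \<iota> v y"
        using \<iota>[OF k(1) uv(1) refine[OF k(1) uv(1) w(1,2) k(2)] x]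
          \<iota>[OF k(1) uv(2) refine[OF k(1) uv(2) w(1,3) k(2)] y] by simp
    next
      assume "\<iota> u x = \<iota> v y"
      then have "((\<kappa> u, \<alpha> (\<kappa> u) u x), (\<kappa> v, \<alpha> (\<kappa> v) v y)) \<in> ?r"
        unfolding \<iota>_def using cl_iff \<kappa> uv \<alpha>_in x y by blast
      then obtain m where m: "\<kappa> u \<le> m" "\<kappa> v \<le> m" "a (\<kappa> u) m (\<alpha> (\<kappa> u) u x) = a (\<kappa> v) m (\<alpha> (\<kappa> v) v y)"
        unfolding r by blast
      obtain N N' where N: "\<forall>n\<ge>N. S u (V n)" "\<forall>n\<ge>N'. S v (V n)"
        using cofinal uv by meson
      define n where "n = max m (max N N')"
      have n: "1 \<le> n" "m \<le> n" "S u (V n)" "S v (V n)"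
        using N m \<kappa>(1)[OF uv(1)] by (auto simp: n_def)
      have "a (\<kappa> u) n (\<alpha> (\<kappa> u) u x) = a (\<kappa> v) n (\<alpha> (\<kappa> v) v y)"
        by (rule later[OF _ _ _ _ m n(2)]) (use \<kappa> uv \<alpha>_in x y in auto)
      then have "\<alpha> n u x = \<alpha> n v y"
        using a_\<alpha>[OF \<kappa>(1)[OF uv(1)] _ uv(1) \<kappa>(2)[OF uv(1)] x, of n]
          a_\<alpha>[OF \<kappa>(1)[OF uv(2)] _ uv(2) \<kappa>(2)[OF uv(2)] y, of n] m n(2) by simp
      then have "\<alpha> n (V n) (b u (V n) x) = \<alpha> n (V n) (b v (V n) y)"
        using \<alpha>_b[OF n(1) uv(1) V(1)[OF n(1)] n(3) V(2)[OF n(1)] x]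
          \<alpha>_b[OF n(1) uv(2) V(1)[OF n(1)] n(4) V(2)[OF n(1)] y] by simp
      then have "b u (V n) x = b v (V n) y"
        using V(3)[OF n(1)] b_in[OF uv(1) V(1)[OF n(1)] n(3) x] b_in[OF uv(2) V(1)[OF n(1)] n(4) y]
        unfolding bij_betw_def inj_on_def by blast
      then show "((u, x), (v, y)) \<in> direct_limit_rel E S B b"
        using uv x y V(1)[OF n(1)] n(3,4) by (auto simp: direct_limit_rel_def)
    qed
  next
    fix s t assume "s \<in> carrier ?T" "t \<in> carrier ?T"
    then obtain k x l y where s: "1 \<le> k" "x \<in> carrier (A k)" "s = ?cl k x"
        and t: "1 \<le> l" "y \<in> carrier (A l)" "t = ?cl l y"
      unfolding carrier by (auto elim!: quotientE)
    let ?m = "max k l"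
    have m: "1 \<le> ?m" using s by simp
    have im: "a k ?m x \<in> \<alpha> ?m (V ?m) ` carrier (B (V ?m))" "a l ?m y \<in> \<alpha> ?m (V ?m) ` carrier (B (V ?m))"
      using V(3)[OF m] a_in[OF s(1) _ s(2), of ?m] a_in[OF t(1) _ t(2), of ?m] unfolding bij_betw_def by auto
    obtain x' where x': "a k ?m x = \<alpha> ?m (V ?m) x'" "x' \<in> carrier (B (V ?m))"
      using im(1) by (rule imageE)
    obtain y' where y': "a l ?m y = \<alpha> ?m (V ?m) y'" "y' \<in> carrier (B (V ?m))"
      using im(2) by (rule imageE)
    have "\<iota> (V ?m) x' = s" "\<iota> (V ?m) y' = t"
      using \<iota>[OF m V(1,2)[OF m] x'(2)] x'(1) cl_a[OF s(1) _ s(2), of ?m] s(3)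
        \<iota>[OF m V(1,2)[OF m] y'(2)] y'(1) cl_a[OF t(1) _ t(2), of ?m] t(3) by simp_all
    then show "\<exists>u\<in>E. \<exists>x\<in>carrier (B u). \<exists>y\<in>carrier (B u). \<iota> u x = s \<and> \<iota> u y = t"
      using V(1)[OF m] x'(2) y'(2) by blast
  qed (rule closed(2))
qed

section \<open>Cylinders of a non-autonomous iterated function system\<close>

lemma listset_snoc: "listset (As @ [A]) = {v @ [a] | v a. v \<in> listset As \<and> a \<in> A}"
proof (induction As)
  case (Cons B As)
  show ?case
  proof (rule equalityI; rule subsetI)
    fix w assume "w \<in> listset ((B # As) @ [A])"
    then obtain b v a where "b \<in> B" "v \<in> listset As" "a \<in> A" "w = (b # v) @ [a]"
      by (auto simp: Cons.IH set_Cons_def)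
    then show "w \<in> {v @ [a] | v a. v \<in> listset (B # As) \<and> a \<in> A}"
      unfolding listset.simps set_Cons_def by blast
  next
    fix w assume "w \<in> {v @ [a] | v a. v \<in> listset (B # As) \<and> a \<in> A}"
    then show "w \<in> listset ((B # As) @ [A])"
      by (auto simp: Cons.IH set_Cons_def)
  qed
qed (auto simp: set_Cons_def)

lemma words_0 [simp]: "words I 0 0 = {[]}"
  by (simp add: words_def)

lemma words_Suc: "words I 0 (Suc k) = {v @ [i] | v i. v \<in> words I 0 k \<and> i \<in> I (Suc k)}"
  by (simp add: words_def listset_snoc)

lemma length_words: "v \<in> words I 0 k \<Longrightarrow> length v = k"
  by (induction k arbitrary: v) (auto simp: words_Suc)

lemma prefix_in_words:
  "(\<And>j. j \<ge> 1 \<Longrightarrow> \<omega> j \<in> I j) \<Longrightarrow> map \<omega> [1..<Suc k] \<in> words I 0 k"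
  by (induction k) (auto simp: words_Suc)

lemma word_map_snoc: "word_map f j (v @ [i]) = word_map f j v \<circ> f (Suc (j + length v)) i"
  by (induction v arbitrary: j) (auto simp: comp_assoc)

lemma word_map_shift: "word_map (\<lambda>k. f (j + k)) m v = word_map f (j + m) v"
  by (induction v arbitrary: m) auto

lemma closure_finite_UN: "finite A \<Longrightarrow> closure (\<Union>a\<in>A. S a) = (\<Union>a\<in>A. closure (S a))"
  by (induction A rule: finite_induct) auto

context nonautonomous_ifs
begin

lemma shift: "nonautonomous_ifs X (\<lambda>k. I (j + k)) (\<lambda>k. f (j + k))"
proof -
  obtain c where "c < 1" "\<forall>j\<ge>1. \<forall>i\<in>I j. c-lipschitz_on X (f j i)"
    using uniformly_contracting by blast
  then have "\<exists>c<1. \<forall>k\<ge>1. \<forall>i\<in>I (j + k). c-lipschitz_on X (f (j + k) i)"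
    by (intro exI[of _ c]) auto
  then show ?thesis
    using compact_space nonempty_space finite_index nonempty_index maps_into by unfold_locales auto
qed

lemma finite_words: "finite (words I 0 k)"
proof (induction k)
  case (Suc k)
  have "words I 0 (Suc k) = (\<lambda>(v, i). v @ [i]) ` (words I 0 k \<times> I (Suc k))"
    by (auto simp: words_Suc)
  then show ?case
    using Suc finite_index by simp
qed simp

lemma word_map_into: "v \<in> words I 0 k \<Longrightarrow> word_map f 0 v ` X \<subseteq> X"
proof (induction k arbitrary: v)
  case (Suc k)
  then obtain u i where v: "v = u @ [i]" "u \<in> words I 0 k" "i \<in> I (Suc k)"
    by (auto simp: words_Suc)
  have "word_map f 0 v ` X = word_map f 0 u ` f (Suc k) i ` X"
    using length_words[OF v(2)] v(1) by (simp add: word_map_snoc image_comp)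
  also have "\<dots> \<subseteq> X"
    using Suc.IH[OF v(2)] maps_into[of "Suc k" i] v(3) by auto
  finally show ?case .
qed simp

lemma word_map_lipschitz:
  "\<exists>c. 0 \<le> c \<and> c < 1 \<and> (\<forall>k. \<forall>v\<in>words I 0 k. (c ^ k)-lipschitz_on X (word_map f 0 v))"
proof -
  obtain c where c: "c < 1" "\<And>j i. j \<ge> 1 \<Longrightarrow> i \<in> I j \<Longrightarrow> c-lipschitz_on X (f j i)"
    using uniformly_contracting by blast
  have "0 \<le> c"
    using c(2)[of 1] nonempty_index[of 1] lipschitz_on_nonneg by blast
  have "(c ^ k)-lipschitz_on X (word_map f 0 v)" if "v \<in> words I 0 k" for k v
    using that
  proof (induction k arbitrary: v)
    case 0
    then show ?case by (simp add: lipschitz_on_def)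
  next
    case (Suc k)
    then obtain u i where v: "v = u @ [i]" "u \<in> words I 0 k" "i \<in> I (Suc k)"
      by (auto simp: words_Suc)
    have "(c ^ k)-lipschitz_on (f (Suc k) i ` X) (word_map f 0 u)"
      using Suc.IH[OF v(2)] maps_into[of "Suc k" i] v(3) by (auto intro: lipschitz_on_subset)
    then have "(c ^ k * c)-lipschitz_on X (word_map f 0 u \<circ> f (Suc k) i)"
      using c(2)[of "Suc k" i] v(3) by (intro lipschitz_on_compose) auto
    then show ?case
      using length_words[OF v(2)] v(1) by (simp add: word_map_snoc mult.commute)
  qed
  then show ?thesis
    using \<open>0 \<le> c\<close> c(1) by blast
qed

text \<open>The images of the space under the words of length \<open>k\<close> have uniformly small diameter.\<close>

lemma word_map_small:
  assumes "e > 0"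
  shows "\<exists>N. \<forall>k\<ge>N. \<forall>v\<in>words I 0 k. \<forall>x\<in>word_map f 0 v ` X. \<forall>y\<in>word_map f 0 v ` X. dist x y < e"
proof -
  obtain c where c: "0 \<le> c" "c < 1" "\<forall>k. \<forall>v\<in>words I 0 k. (c ^ k)-lipschitz_on X (word_map f 0 v)"
    using word_map_lipschitz by blast
  have d: "dist x y \<le> diameter X" if "x \<in> X" "y \<in> X" for x y
    using diameter_bounded_bound[OF compact_imp_bounded[OF compact_space] that] .
  have "(\<lambda>k. c ^ k * diameter X) \<longlonglongrightarrow> 0 * diameter X"
    using c by (intro tendsto_intros LIMSEQ_power_zero) auto
  then have "eventually (\<lambda>k. c ^ k * diameter X < e) sequentially"
    using assms by (auto intro: order_tendstoD)
  then obtain N where N: "\<And>k. k \<ge> N \<Longrightarrow> c ^ k * diameter X < e"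
    unfolding eventually_sequentially by blast
  have "dist (word_map f 0 v x) (word_map f 0 v y) < e"
    if "k \<ge> N" "v \<in> words I 0 k" "x \<in> X" "y \<in> X" for k v x y
  proof -
    have "dist (word_map f 0 v x) (word_map f 0 v y) \<le> c ^ k * dist x y"
      using lipschitz_onD[OF c(3)[rule_format, OF that(2)] that(3,4)] .
    also have "\<dots> \<le> c ^ k * diameter X"
      using d[OF that(3,4)] c(1) by (intro mult_left_mono) auto
    finally show ?thesis
      using N[OF that(1)] by linarith
  qed
  then show ?thesis by blast
qed

lemma compact_word_map_image:
  assumes "v \<in> words I 0 k" "compact S" "S \<subseteq> X"
  shows "compact (word_map f 0 v ` S)"
proof -
  obtain c where "(c ^ k)-lipschitz_on X (word_map f 0 v)"
    using word_map_lipschitz assms(1) by blast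
  then have "continuous_on S (word_map f 0 v)"
    using lipschitz_on_continuous_on continuous_on_subset assms(3) by blast
  then show ?thesis
    using assms(2) by (rule compact_continuous_image)
qed

lemma coding_map_eqI:
  assumes \<omega>: "\<And>j. j \<ge> 1 \<Longrightarrow> \<omega> j \<in> I j" and x: "\<And>k. x \<in> word_map f 0 (map \<omega> [1..<Suc k]) ` X"
  shows "coding_map X f \<omega> = x"
proof -
  let ?A = "\<lambda>k. word_map f 0 (map \<omega> [1..<Suc k]) ` X"
  have "y = x" if y: "\<And>k. k \<ge> 1 \<Longrightarrow> y \<in> ?A k" for y
  proof (rule ccontr)
    assume "y \<noteq> x"
    then have "0 < dist x y" by simp
    from word_map_small[OF this]
    obtain N where N: "\<forall>k\<ge>N. \<forall>v\<in>words I 0 k. \<forall>x'\<in>word_map f 0 v ` X. \<forall>y'\<in>word_map f 0 v ` X.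
        dist x' y' < dist x y" ..
    let ?k = "max N 1"
    have "map \<omega> [1..<Suc ?k] \<in> words I 0 ?k"
      using prefix_in_words \<omega> by blast
    moreover have "y \<in> ?A ?k"
      by (rule y) simp
    ultimately have "dist x y < dist x y"
      using N x[of ?k] max.cobounded1[of N 1] by blast
    then show False by simp
  qed
  then have "(\<Inter>k\<in>{1..}. ?A k) = {x}"
    using x by blast
  then show ?thesis
    by (simp add: coding_map_def)
qed

lemma coding_map_in:
  assumes \<omega>: "\<And>j. j \<ge> 1 \<Longrightarrow> \<omega> j \<in> I j"
  shows "coding_map X f \<omega> \<in> word_map f 0 (map \<omega> [1..<Suc k]) ` X"
proof -
  let ?A = "\<lambda>k. word_map f 0 (map \<omega> [1..<Suc k]) ` X"
  have w: "map \<omega> [1..<Suc k] \<in> words I 0 k" for k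
    using prefix_in_words \<omega> by blast
  have step: "?A (Suc k) \<subseteq> ?A k" for k
  proof -
    have "map \<omega> [1..<Suc (Suc k)] = map \<omega> [1..<Suc k] @ [\<omega> (Suc k)]"
      by simp
    then have "?A (Suc k) = word_map f 0 (map \<omega> [1..<Suc k]) ` f (Suc k) (\<omega> (Suc k)) ` X"
      by (simp add: word_map_snoc image_comp del: upt_Suc)
    then show ?thesis
      using maps_into[of "Suc k" "\<omega> (Suc k)"] \<omega>[of "Suc k"] by (simp add: image_mono del: upt_Suc)
  qed
  have mono: "?A n \<subseteq> ?A m" if "m \<le> n" for m n
    using lift_Suc_antimono_le[of ?A, OF step that] .
  have "X \<inter> (\<Inter>k\<in>UNIV. ?A k) \<noteq> {}"
  proof (rule compact_imp_fip_image[OF compact_space])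
    show "closed (?A k)" for k
      using compact_word_map_image[OF w compact_space subset_refl] by (rule compact_imp_closed)
    fix T :: "nat set" assume T: "finite T"
    let ?n = "Max (insert 0 T)"
    have "?A ?n \<subseteq> ?A k" if "k \<in> T" for k
      using T that by (intro mono Max_ge) auto
    then have "?A ?n \<subseteq> X \<inter> (\<Inter>k\<in>T. ?A k)"
      using word_map_into[OF w, of ?n] by blast
    moreover have "?A ?n \<noteq> {}"
      using nonempty_space by blast
    ultimately show "X \<inter> (\<Inter>k\<in>T. ?A k) \<noteq> {}"
      by blast
  qed
  then obtain x where x: "\<And>k. x \<in> ?A k" by blast
  then show ?thesis
    using coding_map_eqI[of \<omega> x] \<omega> by simp
qed

lemma limit_set_iff:
  "x \<in> limit_set X I f \<longleftrightarrow> (\<exists>\<omega>. (\<forall>j\<ge>1. \<omega> j \<in> I j) \<and> x = coding_map X f \<omega>)"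
proof
  assume "x \<in> limit_set X I f"
  then show "\<exists>\<omega>. (\<forall>j\<ge>1. \<omega> j \<in> I j) \<and> x = coding_map X f \<omega>"
    unfolding limit_set_def by fastforce
next
  assume "\<exists>\<omega>. (\<forall>j\<ge>1. \<omega> j \<in> I j) \<and> x = coding_map X f \<omega>"
  then obtain \<omega> where \<omega>: "\<forall>j\<ge>1. \<omega> j \<in> I j" "x = coding_map X f \<omega>" by blast
  have *: "map (restrict \<omega> {1..}) [1..<Suc k] = map \<omega> [1..<Suc k]" for k
    by (rule map_cong) auto
  have "coding_map X f (restrict \<omega> {1..}) = x"
    unfolding \<omega>(2) coding_map_def * ..
  moreover have "restrict \<omega> {1..} \<in> (\<Pi>\<^sub>E j\<in>{1..}. I j)"
    using \<omega>(1) by auto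
  ultimately show "x \<in> limit_set X I f"
    unfolding limit_set_def by blast
qed

lemma limit_set_subset: "limit_set X I f \<subseteq> X"
  using coding_map_in[of _ 0] by (auto simp: limit_set_iff)

lemma limit_set_nonempty: "limit_set X I f \<noteq> {}"
proof -
  have "\<forall>j\<ge>1. (SOME i. i \<in> I j) \<in> I j"
    using nonempty_index some_in_eq by blast
  then have "coding_map X f (\<lambda>j. SOME i. i \<in> I j) \<in> limit_set X I f"
    unfolding limit_set_iff by (intro exI[of _ "\<lambda>j. SOME i. i \<in> I j"]) blast
  then show ?thesis by blast
qed

text \<open>The first letter of a sequence acts last, on the point coded by the remaining letters.\<close>

lemma coding_map_first:
  assumes \<omega>: "\<And>j. j \<ge> 1 \<Longrightarrow> \<omega> j \<in> I j"
  shows "coding_map X f \<omega> = f 1 (\<omega> 1) (coding_map X (\<lambda>k. f (1 + k)) (\<lambda>k. \<omega> (1 + k)))"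
proof (rule coding_map_eqI[OF \<omega>])
  interpret S: nonautonomous_ifs X "\<lambda>k. I (1 + k)" "\<lambda>k. f (1 + k)"
    by (rule shift)
  let ?y = "coding_map X (\<lambda>k. f (1 + k)) (\<lambda>k. \<omega> (1 + k))"
  fix k
  show "f 1 (\<omega> 1) ?y \<in> word_map f 0 (map \<omega> [1..<Suc k]) ` X"
  proof (cases k)
    case 0
    have "?y \<in> X"
      using S.coding_map_in[of "\<lambda>k. \<omega> (1 + k)" 0] \<omega> by simp
    then show ?thesis
      using 0 maps_into[of 1 "\<omega> 1"] \<omega>[of 1] by auto
  next
    case (Suc m)
    have "[1..<Suc k] = 1 # map Suc [1..<Suc m]"
      using Suc by (simp only: map_Suc_upt) (simp add: upt_conv_Cons)
    then have "map \<omega> [1..<Suc k] = \<omega> 1 # map (\<lambda>k. \<omega> (1 + k)) [1..<Suc m]"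
      by simp
    then have "word_map f 0 (map \<omega> [1..<Suc k]) =
        f 1 (\<omega> 1) \<circ> word_map (\<lambda>k. f (1 + k)) 0 (map (\<lambda>k. \<omega> (1 + k)) [1..<Suc m])"
      using word_map_shift[of f 1 0] by (simp del: upt_Suc)
    moreover have "?y \<in> word_map (\<lambda>k. f (1 + k)) 0 (map (\<lambda>k. \<omega> (1 + k)) [1..<Suc m]) ` X"
      using S.coding_map_in[of "\<lambda>k. \<omega> (1 + k)" m] \<omega> by simp
    ultimately show ?thesis
      by (auto simp del: upt_Suc)
  qed
qed

lemma limit_set_first: "limit_set X I f = (\<Union>i\<in>I 1. f 1 i ` shifted_limit_set X I f 1)"
proof (rule equalityI; rule subsetI)
  interpret S: nonautonomous_ifs X "\<lambda>k. I (1 + k)" "\<lambda>k. f (1 + k)"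
    by (rule shift)
  fix x assume "x \<in> limit_set X I f"
  then obtain \<omega> where \<omega>: "\<And>j. j \<ge> 1 \<Longrightarrow> \<omega> j \<in> I j" "x = coding_map X f \<omega>"
    unfolding limit_set_iff by blast
  have "\<forall>j\<ge>1. \<omega> (1 + j) \<in> I (1 + j)"
    using \<omega>(1) by simp
  then have "coding_map X (\<lambda>k. f (1 + k)) (\<lambda>k. \<omega> (1 + k)) \<in> shifted_limit_set X I f 1"
    unfolding shifted_limit_set_def S.limit_set_iff by (intro exI[of _ "\<lambda>k. \<omega> (1 + k)"]) simp
  then show "x \<in> (\<Union>i\<in>I 1. f 1 i ` shifted_limit_set X I f 1)"
    using coding_map_first[OF \<omega>(1)] \<omega>(1)[of 1] \<omega>(2) by blast
next
  interpret S: nonautonomous_ifs X "\<lambda>k. I (1 + k)" "\<lambda>k. f (1 + k)"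
    by (rule shift)
  fix x assume "x \<in> (\<Union>i\<in>I 1. f 1 i ` shifted_limit_set X I f 1)"
  then obtain i y where i: "i \<in> I 1" "y \<in> shifted_limit_set X I f 1" "x = f 1 i y"
    by blast
  then obtain \<omega> where \<omega>: "\<forall>j\<ge>1. \<omega> j \<in> I (1 + j)" "y = coding_map X (\<lambda>k. f (1 + k)) \<omega>"
    unfolding shifted_limit_set_def S.limit_set_iff by blast
  define \<omega>' where "\<omega>' j = (if j = 1 then i else \<omega> (j - 1))" for j
  have \<omega>': "\<omega>' j \<in> I j" if "j \<ge> 1" for j
    using that \<omega>(1)[rule_format, of "j - 1"] i(1) by (cases "j = 1") (auto simp: \<omega>'_def)
  have *: "map (\<lambda>k. \<omega>' (1 + k)) [1..<Suc k] = map \<omega> [1..<Suc k]" for k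
    by (rule map_cong) (auto simp: \<omega>'_def)
  have "coding_map X (\<lambda>k. f (1 + k)) (\<lambda>k. \<omega>' (1 + k)) = y"
    unfolding \<omega>(2) coding_map_def * ..
  then have "coding_map X f \<omega>' = f 1 (\<omega>' 1) y"
    using coding_map_first[OF \<omega>'] by simp
  then have "coding_map X f \<omega>' = x"
    using i(3) by (simp add: \<omega>'_def)
  then show "x \<in> limit_set X I f"
    unfolding limit_set_iff using \<omega>' by blast
qed

lemma shifted_limit_set_0: "shifted_limit_set X I f 0 = limit_set X I f"
  by (simp add: shifted_limit_set_def)

lemma shifted_limit_set_subset: "shifted_limit_set X I f k \<subseteq> X"
  unfolding shifted_limit_set_def by (rule nonautonomous_ifs.limit_set_subset[OF shift])

lemma shifted_limit_set_nonempty: "shifted_limit_set X I f k \<noteq> {}"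
  unfolding shifted_limit_set_def by (rule nonautonomous_ifs.limit_set_nonempty[OF shift])

lemma shifted_limit_set_first:
  "shifted_limit_set X I f k = (\<Union>i\<in>I (Suc k). f (Suc k) i ` shifted_limit_set X I f (Suc k))"
  using nonautonomous_ifs.limit_set_first[OF shift, of k] by (simp add: shifted_limit_set_def)

text \<open>The piece of the limit set that belongs to the word \<open>v\<close> of length \<open>k\<close>. The nerves of the system are
  the nerves of these pieces.\<close>

definition cylinder :: "nat \<Rightarrow> 'i list \<Rightarrow> 'x set" where
  "cylinder k v = word_map f 0 v ` shifted_limit_set X I f k"

lemma cylinder_children:
  assumes "v \<in> words I 0 k"
  shows "cylinder k v = (\<Union>i\<in>I (Suc k). cylinder (Suc k) (v @ [i]))"
  unfolding cylinder_def using length_words[OF assms]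
  by (subst shifted_limit_set_first) (simp add: word_map_snoc image_UN image_comp)

lemma limit_set_cylinders: "limit_set X I f = (\<Union>v\<in>words I 0 k. cylinder k v)"
proof (induction k)
  case 0
  show ?case by (simp add: cylinder_def shifted_limit_set_0)
next
  case (Suc k)
  have "(\<Union>v\<in>words I 0 (Suc k). cylinder (Suc k) v) =
      (\<Union>v\<in>words I 0 k. \<Union>i\<in>I (Suc k). cylinder (Suc k) (v @ [i]))"
    unfolding words_Suc by blast
  then show ?case
    using Suc cylinder_children by simp
qed

lemma cylinder_subset: "cylinder k v \<subseteq> word_map f 0 v ` X"
  unfolding cylinder_def using shifted_limit_set_subset by blast

lemma cylinder_nonempty: "cylinder k v \<noteq> {}"
  unfolding cylinder_def using shifted_limit_set_nonempty by simp

lemma cylinder_butlast: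
  assumes "w \<in> words I 0 (Suc k)"
  shows "butlast w \<in> words I 0 k" "cylinder (Suc k) w \<subseteq> cylinder k (butlast w)"
proof -
  obtain v i where "w = v @ [i]" "v \<in> words I 0 k" "i \<in> I (Suc k)"
    using assms by (auto simp: words_Suc)
  then show "butlast w \<in> words I 0 k" "cylinder (Suc k) w \<subseteq> cylinder k (butlast w)"
    using cylinder_children by auto
qed

text \<open>A point of the closure lies in the closures of the cylinders of arbitrarily long words, hence
  in those of all prefixes of one infinite word.\<close>

lemma closed_limit_set: "closed (limit_set X I f)"
proof -
  have "x \<in> limit_set X I f" if x: "x \<in> closure (limit_set X I f)" for x
  proof -
    let ?P = "\<lambda>k v. v \<in> words I 0 k \<and> x \<in> closure (cylinder k v)"
    let ?Q = "\<lambda>k v v'. \<exists>i\<in>I (Suc k). v' = v @ [i]"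
    have "\<exists>w. \<forall>k. ?P k (w k) \<and> ?Q k (w k) (w (Suc k))"
    proof (rule dependent_nat_choice)
      show "\<exists>v. ?P 0 v"
        using x by (simp add: cylinder_def shifted_limit_set_0)
      fix v k assume v: "?P k v"
      have "x \<in> closure (\<Union>i\<in>I (Suc k). cylinder (Suc k) (v @ [i]))"
        using v cylinder_children by auto
      then have "x \<in> (\<Union>i\<in>I (Suc k). closure (cylinder (Suc k) (v @ [i])))"
        using closure_finite_UN[of "I (Suc k)" "\<lambda>i. cylinder (Suc k) (v @ [i])"] finite_index by simp
      then obtain i where "i \<in> I (Suc k)" "x \<in> closure (cylinder (Suc k) (v @ [i]))"
        by blast
      then show "\<exists>v'. ?P (Suc k) v' \<and> ?Q k v v'"
        using v by (intro exI[of _ "v @ [i]"]) (auto simp: words_Suc)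
    qed
    then obtain w where w: "\<And>k. w k \<in> words I 0 k" "\<And>k. x \<in> closure (cylinder k (w k))"
        "\<And>k. \<exists>i\<in>I (Suc k). w (Suc k) = w k @ [i]"
      by blast
    define \<omega> where "\<omega> k = last (w k)" for k
    have \<omega>: "\<omega> j \<in> I j" if "j \<ge> 1" for j
      using w(3)[of "j - 1"] that by (auto simp: \<omega>_def)
    have w\<omega>: "w k = map \<omega> [1..<Suc k]" for k
    proof (induction k)
      case 0
      then show ?case using w(1)[of 0] by simp
    next
      case (Suc k)
      obtain i where "w (Suc k) = w k @ [i]"
        using w(3) by blast
      then show ?case
        using Suc by (simp add: \<omega>_def)
    qed
    have "x \<in> word_map f 0 (map \<omega> [1..<Suc k]) ` X" for k
    proof -
      have "closure (cylinder k (w k)) \<subseteq> word_map f 0 (w k) ` X"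
        using cylinder_subset compact_word_map_image[OF w(1) compact_space subset_refl]
        by (intro closure_minimal compact_imp_closed)
      then show ?thesis
        using w(2)[of k] w\<omega>[of k] by auto
    qed
    then have "coding_map X f \<omega> = x"
      using coding_map_eqI \<omega> by blast
    then show ?thesis
      unfolding limit_set_iff using \<omega> by blast
  qed
  then show ?thesis
    using closure_subset_eq by blast
qed

lemma compact_limit_set: "compact (limit_set X I f)"
  using compact_Int_closed[OF compact_space closed_limit_set] limit_set_subset
  by (simp add: Int_absorb1)

lemma compact_cylinder: "v \<in> words I 0 k \<Longrightarrow> compact (cylinder k v)"
  unfolding cylinder_def
  by (rule compact_word_map_image)
    (auto simp: shifted_limit_set_def nonautonomous_ifs.compact_limit_set[OF shift]
      subsetD[OF nonautonomous_ifs.limit_set_subset[OF shift]])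

lemma ifs_nerve_eq: "ifs_nerve X I f 0 k = nerve (words I 0 k) (cylinder k)"
  by (simp add: ifs_nerve_def cylinder_def[abs_def])

end

section \<open>Coverings by neighbourhoods of the cylinders\<close>

text \<open>Sufficiently small neighbourhoods of finitely many closed subsets of a compact set have the same
  nerve as the sets: if the sets of a subfamily have no common point, the sum of the distances to
  them has a positive minimum.\<close>

lemma nerve_thickening:
  fixes F :: "'v \<Rightarrow> 'a::metric_space set"
  assumes W: "finite W" and J: "compact J" "J \<noteq> {}"
    and F: "\<And>v. v \<in> W \<Longrightarrow> closed (F v)" "\<And>v. v \<in> W \<Longrightarrow> F v \<noteq> {}" "\<And>v. v \<in> W \<Longrightarrow> F v \<subseteq> J"
  shows "\<exists>\<delta>>0. \<forall>e. 0 < e \<longrightarrow> e \<le> \<delta> \<longrightarrow> nerve W F = nerve W (\<lambda>v. {x \<in> J. infdist x (F v) < e})"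
proof -
  have "\<exists>\<delta>>0. s \<noteq> {} \<longrightarrow> (\<Inter>v\<in>s. F v) = {} \<longrightarrow> (\<forall>x\<in>J. \<exists>v\<in>s. \<delta> \<le> infdist x (F v))" if s: "s \<in> Pow W" for s
  proof (cases "s \<noteq> {} \<and> (\<Inter>v\<in>s. F v) = {}")
    case True
    define g where "g x = (\<Sum>v\<in>s. infdist x (F v))" for x
    have fin: "finite s" using s W finite_subset by blast
    have "continuous_on J g"
      unfolding g_def by (intro continuous_intros)
    then obtain x0 where x0: "x0 \<in> J" "\<And>x. x \<in> J \<Longrightarrow> g x0 \<le> g x"
      using continuous_attains_inf[OF J] by blast
    have "g x0 > 0"
    proof -
      obtain v where v: "v \<in> s" "x0 \<notin> F v"
        using True by blast
      then have "infdist x0 (F v) > 0"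
        using F(1,2)[of v] s infdist_pos_not_in_closed by blast
      also have "infdist x0 (F v) \<le> g x0"
        unfolding g_def using v(1) fin by (intro member_le_sum) (auto simp: infdist_nonneg)
      finally show ?thesis .
    qed
    have "\<exists>v\<in>s. g x0 / card s \<le> infdist x (F v)" if x: "x \<in> J" for x
    proof (rule ccontr)
      assume "\<not> ?thesis"
      then have "g x < (\<Sum>v\<in>s. g x0 / card s)"
        unfolding g_def using True fin by (intro sum_strict_mono) auto
      then show False
        using x0(2)[OF x] True fin by simp
    qed
    moreover have "g x0 / card s > 0"
      using \<open>g x0 > 0\<close> True fin by (simp add: card_gt_0_iff)
    ultimately show ?thesis by blast
  qed (auto intro: exI[of _ 1])
  then obtain d where d: "\<And>s. s \<in> Pow W \<Longrightarrow> d s > 0"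
      "\<And>s x. s \<in> Pow W \<Longrightarrow> s \<noteq> {} \<Longrightarrow> (\<Inter>v\<in>s. F v) = {} \<Longrightarrow> x \<in> J \<Longrightarrow> \<exists>v\<in>s. d s \<le> infdist x (F v)"
    by metis
  define \<delta> where "\<delta> = Min (d ` Pow W)"
  have fin: "finite (d ` Pow W)" "d ` Pow W \<noteq> {}"
    using W by auto
  have "\<delta> > 0"
    unfolding \<delta>_def using fin d(1) by simp
  moreover have "nerve W F = nerve W (\<lambda>v. {x \<in> J. infdist x (F v) < e})" if e: "0 < e" "e \<le> \<delta>" for e
  proof (rule equalityI; rule subsetI)
    let ?U = "\<lambda>v. {x \<in> J. infdist x (F v) < e}"
    fix s assume s: "s \<in> nerve W F"
    have "F v \<subseteq> ?U v" if "v \<in> s" for v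
      using s that F(3) e(1) unfolding nerve_def by auto
    then have "(\<Inter>v\<in>s. F v) \<subseteq> (\<Inter>v\<in>s. ?U v)"
      by blast
    then show "s \<in> nerve W ?U"
      using s unfolding nerve_def by blast
  next
    let ?U = "\<lambda>v. {x \<in> J. infdist x (F v) < e}"
    fix s assume "s \<in> nerve W ?U"
    then have s: "s \<subseteq> W" "s \<noteq> {}" "finite s" "(\<Inter>v\<in>s. ?U v) \<noteq> {}"
      by (simp_all add: nerve_def)
    then obtain x where x: "\<And>v. v \<in> s \<Longrightarrow> x \<in> ?U v"
      by blast
    have "e \<le> d s"
      using e(2) Min_le[OF fin(1), of "d s"] s(1) unfolding \<delta>_def by auto
    have "(\<Inter>v\<in>s. F v) \<noteq> {}"
    proof
      assume "(\<Inter>v\<in>s. F v) = {}"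
      then obtain v where "v \<in> s" "d s \<le> infdist x (F v)"
        using d(2)[of s x] s(1,2) x by blast
      then show False
        using x[of v] \<open>e \<le> d s\<close> by simp
    qed
    then show "s \<in> nerve W F"
      using s by (simp add: nerve_def)
  qed
  ultimately show ?thesis by blast
qed

context nonautonomous_ifs
begin

text \<open>Radii for level \<open>k\<close> that are so small that thickening the cylinders does not change their nerve.
  The bound \<open>1 / (k + 1)\<close> forces the thickened cylinders to shrink as \<open>k\<close> grows.\<close>

definition good_radius :: "nat \<Rightarrow> real \<Rightarrow> bool" where
  "good_radius k e \<longleftrightarrow> 0 < e \<and> e \<le> 1 / real (Suc k) \<and>
     nerve (words I 0 k) (cylinder k) =
     nerve (words I 0 k) (\<lambda>v. {x \<in> limit_set X I f. infdist x (cylinder k v) < e})"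

text \<open>The neighbourhood of a cylinder in the limit set, for a fixed choice of the radius.\<close>

definition thickened :: "nat \<Rightarrow> 'i list \<Rightarrow> 'x set" where
  "thickened k v = {x \<in> limit_set X I f. infdist x (cylinder k v) < (SOME e. good_radius k e)}"

text \<open>Different words may have the same neighbourhood, so the nerve of this covering may have fewer
  vertices than that of the family \<open>thickened k\<close>.\<close>

definition thickened_covering :: "nat \<Rightarrow> 'x set set" where
  "thickened_covering k = thickened k ` words I 0 k"

lemma cylinder_subset_limit_set: "v \<in> words I 0 k \<Longrightarrow> cylinder k v \<subseteq> limit_set X I f"
  using limit_set_cylinders by blast

lemma good_radius: "good_radius k (SOME e. good_radius k e)"
proof -
  have "\<exists>\<delta>>0. \<forall>e. 0 < e \<longrightarrow> e \<le> \<delta> \<longrightarrow> nerve (words I 0 k) (cylinder k) =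
      nerve (words I 0 k) (\<lambda>v. {x \<in> limit_set X I f. infdist x (cylinder k v) < e})"
    by (intro nerve_thickening finite_words compact_limit_set limit_set_nonempty cylinder_nonempty
        compact_imp_closed compact_cylinder cylinder_subset_limit_set)
  then obtain \<delta> where \<delta>: "\<delta> > 0" "\<And>e. 0 < e \<Longrightarrow> e \<le> \<delta> \<Longrightarrow> nerve (words I 0 k) (cylinder k) =
      nerve (words I 0 k) (\<lambda>v. {x \<in> limit_set X I f. infdist x (cylinder k v) < e})"
    by blast
  have "good_radius k (min \<delta> (1 / real (Suc k)))"
    unfolding good_radius_def
  proof (intro conjI)
    show "nerve (words I 0 k) (cylinder k) = nerve (words I 0 k)
        (\<lambda>v. {x \<in> limit_set X I f. infdist x (cylinder k v) < min \<delta> (1 / real (Suc k))})"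
      by (rule \<delta>(2)) (use \<delta>(1) in auto)
  qed (use \<delta>(1) in auto)
  then show ?thesis by (rule someI)
qed

lemma nerve_thickened: "nerve (words I 0 k) (cylinder k) = nerve (words I 0 k) (thickened k)"
  using good_radius[of k] unfolding good_radius_def thickened_def[abs_def] by blast

lemma cylinder_subset_thickened: "v \<in> words I 0 k \<Longrightarrow> cylinder k v \<subseteq> thickened k v"
  using good_radius[of k] cylinder_subset_limit_set[of v k] unfolding good_radius_def thickened_def by auto

lemma thickened_covering: "thickened_covering k \<in> finite_open_coverings (top_of_set (limit_set X I f))"
  unfolding finite_open_coverings_def
proof (intro CollectI conjI ballI)
  let ?J = "limit_set X I f"
  show "finite (thickened_covering k)"
    by (simp add: thickened_covering_def finite_words)
  show "openin (top_of_set ?J) U" if U: "U \<in> thickened_covering k" for U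
  proof -
    obtain v where v: "U = thickened k v"
      using U unfolding thickened_covering_def by blast
    have "open {x. infdist x (cylinder k v) < (SOME e. good_radius k e)}"
      by (intro open_Collect_less continuous_intros)
    moreover have "U = ?J \<inter> {x. infdist x (cylinder k v) < (SOME e. good_radius k e)}"
      by (auto simp: v thickened_def)
    ultimately show ?thesis
      by (simp add: openin_open_Int)
  qed
  have "limit_set X I f \<subseteq> \<Union>(thickened_covering k)"
    using limit_set_cylinders[of k] cylinder_subset_thickened unfolding thickened_covering_def by blast
  then show "\<Union>(thickened_covering k) = topspace (top_of_set ?J)"
    by (auto simp: thickened_covering_def thickened_def)
qed

lemma thickened_covering_cofinal:
  assumes u: "u \<in> finite_open_coverings (top_of_set (limit_set X I f))"
  shows "\<exists>N. \<forall>n\<ge>N. refined_by u (thickened_covering n)"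
proof -
  let ?J = "limit_set X I f"
  let ?C = "{T. open T \<and> ?J \<inter> T \<in> u}"
  have C: "?J \<subseteq> \<Union>?C"
  proof
    fix x assume "x \<in> ?J"
    then obtain U where U: "U \<in> u" "x \<in> U" "openin (top_of_set ?J) U"
      using u unfolding finite_open_coverings_def by auto
    then obtain T where T: "open T" "U = ?J \<inter> T"
      unfolding openin_open by auto
    then have "T \<in> ?C" "x \<in> T"
      using U(1,2) by auto
    then show "x \<in> \<Union>?C"
      by (rule UnionI)
  qed
  have "open T" if "T \<in> ?C" for T
    using that by simp
  then have "\<exists>e>0. \<forall>x\<in>?J. \<exists>T\<in>?C. ball x e \<subseteq> T"
    by (rule Heine_Borel_lemma[OF compact_limit_set C]) blast+
  then obtain e where e: "e > 0" "\<forall>x\<in>?J. \<exists>T\<in>?C. ball x e \<subseteq> T"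
    by blast
  have "0 < e / 2" using e(1) by simp
  from word_map_small[OF this]
  obtain N where N: "\<forall>k\<ge>N. \<forall>v\<in>words I 0 k. \<forall>x\<in>word_map f 0 v ` X. \<forall>y\<in>word_map f 0 v ` X.
      dist x y < e / 2" ..
  obtain M where M: "1 / real (Suc M) < e / 2"
    using nat_approx_posE[of "e / 2"] e(1) by auto
  have "\<exists>U\<in>u. thickened n v \<subseteq> U" if n: "n \<ge> max N M" and v: "v \<in> words I 0 n" for n v
  proof -
    obtain x where x: "x \<in> cylinder n v"
      using cylinder_nonempty by blast
    obtain T where T: "T \<in> ?C" "ball x e \<subseteq> T"
      using e(2) cylinder_subset_limit_set[OF v] x by blast
    have "thickened n v \<subseteq> ?J \<inter> T"
    proof
      fix y assume y: "y \<in> thickened n v"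
      have "infdist y (cylinder n v) < 1 / real (Suc n)"
        using y good_radius[of n] unfolding thickened_def good_radius_def by auto
      also have "\<dots> \<le> 1 / real (Suc M)"
        using n by (intro divide_left_mono) auto
      also have "\<dots> < e / 2" by (rule M)
      finally have "(INF z\<in>cylinder n v. dist y z) < e / 2"
        by (simp only: infdist_notempty[OF cylinder_nonempty])
      then obtain z where z: "z \<in> cylinder n v" "dist y z < e / 2"
        by (subst (asm) cINF_less_iff) (use cylinder_nonempty bdd_below_image_dist in auto)
      have "dist x z < e / 2"
        using N n v subsetD[OF cylinder_subset x] subsetD[OF cylinder_subset z(1)] by auto
      then have "dist x y < e"
        using z(2) dist_triangle_half_l[of x z e y] by (simp add: dist_commute)
      then show "y \<in> ?J \<inter> T"
        using y T(2) by (auto simp: thickened_def)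
    qed
    then show ?thesis
      using T(1) by blast
  qed
  then show ?thesis
    unfolding refined_by_def thickened_covering_def by (intro exI[of _ "max N M"]) auto
qed

end

section \<open>Comparison of the two limits\<close>

context nonautonomous_ifs
begin

text \<open>The cylinders of level \<open>k\<close> refine the covering \<open>u\<close>.\<close>

definition subordinate :: "nat \<Rightarrow> 'x set set \<Rightarrow> bool" where
  "subordinate k u \<longleftrightarrow> (\<forall>v\<in>words I 0 k. \<exists>U\<in>u. cylinder k v \<subseteq> U)"

text \<open>The vertex map from the words of length \<open>k\<close> to a covering to which level \<open>k\<close> is subordinate. The
  choice does not affect the induced maps.\<close>

definition covering_choice :: "'x set set \<Rightarrow> nat \<Rightarrow> 'i list \<Rightarrow> 'x set" where
  "covering_choice u k v = (SOME U. U \<in> u \<and> cylinder k v \<subseteq> U)"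

lemma covering_choice_nerve_map:
  assumes "subordinate k u"
  shows "nerve_map (words I 0 k) (cylinder k) u (\<lambda>U. U) (covering_choice u k)"
  unfolding nerve_map_def
proof
  fix v assume "v \<in> words I 0 k"
  then have "\<exists>U. U \<in> u \<and> cylinder k v \<subseteq> U"
    using assms unfolding subordinate_def by blast
  then show "covering_choice u k v \<in> u \<and> cylinder k v \<subseteq> covering_choice u k v"
    unfolding covering_choice_def by (rule someI_ex)
qed

lemma butlast_nerve_map: "nerve_map (words I 0 (Suc k)) (cylinder (Suc k)) (words I 0 k) (cylinder k) butlast"
  unfolding nerve_map_def using cylinder_butlast by blast

lemma refinement_nerve_map:
  assumes "refined_by u u'"
  shows "nerve_map u' (\<lambda>U. U) u (\<lambda>U. U) (refinement_projection u)"
  unfolding nerve_map_def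
proof
  fix V assume "V \<in> u'"
  then have "\<exists>U. U \<in> u \<and> V \<subseteq> U"
    using assms unfolding refined_by_def by blast
  then show "refinement_projection u V \<in> u \<and> V \<subseteq> refinement_projection u V"
    unfolding refinement_projection_def by (rule someI_ex)
qed

lemma subordinate_mono:
  assumes "k \<le> m" "subordinate k u"
  shows "subordinate m u"
  using assms
proof (induction m rule: dec_induct)
  case (step m)
  have "\<exists>U\<in>u. cylinder (Suc m) w \<subseteq> U" if w: "w \<in> words I 0 (Suc m)" for w
  proof -
    obtain U where "U \<in> u" "cylinder m (butlast w) \<subseteq> U"
      using step cylinder_butlast(1)[OF w] unfolding subordinate_def by blast
    then show ?thesis
      using cylinder_butlast(2)[OF w] by blast
  qed
  then show ?case
    unfolding subordinate_def by blast
qed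

lemma subordinate_refined:
  assumes "refined_by u u'" "subordinate k u'"
  shows "subordinate k u"
  unfolding subordinate_def
proof
  fix v assume "v \<in> words I 0 k"
  then obtain V where V: "V \<in> u'" "cylinder k v \<subseteq> V"
    using assms(2) unfolding subordinate_def by blast
  then obtain U where "U \<in> u" "V \<subseteq> U"
    using assms(1) unfolding refined_by_def by blast
  then show "\<exists>U\<in>u. cylinder k v \<subseteq> U"
    using V(2) by blast
qed

lemma subordinate_thickened: "subordinate k (thickened_covering k)"
  unfolding subordinate_def thickened_covering_def using cylinder_subset_thickened by blast

lemma thickened_nerve_maps:
  "nerve_map (words I 0 k) (thickened k) (thickened_covering k) (\<lambda>U. U) (thickened k)"
  "nerve_map (thickened_covering k) (\<lambda>U. U) (words I 0 k) (thickened k) (inv_into (words I 0 k) (thickened k))"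
  unfolding nerve_map_def thickened_covering_def
  by (auto simp: inv_into_into f_inv_into_f)

lemma finite_covering: "u \<in> finite_open_coverings Y \<Longrightarrow> finite u"
  by (simp add: finite_open_coverings_def)

lemma nerve_homology_limit_iso:
  "ifs_nerve_homology_limit TYPE('g::ab_group_add) q X I f \<cong>
    cech_homology TYPE('g) q (top_of_set (limit_set X I f))"
proof -
  let ?E = "finite_open_coverings (top_of_set (limit_set X I f))"
  let ?N = "\<lambda>k. nerve (words I 0 k) (cylinder k)"
  let ?A = "\<lambda>k. simplicial_homology TYPE('g) q (?N k)"
  let ?B = "\<lambda>u. simplicial_homology TYPE('g) q (covering_nerve u)"
  let ?h = "\<lambda>m. homology_map q (?N m) butlast :: ('i list list \<Rightarrow> 'g) set \<Rightarrow> _"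
  let ?\<alpha> = "\<lambda>k u. homology_map q (covering_nerve u) (covering_choice u k) :: ('i list list \<Rightarrow> 'g) set \<Rightarrow> _"
  have h_in: "?h m y \<in> carrier (?A m)" if "y \<in> carrier (?A (Suc m))" for m y
    using nerve_homology_hom[OF finite_words finite_words butlast_nerve_map, where 'g = 'g] that
    unfolding hom_def by blast
  have \<alpha>_h: "?\<alpha> m u (?h m y) = ?\<alpha> (Suc m) u y"
    if "u \<in> ?E" "subordinate m u" "y \<in> carrier (?A (Suc m))" for m u y
    using nerve_homology_triangle[OF finite_words finite_words finite_covering[OF that(1)] butlast_nerve_map
        covering_choice_nerve_map[OF that(2)] covering_choice_nerve_map[OF subordinate_mono[OF _ that(2)]] that(3)]
    by (simp add: covering_nerve_def)
  have a_in: "foldr ?h [k..<m] y \<in> carrier (?A k)" if "k \<le> m" "y \<in> carrier (?A m)" for k m y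
    using that by (induction m arbitrary: y rule: dec_induct) (auto intro: h_in)
  have \<alpha>_a: "?\<alpha> k u (foldr ?h [k..<m] y) = ?\<alpha> m u y"
    if "k \<le> m" "u \<in> ?E" "subordinate k u" "y \<in> carrier (?A m)" for k m u y
    using that(1,4)
  proof (induction m arbitrary: y rule: dec_induct)
    case (step m)
    then show ?case
      using \<alpha>_h[OF that(2) subordinate_mono[OF step.hyps(1) that(3)] step.prems] h_in by simp
  qed simp
  have "inverse_limit {1..} (\<le>) ?A (\<lambda>j k. foldr ?h [j..<k]) \<cong>
    inverse_limit ?E refined_by ?B (\<lambda>u u'. homology_map q (covering_nerve u) (refinement_projection u))"
  proof (rule inverse_limit_iso[where P = subordinate and \<alpha> = ?\<alpha> and V = thickened_covering])
    fix k u assume "u \<in> ?E" "subordinate k u"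
    then show "?\<alpha> k u \<in> hom (?A k) (?B u)"
      unfolding covering_nerve_def
      by (intro nerve_homology_hom finite_words covering_choice_nerve_map finite_covering)
  next
    fix k u u' y assume u: "u \<in> ?E" "u' \<in> ?E" "refined_by u u'" "subordinate k u'" and y: "y \<in> carrier (?A k)"
    show "homology_map q (covering_nerve u) (refinement_projection u) (?\<alpha> k u' y) = ?\<alpha> k u y"
      unfolding covering_nerve_def
      by (rule nerve_homology_triangle[OF finite_words finite_covering[OF u(2)] finite_covering[OF u(1)]
            covering_choice_nerve_map[OF u(4)] refinement_nerve_map[OF u(3)]
            covering_choice_nerve_map[OF subordinate_refined[OF u(3,4)]] y])
  next
    fix k :: nat
    show "bij_betw (?\<alpha> k (thickened_covering k)) (carrier (?A k)) (carrier (?B (thickened_covering k)))"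
      unfolding covering_nerve_def
      by (intro nerve_homology_bij[OF _ _ nerve_thickened _ thickened_nerve_maps] finite_words
          finite_covering[OF thickened_covering] cylinder_subset_thickened
          covering_choice_nerve_map subordinate_thickened)
  qed (rule subordinate_mono \<alpha>_a a_in subordinate_refined thickened_covering subordinate_thickened
      thickened_covering_cofinal; assumption)+
  then show ?thesis
    unfolding ifs_nerve_homology_limit_def cech_homology_def ifs_nerve_eq .
qed

lemma nerve_cohomology_limit_iso:
  "ifs_nerve_cohomology_limit TYPE('g::ab_group_add) q X I f \<cong>
    cech_cohomology TYPE('g) q (top_of_set (limit_set X I f))"
proof -
  let ?E = "finite_open_coverings (top_of_set (limit_set X I f))"
  let ?N = "\<lambda>k. nerve (words I 0 k) (cylinder k)"
  let ?A = "\<lambda>k. simplicial_cohomology TYPE('g) q (?N k)"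
  let ?B = "\<lambda>u. simplicial_cohomology TYPE('g) q (covering_nerve u)"
  let ?h = "\<lambda>m. cohomology_map q (?N (Suc m)) butlast :: (('i list list \<Rightarrow> int) \<Rightarrow> 'g) set \<Rightarrow> _"
  let ?a = "\<lambda>j k. fold ?h [j..<k]"
  let ?\<alpha> = "\<lambda>k u. cohomology_map q (?N k) (covering_choice u k) :: (('x set list \<Rightarrow> int) \<Rightarrow> 'g) set \<Rightarrow> _"
  have h_hom: "?h m \<in> hom (?A m) (?A (Suc m))" for m
    by (intro nerve_cohomology_hom finite_words butlast_nerve_map)
  have h_\<alpha>: "?h m (?\<alpha> m u x) = ?\<alpha> (Suc m) u x"
    if "u \<in> ?E" "subordinate m u" "x \<in> carrier (?B u)" for m u x
    using nerve_cohomology_triangle[OF finite_words finite_words finite_covering[OF that(1)] butlast_nerve_map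
        covering_choice_nerve_map[OF that(2)] covering_choice_nerve_map[OF subordinate_mono[OF _ that(2)]]
        that(3)[unfolded covering_nerve_def]]
    by simp
  have a_hom: "?a k m \<in> hom (?A k) (?A m)" if "k \<le> m" for k m
    using that
  proof (induction m rule: dec_induct)
    case base
    show ?case by (simp add: hom_def)
  next
    case (step m)
    have "?a k (Suc m) = ?h m \<circ> ?a k m"
      using step.hyps by (simp add: fun_eq_iff)
    then show ?case
      using hom_compose[OF step.IH h_hom[of m]] by (simp only:)
  qed
  have a_comp: "?a m n (?a k m x) = ?a k n x" if "k \<le> m" "m \<le> n" for k m n x
  proof -
    have "[k..<n] = [k..<m] @ [m..<n]"
      using upt_add_eq_append[OF that(1), of "n - m"] that(2) by simp
    then show ?thesis by simp
  qed
  have a_\<alpha>: "?a k m (?\<alpha> k u x) = ?\<alpha> m u x"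
    if "k \<le> m" "u \<in> ?E" "subordinate k u" "x \<in> carrier (?B u)" for k m u x
    using that(1)
  proof (induction m rule: dec_induct)
    case (step m)
    then show ?case
      using h_\<alpha>[OF that(2) subordinate_mono[OF step.hyps(1) that(3)] that(4)] by simp
  qed simp
  have "direct_limit {1..} (\<le>) ?A ?a \<cong>
    direct_limit ?E refined_by ?B (\<lambda>u u'. cohomology_map q (covering_nerve u') (refinement_projection u))"
  proof (rule direct_limit_iso[where P = subordinate and \<alpha> = ?\<alpha> and V = thickened_covering])
    fix k u assume "u \<in> ?E" "subordinate k u"
    then show "?\<alpha> k u \<in> hom (?B u) (?A k)"
      unfolding covering_nerve_def
      by (intro nerve_cohomology_hom finite_words covering_choice_nerve_map finite_covering)
  next
    fix k x y assume "x \<in> carrier (?A k)" "y \<in> carrier (?A k)"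
    then show "x \<otimes>\<^bsub>?A k\<^esub> y \<in> carrier (?A k)"
      using simplicial_cohomology_closed[OF finite_complex_nerve[OF finite_words]] by blast
  next
    fix u x y assume "u \<in> ?E" "x \<in> carrier (?B u)" "y \<in> carrier (?B u)"
    then show "x \<otimes>\<^bsub>?B u\<^esub> y \<in> carrier (?B u)"
      using simplicial_cohomology_closed[OF finite_complex_nerve[OF finite_covering]]
      unfolding covering_nerve_def by blast
  next
    fix u u' x assume "u \<in> ?E" "u' \<in> ?E" "refined_by u u'" and x: "x \<in> carrier (?B u)"
    then have "cohomology_map q (covering_nerve u') (refinement_projection u) \<in> hom (?B u) (?B u')"
      unfolding covering_nerve_def
      by (intro nerve_cohomology_hom refinement_nerve_map finite_covering)
    then show "cohomology_map q (covering_nerve u') (refinement_projection u) x \<in> carrier (?B u')"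
      using x unfolding hom_def by blast
  next
    fix k u u' x assume u: "u \<in> ?E" "u' \<in> ?E" "refined_by u u'" "subordinate k u'" and x: "x \<in> carrier (?B u)"
    show "?\<alpha> k u' (cohomology_map q (covering_nerve u') (refinement_projection u) x) = ?\<alpha> k u x"
      unfolding covering_nerve_def
      by (rule nerve_cohomology_triangle[OF finite_words finite_covering[OF u(2)] finite_covering[OF u(1)]
            covering_choice_nerve_map[OF u(4)] refinement_nerve_map[OF u(3)]
            covering_choice_nerve_map[OF subordinate_refined[OF u(3,4)]] x[unfolded covering_nerve_def]])
  next
    fix k :: nat
    show "bij_betw (?\<alpha> k (thickened_covering k)) (carrier (?B (thickened_covering k))) (carrier (?A k))"
      unfolding covering_nerve_def
      by (intro nerve_cohomology_bij[OF _ _ nerve_thickened _ thickened_nerve_maps] finite_words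
          finite_covering[OF thickened_covering] cylinder_subset_thickened
          covering_choice_nerve_map subordinate_thickened)
  qed (rule subordinate_mono a_hom a_comp a_\<alpha> subordinate_refined thickened_covering subordinate_thickened
      thickened_covering_cofinal; assumption)+
  then show ?thesis
    unfolding ifs_nerve_cohomology_limit_def cech_cohomology_def ifs_nerve_eq .
qed

end

theorem theorem2:
  fixes X :: "'x::metric_space set"
    and I :: "nat \<Rightarrow> 'i set"
    and f :: "nat \<Rightarrow> 'i \<Rightarrow> 'x \<Rightarrow> 'x"
  assumes "nonautonomous_ifs X I f"
  shows "(\<forall>q. ifs_nerve_homology_limit TYPE('g::ab_group_add) q X I f
               \<cong> cech_homology TYPE('g) q (top_of_set (limit_set X I f))) \<and>
         (\<forall>q. ifs_nerve_cohomology_limit TYPE('g) q X I f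
               \<cong> cech_cohomology TYPE('g) q (top_of_set (limit_set X I f)))"
  using nonautonomous_ifs.nerve_homology_limit_iso[OF assms]
    nonautonomous_ifs.nerve_cohomology_limit_iso[OF assms] by blast

end
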